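(* Let $n,N$ be positive integers, $\lambda\in\mathcal{O}(n,N)$, $\Lambda\in\mathcal{L}(\lambda,n)$ and $k\in\{1,\dots,n-1\}$. Suppose that $\Lambda(k-1)\neq\Lambda(k+1)$. Then $\bar s_k\cdot v(\Lambda)=0$ in $V(\lambda,n)$.
   Context: Brauer algebra. For $n\ge1$ let $\mathcal{G}(n)$ be the set of partitions of $\{1,\dots,n,\bar1,\dots,\bar n\}$ into pairs (graphs with $n$ edges). $B(n,N)$ is the complex associative algebra with basis $b(\gamma)$, $\gamma\in\mathcal{G}(n)$, and product $b(\gamma)b(\gamma')=N^{q}b(\gamma\circ\gamma')$: identify the vertices $\bar1,\dots,\bar n$ of $\gamma$ with $1,\dots,n$ of $\gamma'$, let $q$ be the number of loops, remove the loops and replace the other components by single edges joining their terminal vertices to get $\gamma\circ\gamma'$. For $k\neq l$, $(k,l)$ denotes the transposition in $S(n)\subset B(n,N)$ (a permutation $s$ is $b(\gamma)$, $\gamma$ having edges $\{s(m),\bar m\}$) and $\overline{(k,l)}=b(\gamma)$ with $\gamma$ having edges $\{k,l\},\{\bar k,\bar l\}$ and $\{m,\bar m\}$, $m\ne k,l$. Put $\bar s_k=\overline{(k,k+1)}$. $B(n-1,N)\subset B(n,N)$ is spanned by the $b(\gamma)$ with $\{n,\bar n\}\in\gamma$. Representations. $N$ is a positive integer, $U=\mathbb{C}^N$ with standard orthonormal basis $u(1),\dots,u(N)$, $G=O(N,\mathbb{C})$, $C(n,N)=\operatorname{End}_G(U^{\otimes n})$. $B(n,N)$ maps onto $C(n,N)$: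 $(k,l)$ permutes the $k$-th and $l$-th tensor factors, and $\overline{(k,l)}$ sends $u(i_1)\otimes\cdots\otimes u(i_n)$ to $\delta_{i_k i_l}\sum_{i=1}^N$ of the same tensor with both the $k$-th and $l$-th factors replaced by $u(i)$. $\mathcal{O}(n,N)$ is the set of Young diagrams with at most $N$ boxes in the first two columns together and with $n-2r$ boxes in total, $r=0,1,\dots,[n/2]$. For such a diagram $\lambda$ with $m$ boxes, $U(\lambda,N)$ is Weyl's irreducible representation of $G$: the space of traceless tensors in $U^{\otimes m}$ (those killed by all $\overline{(k,l)}$) decomposes under $G\times S(m)$ as $\bigoplus_\lambda U(\lambda,N)\otimes S^\lambda$, over diagrams $\lambda$ with $m$ boxes and at most $N$ boxes in the first two columns, $S^\lambda$ being the irreducible $S(m)$-module of $\lambda$ (trivial for a one-row diagram). One has $U^{\otimes n}=\bigoplus_{\lambda\in\mathcal{O}(n,N)}U(\lambda,N)\otimes V(\lambda,n)$ with $V(\lambda,n)$ the irreducible $C(n,N)$-modules, also regarded as $B(n,N)$-modules. The restriction of $V(\lambda,n)$ to $C(n-1,N)$ is the multiplicity-free direct sum of $V(\mu,n-1)$ over $\mu\in\mathcal{O}(n-1,N)$ obtained from $\lambda$ by removing or adding one box. Canonical basis. $\mathcal{L}(\lambda,n)$ is the set of sequences $\Lambda=(\Lambda(1),\dots,\Lambda(n))\in\mathcal{O}(1,N)\times\cdots\times\mathcal{O}(n,N)$ with $\Lambda(n)=\lambda$ and neighbouring terms differing by exactly one box; $\Lambda(0)$ is the empty diagram. The canonical basis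 of $V(\lambda,n)$ consists of vectors $v(\Lambda)$, $\Lambda\in\mathcal{L}(\lambda,n)$, determined up to nonzero scalars by: $v(\Lambda)$ lies in the component $V(\Lambda(k),k)$ of the restriction of $V(\lambda,n)$ to $C(k,N)$ for every $k=1,\dots,n-1$. *)

theory Defs
  imports
    Complex_Main
    "HOL-Library.FuncSet"
    "HOL-Library.Disjoint_Sets"
    "HOL-Library.Function_Algebras"
    "HOL-Combinatorics.Permutations"
    "Jordan_Normal_Form.Matrix"
begin

class complex_vector = ab_group_add +
  fixes scaleC :: "complex \<Rightarrow> 'a \<Rightarrow> 'a"  (infixr "*\<^sub>C" 75)
  assumes scaleC_add_right: "a *\<^sub>C (x + y) = a *\<^sub>C x + a *\<^sub>C y"
    and scaleC_add_left: "(a + b) *\<^sub>C x = a *\<^sub>C x + b *\<^sub>C x"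
    and scaleC_scaleC: "a *\<^sub>C (b *\<^sub>C x) = (a * b) *\<^sub>C x"
    and scaleC_one: "1 *\<^sub>C x = x"

instantiation complex :: complex_vector
begin
definition scaleC_complex :: "complex \<Rightarrow> complex \<Rightarrow> complex" where
  "scaleC_complex a x = a * x"
instance
  by standard (simp_all add: scaleC_complex_def algebra_simps)
end

instantiation "fun" :: (type, complex_vector) complex_vector
begin
definition scaleC_fun :: "complex \<Rightarrow> ('a \<Rightarrow> 'b) \<Rightarrow> 'a \<Rightarrow> 'b" where
  "scaleC_fun a f = (\<lambda>x. a *\<^sub>C f x)"
instance
  by standard
    (simp_all add: scaleC_fun_def fun_eq_iff scaleC_add_right scaleC_add_left scaleC_scaleC scaleC_one)
end

global_interpretation cvec: vector_space "scaleC :: complex \<Rightarrow> 'a \<Rightarrow> 'a::complex_vector"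
  defines csubspace = cvec.subspace and cspan = cvec.span
  by standard (simp_all add: scaleC_add_right scaleC_add_left scaleC_scaleC scaleC_one)

definition linear_on :: "'v::complex_vector set \<Rightarrow> ('v \<Rightarrow> 'w::complex_vector) \<Rightarrow> bool" where
  "linear_on V f \<longleftrightarrow>
     (\<forall>x\<in>V. \<forall>y\<in>V. f (x + y) = f x + f y) \<and> (\<forall>c. \<forall>x\<in>V. f (c *\<^sub>C x) = c *\<^sub>C f x)"

text \<open>
  \<open>Hom A \<alpha> V \<beta> W\<close> is the space of linear maps \<open>V \<rightarrow> W\<close> that intertwine the actions \<open>\<alpha>\<close> and \<open>\<beta>\<close>
  of the elements of \<open>A\<close>.  Maps are made unique by the value 0 outside \<open>V\<close>, so that pointwise
  operations turn \<open>Hom A \<alpha> V \<beta> W\<close> into a subspace of the function space.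
\<close>
definition Hom :: "'a set \<Rightarrow> ('a \<Rightarrow> 'v \<Rightarrow> 'v) \<Rightarrow> 'v::complex_vector set \<Rightarrow>
    ('a \<Rightarrow> 'w \<Rightarrow> 'w) \<Rightarrow> 'w::complex_vector set \<Rightarrow> ('v \<Rightarrow> 'w) set" where
  "Hom A \<alpha> V \<beta> W =
     {f. linear_on V f \<and> f ` V \<subseteq> W \<and> (\<forall>a\<in>A. \<forall>x\<in>V. f (\<alpha> a x) = \<beta> a (f x)) \<and> (\<forall>x. x \<notin> V \<longrightarrow> f x = 0)}"

definition submodules :: "'a set \<Rightarrow> ('a \<Rightarrow> 'v \<Rightarrow> 'v) \<Rightarrow> 'v::complex_vector set \<Rightarrow> 'v set set" where
  "submodules A \<alpha> V = {W. W \<subseteq> V \<and> csubspace W \<and> (\<forall>a\<in>A. \<alpha> a ` W \<subseteq> W)}"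

definition isomorphic_modules :: "'a set \<Rightarrow> ('a \<Rightarrow> 'v \<Rightarrow> 'v) \<Rightarrow> 'v::complex_vector set \<Rightarrow>
    ('a \<Rightarrow> 'w \<Rightarrow> 'w) \<Rightarrow> 'w::complex_vector set \<Rightarrow> bool" where
  "isomorphic_modules A \<alpha> V \<beta> W \<longleftrightarrow> (\<exists>f \<in> Hom A \<alpha> V \<beta> W. bij_betw f V W)"

text \<open>
  A tensor in the \<open>n\<close>-th tensor power of \<open>U = \<complex>\<^sup>N\<close> is given by its coordinates: the coefficient
  of \<open>u(i 1) \<otimes> \<dots> \<otimes> u(i n)\<close> is the value at \<open>i\<close>.  The places are numbered \<open>1, \<dots>, n\<close>; the basis
  vectors of \<open>U\<close> are numbered from 0, as are the rows and columns of matrices in the library.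
\<close>
type_synonym tensor = "(nat \<Rightarrow> nat) \<Rightarrow> complex"

definition multi_indices :: "nat \<Rightarrow> nat \<Rightarrow> (nat \<Rightarrow> nat) set" where
  "multi_indices N n = {1..n} \<rightarrow>\<^sub>E {..<N}"

definition tensors :: "nat \<Rightarrow> nat \<Rightarrow> tensor set" where
  "tensors N n = {t. \<forall>i. i \<notin> multi_indices N n \<longrightarrow> t i = 0}"

definition orthogonal_group :: "nat \<Rightarrow> complex mat set" where
  "orthogonal_group N = {g \<in> carrier_mat N N. transpose_mat g * g = 1\<^sub>m N}"

definition tensor_power :: "nat \<Rightarrow> nat \<Rightarrow> complex mat \<Rightarrow> tensor \<Rightarrow> tensor" where
  "tensor_power N n g t = (\<lambda>i. if i \<in> multi_indices N n
     then \<Sum>j \<in> multi_indices N n. (\<Prod>m=1..n. g $$ (i m, j m)) * t j else 0)"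

definition centralizer_algebra :: "nat \<Rightarrow> nat \<Rightarrow> (tensor \<Rightarrow> tensor) set" where
  "centralizer_algebra N n =
     Hom (orthogonal_group N) (tensor_power N n) (tensors N n) (tensor_power N n) (tensors N n)"

text \<open>
  The embedding \<open>X \<mapsto> X \<otimes> 1\<close> of the operators on the \<open>k\<close>-th tensor power into those on the
  \<open>n\<close>-th, \<open>k \<le> n\<close>: the indices at the places \<open>k+1, \<dots>, n\<close> are kept fixed and \<open>X\<close> is applied to the
  remaining tensor of degree \<open>k\<close>.
\<close>
definition ampliation :: "nat \<Rightarrow> nat \<Rightarrow> nat \<Rightarrow> (tensor \<Rightarrow> tensor) \<Rightarrow> tensor \<Rightarrow> tensor" where
  "ampliation N k n X t = (\<lambda>i. if i \<in> multi_indices N n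
     then X (\<lambda>j. if j \<in> multi_indices N k then t (\<lambda>m. if m \<in> {1..k} then j m else i m) else 0)
            (restrict i {1..k})
     else 0)"

datatype vertex = Plain nat | Bar nat

type_synonym brauer_diagram = "vertex set set"

definition brauer_diagrams :: "nat \<Rightarrow> brauer_diagram set" where
  "brauer_diagrams n =
     {\<gamma>. partition_on (Plain ` {1..n} \<union> Bar ` {1..n}) \<gamma> \<and> (\<forall>e\<in>\<gamma>. card e = 2)}"

type_synonym brauer_element = "brauer_diagram \<Rightarrow> complex"

definition brauer_algebra :: "nat \<Rightarrow> brauer_element set" where
  "brauer_algebra n = {x. \<forall>\<gamma>. \<gamma> \<notin> brauer_diagrams n \<longrightarrow> x \<gamma> = 0}"

definition brauer_basis :: "brauer_diagram \<Rightarrow> brauer_element" where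
  "brauer_basis \<gamma> = (\<lambda>\<delta>. if \<delta> = \<gamma> then 1 else 0)"

text \<open>
  For the product of \<open>b(\<gamma>)\<close> and \<open>b(\<gamma>')\<close> the barred vertices of \<open>\<gamma>\<close> and the plain vertices of \<open>\<gamma>'\<close>
  become the middle nodes of one graph; the connected components consisting of middle
  nodes are the loops, and each other component is contracted to its terminal vertices.
\<close>
datatype node = Upper nat | Middle nat | Lower nat

fun upper_part :: "vertex \<Rightarrow> node" where
  "upper_part (Plain k) = Upper k"
| "upper_part (Bar k) = Middle k"

fun lower_part :: "vertex \<Rightarrow> node" where
  "lower_part (Plain k) = Middle k"
| "lower_part (Bar k) = Lower k"

fun outer_part :: "vertex \<Rightarrow> node" where
  "outer_part (Plain k) = Upper k"
| "outer_part (Bar k) = Lower k"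

definition glued_components :: "nat \<Rightarrow> brauer_diagram \<Rightarrow> brauer_diagram \<Rightarrow> node set set" where
  "glued_components n \<gamma> \<gamma>' =
     (Upper ` {1..n} \<union> Middle ` {1..n} \<union> Lower ` {1..n}) //
     ((\<Union>e\<in>\<gamma>. upper_part ` e \<times> upper_part ` e) \<union> (\<Union>e\<in>\<gamma>'. lower_part ` e \<times> lower_part ` e))\<^sup>*"

definition loops :: "nat \<Rightarrow> brauer_diagram \<Rightarrow> brauer_diagram \<Rightarrow> nat" where
  "loops n \<gamma> \<gamma>' = card {c \<in> glued_components n \<gamma> \<gamma>'. c \<subseteq> range Middle}"

definition brauer_comp :: "nat \<Rightarrow> brauer_diagram \<Rightarrow> brauer_diagram \<Rightarrow> brauer_diagram" where
  "brauer_comp n \<gamma> \<gamma>' = {outer_part -` c |c. c \<in> glued_components n \<gamma> \<gamma>' \<and> \<not> c \<subseteq> range Middle}"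

definition brauer_mult :: "nat \<Rightarrow> nat \<Rightarrow> brauer_element \<Rightarrow> brauer_element \<Rightarrow> brauer_element" where
  "brauer_mult n N x y = (\<Sum>\<gamma>\<in>brauer_diagrams n. \<Sum>\<gamma>'\<in>brauer_diagrams n.
     (x \<gamma> * y \<gamma>' * of_nat N ^ loops n \<gamma> \<gamma>') *\<^sub>C brauer_basis (brauer_comp n \<gamma> \<gamma>'))"

definition sym_group :: "nat \<Rightarrow> (nat \<Rightarrow> nat) set" where
  "sym_group m = {s. s permutes {1..m}}"

definition perm_diagram :: "nat \<Rightarrow> (nat \<Rightarrow> nat) \<Rightarrow> brauer_diagram" where
  "perm_diagram n s = {{Plain (s m), Bar m} |m. m \<in> {1..n}}"

definition contraction_diagram :: "nat \<Rightarrow> nat \<Rightarrow> nat \<Rightarrow> brauer_diagram" where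
  "contraction_diagram n k l =
     {{Plain k, Plain l}, {Bar k, Bar l}} \<union> {{Plain m, Bar m} |m. m \<in> {1..n} - {k, l}}"

definition sbar :: "nat \<Rightarrow> nat \<Rightarrow> brauer_element" where
  "sbar n k = brauer_basis (contraction_diagram n k (k + 1))"

text \<open>
  \<open>b(\<gamma>)\<close> acts on tensors by the matrix whose entry in row \<open>i\<close>, column \<open>j\<close> is 1 if attaching
  \<open>i 1, \<dots>, i n\<close> to the plain and \<open>j 1, \<dots>, j n\<close> to the barred vertices gives the same label to the
  two ends of every edge, and 0 otherwise.  The lemmas \<open>diagram_operator_comp\<close>,
  \<open>perm_operator_apply\<close> and \<open>contraction_apply\<close> show that this respects the product and is the
  usual action of the permutations and of the diagrams \<open>contraction_diagram n k l\<close>.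
\<close>
definition compatible :: "brauer_diagram \<Rightarrow> (nat \<Rightarrow> nat) \<Rightarrow> (nat \<Rightarrow> nat) \<Rightarrow> bool" where
  "compatible \<gamma> i j \<longleftrightarrow> (\<forall>e\<in>\<gamma>. \<forall>x\<in>e. \<forall>y\<in>e. case_vertex i j x = case_vertex i j y)"

definition diagram_operator :: "nat \<Rightarrow> nat \<Rightarrow> brauer_diagram \<Rightarrow> tensor \<Rightarrow> tensor" where
  "diagram_operator N n \<gamma> t = (\<lambda>i. if i \<in> multi_indices N n
     then \<Sum>j \<in> multi_indices N n. if compatible \<gamma> i j then t j else 0 else 0)"

definition brauer_operator :: "nat \<Rightarrow> nat \<Rightarrow> brauer_element \<Rightarrow> tensor \<Rightarrow> tensor" where
  "brauer_operator N n x t = (\<Sum>\<gamma>\<in>brauer_diagrams n. x \<gamma> *\<^sub>C diagram_operator N n \<gamma> t)"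

definition perm_operator :: "nat \<Rightarrow> nat \<Rightarrow> (nat \<Rightarrow> nat) \<Rightarrow> tensor \<Rightarrow> tensor" where
  "perm_operator N n s = brauer_operator N n (brauer_basis (perm_diagram n s))"

definition traceless_tensors :: "nat \<Rightarrow> nat \<Rightarrow> tensor set" where
  "traceless_tensors N n = {t \<in> tensors N n. \<forall>k\<in>{1..n}. \<forall>l\<in>{1..n}. k \<noteq> l \<longrightarrow>
     brauer_operator N n (brauer_basis (contraction_diagram n k l)) t = 0}"

lemma finite_multi_indices: "finite (multi_indices N n)"
  by (simp add: multi_indices_def finite_PiE)

lemma finite_brauer_diagrams: "finite (brauer_diagrams n)"
proof (rule finite_subset)
  show "brauer_diagrams n \<subseteq> Pow (Pow (Plain ` {1..n} \<union> Bar ` {1..n}))"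
    by (auto simp: brauer_diagrams_def partition_on_def)
qed simp

lemma brauer_operator_basis:
  assumes "\<gamma> \<in> brauer_diagrams n"
  shows "brauer_operator N n (brauer_basis \<gamma>) t = diagram_operator N n \<gamma> t"
proof -
  have "brauer_operator N n (brauer_basis \<gamma>) t
      = (\<Sum>\<delta>\<in>brauer_diagrams n. if \<delta> = \<gamma> then diagram_operator N n \<gamma> t else 0)"
    unfolding brauer_operator_def
    by (rule sum.cong) (simp_all add: brauer_basis_def scaleC_one)
  then show ?thesis
    using assms by (simp add: finite_brauer_diagrams)
qed

lemma perm_diagram_in:
  assumes "s \<in> sym_group n"
  shows "perm_diagram n s \<in> brauer_diagrams n"
proof -
  have s: "s permutes {1..n}" using assms by (simp add: sym_group_def)
  have in_range: "s m \<in> {1..n} \<longleftrightarrow> m \<in> {1..n}" for m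
    using permutes_in_image[OF s] .
  have eq: "s m = s m' \<longleftrightarrow> m = m'" for m m'
    using permutes_inj[OF s] by (auto dest: injD)
  have "\<exists>m\<in>{1..n}. k = s m" if "k \<in> {1..n}" for k
    using permutes_image[OF s] that by (metis imageE)
  then have un: "\<Union> (perm_diagram n s) = Plain ` {1..n} \<union> Bar ` {1..n}"
    using in_range unfolding perm_diagram_def by blast
  have "disjoint (perm_diagram n s)"
    by (auto simp: perm_diagram_def disjoint_def eq)
  moreover have "{} \<notin> perm_diagram n s"
    by (auto simp: perm_diagram_def)
  moreover have "\<forall>e\<in>perm_diagram n s. card e = 2"
    by (auto simp: perm_diagram_def)
  ultimately show ?thesis
    using un by (simp add: brauer_diagrams_def partition_on_def)
qed

lemma contraction_diagram_in:
  assumes "k \<in> {1..n}" "l \<in> {1..n}" "k \<noteq> l"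
  shows "contraction_diagram n k l \<in> brauer_diagrams n"
proof -
  have "\<Union> (contraction_diagram n k l) = Plain ` {1..n} \<union> Bar ` {1..n}"
    using assms unfolding contraction_diagram_def by blast
  moreover have "disjoint (contraction_diagram n k l)"
    by (auto simp: contraction_diagram_def disjoint_def)
  moreover have "{} \<notin> contraction_diagram n k l"
    by (auto simp: contraction_diagram_def)
  moreover have "\<forall>e\<in>contraction_diagram n k l. card e = 2"
    using assms by (auto simp: contraction_diagram_def)
  ultimately show ?thesis
    by (simp add: brauer_diagrams_def partition_on_def)
qed

lemma sbar_in:
  assumes "k \<in> {1..<n}"
  shows "sbar n k \<in> brauer_algebra n"
  using contraction_diagram_in[of k n "k + 1"] assms
  by (auto simp: sbar_def brauer_algebra_def brauer_basis_def)

lemma perm_operator_apply: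
  assumes "s \<in> sym_group n" "i \<in> multi_indices N n"
  shows "perm_operator N n s t i = t (i \<circ> s)"
proof -
  have s: "s permutes {1..n}" using assms by (simp add: sym_group_def)
  have in_range: "s m \<in> {1..n} \<longleftrightarrow> m \<in> {1..n}" for m
    using permutes_in_image[OF s] .
  have fix_out: "s m = m" if "m \<notin> {1..n}" for m
    using permutes_not_in[OF s that] .
  have is_in: "i \<circ> s \<in> multi_indices N n"
    using assms(2) in_range fix_out
    by (auto simp: multi_indices_def PiE_def Pi_def extensional_def)
  have compat: "compatible (perm_diagram n s) i j \<longleftrightarrow> j = i \<circ> s" if "j \<in> multi_indices N n" for j
  proof
    assume "compatible (perm_diagram n s) i j"
    then have *: "case_vertex i j x = case_vertex i j y"
      if "e \<in> perm_diagram n s" "x \<in> e" "y \<in> e" for e x y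
      using that unfolding compatible_def by blast
    have "i (s m) = j m" if "m \<in> {1..n}" for m
      using that *[of "{Plain (s m), Bar m}" "Plain (s m)" "Bar m"]
      by (auto simp: perm_diagram_def)
    moreover have "j m = undefined" "i m = undefined" if "m \<notin> {1..n}" for m
      using \<open>j \<in> multi_indices N n\<close> assms(2) that PiE_arb unfolding multi_indices_def by metis+
    ultimately show "j = i \<circ> s"
      using fix_out by (metis comp_apply ext)
  qed (auto simp: compatible_def perm_diagram_def)
  have "perm_operator N n s t i = (\<Sum>j \<in> multi_indices N n. if j = i \<circ> s then t j else 0)"
    unfolding perm_operator_def brauer_operator_basis[OF perm_diagram_in[OF assms(1)]]
      diagram_operator_def using assms(2) compat by (auto intro: sum.cong)
  then show ?thesis
    using is_in by (simp add: finite_multi_indices)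
qed

lemma contraction_apply:
  assumes "k \<in> {1..n}" "l \<in> {1..n}" "k \<noteq> l" "j \<in> multi_indices N n"
  shows "brauer_operator N n (brauer_basis (contraction_diagram n k l)) (\<lambda>i. if i = j then 1 else 0)
    = (if j k = j l then \<Sum>a<N. (\<lambda>i. if i = j(k := a, l := a) then 1 else 0) else 0)"
proof
  fix i
  let ?C = "\<lambda>i. i k = i l \<and> j k = j l \<and> (\<forall>m\<in>{1..n} - {k, l}. i m = j m)"
  have compat: "compatible (contraction_diagram n k l) i j \<longleftrightarrow> ?C i"
  proof
    assume "compatible (contraction_diagram n k l) i j"
    then have *: "case_vertex i j x = case_vertex i j y"
      if "e \<in> contraction_diagram n k l" "x \<in> e" "y \<in> e" for e x y
      using that unfolding compatible_def by blast
    have "i m = j m" if "m \<in> {1..n} - {k, l}" for m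
      using that *[of "{Plain m, Bar m}" "Plain m" "Bar m"] by (auto simp: contraction_diagram_def)
    moreover have "i k = i l" "j k = j l"
      using *[of "{Plain k, Plain l}" "Plain k" "Plain l"] *[of "{Bar k, Bar l}" "Bar k" "Bar l"]
      by (simp_all add: contraction_diagram_def)
    ultimately show "?C i" by blast
  next
    assume "?C i"
    then show "compatible (contraction_diagram n k l) i j"
      by (auto simp: compatible_def contraction_diagram_def)
  qed
  have l: "brauer_operator N n (brauer_basis (contraction_diagram n k l)) (\<lambda>i. if i = j then 1 else 0) i
    = (if i \<in> multi_indices N n \<and> ?C i then 1 else 0)"
    (is "?L = _")
  proof -
    have "?L = (if i \<in> multi_indices N n then \<Sum>j' \<in> multi_indices N n. if j' = j then
        (if compatible (contraction_diagram n k l) i j then 1 else 0) else 0 else 0)"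
      unfolding brauer_operator_basis[OF contraction_diagram_in[OF assms(1-3)]] diagram_operator_def
      by (rule if_cong[OF refl _ refl], rule sum.cong[OF refl]) simp
    then show ?thesis
      using assms(4) compat by (simp add: finite_multi_indices)
  qed
  have upd: "i \<in> multi_indices N n \<and> ?C i \<longleftrightarrow> j k = j l \<and> i k < N \<and> i = j(k := i k, l := i k)"
    (is "?A \<longleftrightarrow> ?B")
  proof
    assume A: ?A
    have "i m = (j(k := i k, l := i k)) m" for m
    proof (cases "m \<in> {1..n}")
      case True
      then show ?thesis using A by auto
    next
      case False
      then have "i m = undefined" "j m = undefined"
        using A assms(4) PiE_arb unfolding multi_indices_def by metis+
      then show ?thesis using False assms(1,2) by auto
    qed
    then have "i = j(k := i k, l := i k)" by (rule ext)
    moreover have "i k < N"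
      using A PiE_mem[OF _ assms(1)] unfolding multi_indices_def by blast
    ultimately show ?B using A by blast
  next
    assume B: ?B
    then have eq: "i m = (if m = k \<or> m = l then i k else j m)" for m
      by (metis fun_upd_apply)
    have "i m < N" if "m \<in> {1..n}" for m
      using B eq[of m] PiE_mem[OF assms(4)[unfolded multi_indices_def] that] by auto
    moreover have "i m = undefined" if "m \<notin> {1..n}" for m
      using eq[of m] PiE_arb[OF assms(4)[unfolded multi_indices_def] that] that assms(1,2) by auto
    ultimately have "i \<in> multi_indices N n"
      unfolding multi_indices_def PiE_iff extensional_def by blast
    moreover have "i k = i l"
      using eq[of l] by simp
    moreover have "i m = j m" if "m \<in> {1..n} - {k, l}" for m
      using eq[of m] that by auto
    ultimately show ?A using B by blast
  qed
  have sum: "(\<Sum>a<N. (\<lambda>i. if i = j(k := a, l := a) then 1 else 0 :: complex)) i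
      = (\<Sum>a<N. if a = i k then (if i = j(k := i k, l := i k) then 1 else 0) else 0)"
  proof -
    have "(\<Sum>a<M. (\<lambda>i. if i = j(k := a, l := a) then 1 else 0 :: complex)) i
      = (\<Sum>a<M. if i = j(k := a, l := a) then 1 else 0)" for M
      by (induction M) simp_all
    moreover have "(\<Sum>a<N. if i = j(k := a, l := a) then 1 else 0 :: complex)
      = (\<Sum>a<N. if a = i k then (if i = j(k := i k, l := i k) then 1 else 0) else 0)"
    proof (rule sum.cong[OF refl])
      fix a
      have "a = i k" if "i = j(k := a, l := a)"
        using that fun_cong[OF that, of k] by simp
      then show "(if i = j(k := a, l := a) then 1 else 0 :: complex)
        = (if a = i k then (if i = j(k := i k, l := i k) then 1 else 0) else 0)"
        by (cases "i = j(k := a, l := a)") auto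
    qed
    ultimately show ?thesis by simp
  qed
  show "brauer_operator N n (brauer_basis (contraction_diagram n k l)) (\<lambda>i. if i = j then 1 else 0) i
    = (if j k = j l then \<Sum>a<N. (\<lambda>i. if i = j(k := a, l := a) then 1 else 0) else 0) i"
    unfolding l using sum upd by (auto simp: if_distribR)
qed

lemma glued_edges:
  assumes "\<gamma> \<in> brauer_diagrams n" "\<gamma>' \<in> brauer_diagrams n"
  defines "A \<equiv> Upper ` {1..n} \<union> Middle ` {1..n} \<union> Lower ` {1..n}"
  shows "(\<Union>e\<in>\<gamma>. upper_part ` e \<times> upper_part ` e) \<union> (\<Union>e\<in>\<gamma>'. lower_part ` e \<times> lower_part ` e) \<subseteq> A \<times> A"
proof -
  have "upper_part ` e \<subseteq> A" if "e \<in> \<gamma>" for e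
  proof -
    have "e \<subseteq> Plain ` {1..n} \<union> Bar ` {1..n}"
      using assms(1) that by (auto simp: brauer_diagrams_def partition_on_def)
    then show ?thesis unfolding A_def by fastforce
  qed
  moreover have "lower_part ` e \<subseteq> A" if "e \<in> \<gamma>'" for e
  proof -
    have "e \<subseteq> Plain ` {1..n} \<union> Bar ` {1..n}"
      using assms(2) that by (auto simp: brauer_diagrams_def partition_on_def)
    then show ?thesis unfolding A_def by fastforce
  qed
  ultimately show ?thesis by blast
qed

lemma glued_labels:
  assumes "\<gamma> \<in> brauer_diagrams n" "\<gamma>' \<in> brauer_diagrams n"
  shows "compatible \<gamma> i j \<and> compatible \<gamma>' j k \<longleftrightarrow>
    (\<forall>c\<in>glued_components n \<gamma> \<gamma>'. \<forall>x\<in>c. \<forall>y\<in>c. case_node i j k x = case_node i j k y)"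
    (is "?L \<longleftrightarrow> ?R")
proof -
  define E where "E = (\<Union>e\<in>\<gamma>. upper_part ` e \<times> upper_part ` e) \<union> (\<Union>e\<in>\<gamma>'. lower_part ` e \<times> lower_part ` e)"
  let ?lab = "case_node i j k"
  have up: "?lab (upper_part v) = case_vertex i j v" and low: "?lab (lower_part v) = case_vertex j k v" for v
    by (cases v; simp)+
  have "?L \<longleftrightarrow> (\<forall>(x, y)\<in>E. ?lab x = ?lab y)"
    unfolding compatible_def E_def by (simp add: ball_Un split_beta flip: up low)
  also have "\<dots> \<longleftrightarrow> ?R"
  proof
    assume *: "\<forall>(x, y)\<in>E. ?lab x = ?lab y"
    have "?lab x = ?lab y" if "(x, y) \<in> E\<^sup>*" for x y
      using that by induction (use * in auto)
    then have "?lab x = ?lab y" if "x \<in> E\<^sup>* `` {z}" "y \<in> E\<^sup>* `` {z}" for x y z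
      using that by (metis Image_singleton_iff)
    then show ?R
      unfolding glued_components_def E_def[symmetric] quotient_def by blast
  next
    assume R: ?R
    have "?lab x = ?lab y" if "(x, y) \<in> E" for x y
    proof -
      have "x \<in> Upper ` {1..n} \<union> Middle ` {1..n} \<union> Lower ` {1..n}"
        using that glued_edges[OF assms] unfolding E_def by blast
      then have "E\<^sup>* `` {x} \<in> glued_components n \<gamma> \<gamma>'"
        unfolding glued_components_def E_def[symmetric] by (rule quotientI)
      moreover have "x \<in> E\<^sup>* `` {x}" "y \<in> E\<^sup>* `` {x}"
        using that by auto
      ultimately show ?thesis
        by (rule R[rule_format])
    qed
    then show "\<forall>(x, y)\<in>E. ?lab x = ?lab y" by blast
  qed
  finally show ?thesis .
qed

lemma glued_components_partition:
  assumes "\<gamma> \<in> brauer_diagrams n" "\<gamma>' \<in> brauer_diagrams n"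
  shows "partition_on (Upper ` {1..n} \<union> Middle ` {1..n} \<union> Lower ` {1..n}) (glued_components n \<gamma> \<gamma>')"
proof -
  define E where "E = (\<Union>e\<in>\<gamma>. upper_part ` e \<times> upper_part ` e) \<union> (\<Union>e\<in>\<gamma>'. lower_part ` e \<times> lower_part ` e)"
  define A where "A = Upper ` {1..n} \<union> Middle ` {1..n} \<union> Lower ` {1..n}"
  have E: "E \<subseteq> A \<times> A"
    unfolding E_def A_def by (rule glued_edges[OF assms])
  have "sym E"
    unfolding E_def by (auto simp: sym_def)
  then have sym: "sym (E\<^sup>*)"
    by (rule sym_rtrancl)
  have cl: "E\<^sup>* `` {x} = (E\<^sup>* \<inter> A \<times> A) `` {x}" if "x \<in> A" for x
  proof -
    have "y \<in> A" if "(x, y) \<in> E\<^sup>*" for y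
      using that \<open>x \<in> A\<close> E by (induction) auto
    then show ?thesis using \<open>x \<in> A\<close> by auto
  qed
  have "equiv A (E\<^sup>* \<inter> A \<times> A)"
    by (rule equivI) (use sym in \<open>auto simp: refl_on_def sym_def trans_def intro: rtrancl_trans\<close>)
  then have "partition_on A (A // (E\<^sup>* \<inter> A \<times> A))"
    by (rule partition_on_quotient)
  moreover have "A // (E\<^sup>* \<inter> A \<times> A) = A // E\<^sup>*"
    using cl by (auto simp: quotient_def)
  ultimately show ?thesis
    by (simp add: glued_components_def A_def E_def)
qed

lemma diagram_operator_comp:
  assumes "\<gamma> \<in> brauer_diagrams n" "\<gamma>' \<in> brauer_diagrams n"
  shows "diagram_operator N n \<gamma> (diagram_operator N n \<gamma>' t) =
    (of_nat N ^ loops n \<gamma> \<gamma>') *\<^sub>C diagram_operator N n (brauer_comp n \<gamma> \<gamma>') t"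
proof
  fix i
  define CC where "CC = glued_components n \<gamma> \<gamma>'"
  define L where "L = {c \<in> CC. c \<subseteq> range Middle}"
  let ?M = "multi_indices N n"
  let ?J = "\<lambda>i k. {j \<in> ?M. compatible \<gamma> i j \<and> compatible \<gamma>' j k}"
  have part: "\<Union>CC = Upper ` {1..n} \<union> Middle ` {1..n} \<union> Lower ` {1..n}" "disjoint CC" "{} \<notin> CC"
    using glued_components_partition[OF assms] by (auto simp: CC_def partition_on_def)
  have "finite CC"
    by (rule finite_UnionD) (simp add: part(1))
  then have finL: "finite L" by (simp add: L_def)
  have uniq: "c = c'" if "c \<in> CC" "c' \<in> CC" "x \<in> c" "x \<in> c'" for c c' x
    using part(2) that unfolding disjoint_def by blast
  have card: "card (?J i k) = (if compatible (brauer_comp n \<gamma> \<gamma>') i k then N ^ loops n \<gamma> \<gamma>' else 0)"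
    if ik: "i \<in> ?M" "k \<in> ?M" for i k
  proof (cases "compatible (brauer_comp n \<gamma> \<gamma>') i k")
    case False
    then obtain c x y where c: "c \<in> CC" "outer_part x \<in> c" "outer_part y \<in> c"
      and ne: "case_vertex i k x \<noteq> case_vertex i k y"
      unfolding compatible_def brauer_comp_def CC_def by auto
    have lab: "case_node i j k (outer_part v) = case_vertex i k v" for j v
      by (cases v; simp)
    have "?J i k = {}"
      using c ne unfolding glued_labels[OF assms] CC_def[symmetric] by (force simp: lab)
    then show ?thesis using False by (simp only: card.empty if_False)
  next
    case True
    define comp where "comp m = (THE c. c \<in> CC \<and> Middle m \<in> c)" for m
    have comp: "comp m \<in> CC" "Middle m \<in> comp m" if "m \<in> {1..n}" for m
    proof -
      have "Middle m \<in> \<Union>CC" unfolding part(1) using that by blast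
      then obtain c where "c \<in> CC" "Middle m \<in> c" by blast
      moreover from this have "comp m = c"
        unfolding comp_def by (intro the_equality conjI) (auto dest: uniq)
      ultimately show "comp m \<in> CC" "Middle m \<in> comp m" by simp_all
    qed
    have comp_eq: "comp m = c" if "m \<in> {1..n}" "c \<in> CC" "Middle m \<in> c" for m c
      using uniq[OF comp(1)[OF that(1)] that(2) comp(2)[OF that(1)] that(3)] .
    define out where "out c = case_node i undefined k (SOME x. x \<in> c \<and> x \<notin> range Middle)" for c
    have nodes: "x \<in> Upper ` {1..n} \<union> Middle ` {1..n} \<union> Lower ` {1..n}" if "c \<in> CC" "x \<in> c" for c x
      using part(1) that by blast
    have lab_out: "case_node i j k x = out c" if c: "c \<in> CC" "x \<in> c" "x \<notin> range Middle" for c x j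
    proof -
      define y where "y = (SOME x. x \<in> c \<and> x \<notin> range Middle)"
      have y: "y \<in> c" "y \<notin> range Middle"
        using someI[of "\<lambda>x. x \<in> c \<and> x \<notin> range Middle" x] c unfolding y_def by auto
      obtain x' y' where xy: "x = outer_part x'" "y = outer_part y'"
        using c(3) y(2) by (metis node.exhaust outer_part.simps rangeI)
      have "outer_part -` c \<in> brauer_comp n \<gamma> \<gamma>'"
        using c unfolding brauer_comp_def CC_def by auto
      moreover have "x' \<in> outer_part -` c" "y' \<in> outer_part -` c"
        using c(2) y(1) xy by simp_all
      ultimately have "case_vertex i k x' = case_vertex i k y'"
        by (rule True[unfolded compatible_def, rule_format])
      moreover have "case_node i j k (outer_part v) = case_vertex i k v" for v j
        by (cases v; simp)
      ultimately show ?thesis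
        using xy unfolding out_def y_def[symmetric] by simp
    qed
    have out_less: "out c < N" if c: "c \<in> CC" "c \<notin> L" for c
    proof -
      obtain x where x: "x \<in> c" "x \<notin> range Middle"
        using c by (auto simp: L_def)
      have "case_node i undefined k x < N"
        using nodes[OF c(1) x(1)] x(2) ik by (auto simp: multi_indices_def)
      then show ?thesis using lab_out[OF c(1) x] by metis
    qed
    define F where "F h = restrict (\<lambda>m. if comp m \<in> L then h (comp m) else out (comp m)) {1..n}"
      for h :: "node set \<Rightarrow> nat"
    define G where "G j = restrict (\<lambda>c. case_node i j k (SOME x. x \<in> c)) L" for j :: "nat \<Rightarrow> nat"
    have "bij_betw F (L \<rightarrow>\<^sub>E {..<N}) (?J i k)"
    proof (rule bij_betw_byWitness[where f' = G])
      have some: "(SOME x. x \<in> c) \<in> c" if "c \<in> CC" for c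
        using that part(3) by (metis some_in_eq)
      have mid: "\<exists>m\<in>{1..n}. (SOME x. x \<in> c) = Middle m" if "c \<in> L" for c
      proof -
        have "(SOME x. x \<in> c) \<in> c" "c \<in> CC" "c \<subseteq> range Middle"
          using that some by (auto simp: L_def)
        then show ?thesis using nodes[of c "SOME x. x \<in> c"] by (auto simp: subset_iff)
      qed
      have const: "case_node i j k x = case_node i j k y"
        if "j \<in> ?J i k" "c \<in> CC" "x \<in> c" "y \<in> c" for j c x y
        using that(1) glued_labels[OF assms, of i j k, THEN iffD1, rule_format, of c x y] that(2-4)
        by (simp add: CC_def)
      show "\<forall>h\<in>L \<rightarrow>\<^sub>E {..<N}. G (F h) = h"
      proof
        fix h assume h: "h \<in> L \<rightarrow>\<^sub>E {..<N}"
        show "G (F h) = h"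
        proof
          fix c
          show "G (F h) c = h c"
          proof (cases "c \<in> L")
            case cL: True
            then obtain m where m: "m \<in> {1..n}" "(SOME x. x \<in> c) = Middle m"
              using mid by blast
            then have "Middle m \<in> c" "c \<in> CC"
              using some[of c] cL by (auto simp: L_def)
            then have "comp m = c" using comp_eq m by blast
            then show ?thesis using cL m by (simp add: G_def F_def)
          next
            case False
            then show ?thesis using h by (simp add: G_def PiE_def extensional_def)
          qed
        qed
      qed
      show "\<forall>j\<in>?J i k. F (G j) = j"
      proof
        fix j assume j: "j \<in> ?J i k"
        show "F (G j) = j"
        proof
          fix m
          show "F (G j) m = j m"
          proof (cases "m \<in> {1..n}")
            case m: True
            note cm = comp[OF m]
            show ?thesis
            proof (cases "comp m \<in> L")
              case True
              have "case_node i j k (SOME x. x \<in> comp m) = case_node i j k (Middle m)"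
                by (rule const[OF j cm(1) some[OF cm(1)] cm(2)])
              then show ?thesis using m True by (simp add: F_def G_def)
            next
              case False
              then obtain x where x: "x \<in> comp m" "x \<notin> range Middle"
                using cm by (auto simp: L_def)
              have "case_node i j k x = case_node i j k (Middle m)"
                by (rule const[OF j cm(1) x(1) cm(2)])
              then have "out (comp m) = j m"
                using lab_out[OF cm(1) x, of j] by simp
              then show ?thesis using m False by (simp add: F_def)
            qed
          next
            case False
            moreover from this j have "j m = undefined"
              by (auto simp: multi_indices_def PiE_def extensional_def)
            ultimately show ?thesis by (simp only: F_def restrict_apply if_False)
          qed
        qed
      qed
      show "F ` (L \<rightarrow>\<^sub>E {..<N}) \<subseteq> ?J i k"
      proof
        fix j assume "j \<in> F ` (L \<rightarrow>\<^sub>E {..<N})"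
        then obtain h where h: "h \<in> L \<rightarrow>\<^sub>E {..<N}" and j: "j = F h" by blast
        have "j \<in> ?M"
          using h out_less comp by (fastforce simp: j F_def multi_indices_def)
        moreover have "case_node i j k x = (if c \<in> L then h c else out c)" if xc: "c \<in> CC" "x \<in> c" for c x
        proof (cases "x \<in> range Middle")
          case True
          then obtain m where m: "x = Middle m" "m \<in> {1..n}"
            using nodes[OF xc] by auto
          then have "comp m = c" using comp_eq[OF m(2) xc(1)] xc(2) by simp
          then show ?thesis using m by (simp add: j F_def)
        next
          case False
          then show ?thesis using lab_out[OF xc False] xc by (auto simp: L_def)
        qed
        ultimately show "j \<in> ?J i k"
          unfolding mem_Collect_eq glued_labels[OF assms] CC_def[symmetric] by simp
      qed
      show "G ` (?J i k) \<subseteq> L \<rightarrow>\<^sub>E {..<N}"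
      proof -
        have "case_node i j k (SOME x. x \<in> c) < N" if "j \<in> ?M" "c \<in> L" for j c
          using mid[OF that(2)] that(1) by (auto simp: multi_indices_def)
        then show ?thesis by (auto simp: G_def)
      qed
    qed
    then have "card (?J i k) = card (L \<rightarrow>\<^sub>E {..<N})"
      by (rule bij_betw_same_card[symmetric])
    also have "\<dots> = N ^ loops n \<gamma> \<gamma>'"
      using finL by (simp add: card_PiE loops_def L_def CC_def)
    finally show ?thesis using True by simp
  qed
  show "diagram_operator N n \<gamma> (diagram_operator N n \<gamma>' t) i =
    ((of_nat N ^ loops n \<gamma> \<gamma>') *\<^sub>C diagram_operator N n (brauer_comp n \<gamma> \<gamma>') t) i"
  proof (cases "i \<in> ?M")
    case i: True
    have "diagram_operator N n \<gamma> (diagram_operator N n \<gamma>' t) i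
      = (\<Sum>j\<in>?M. \<Sum>k\<in>?M. if compatible \<gamma> i j \<and> compatible \<gamma>' j k then t k else 0)"
      using i unfolding diagram_operator_def by (auto intro!: sum.cong)
    also have "\<dots> = (\<Sum>k\<in>?M. \<Sum>j\<in>?M. if compatible \<gamma> i j \<and> compatible \<gamma>' j k then t k else 0)"
      by (rule sum.swap)
    also have "\<dots> = (\<Sum>k\<in>?M. of_nat (card (?J i k)) * t k)"
      by (rule sum.cong[OF refl])
        (simp add: sum.inter_filter[OF finite_multi_indices, symmetric] flip: sum.inter_filter)
    also have "\<dots> = (\<Sum>k\<in>?M. of_nat N ^ loops n \<gamma> \<gamma>' *
        (if compatible (brauer_comp n \<gamma> \<gamma>') i k then t k else 0))"
      by (rule sum.cong[OF refl]) (simp add: card[OF i])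
    finally show ?thesis
      using i by (simp add: scaleC_fun_def scaleC_complex_def diagram_operator_def sum_distrib_left)
  qed (simp add: diagram_operator_def scaleC_fun_def scaleC_complex_def)
qed

text \<open>A Young diagram is a set of boxes \<open>(row, column)\<close>, both numbered from 0.\<close>
type_synonym diagram = "(nat \<times> nat) set"

definition young_diagram :: "diagram \<Rightarrow> bool" where
  "young_diagram lam \<longleftrightarrow> finite lam \<and> (\<forall>(i, j) \<in> lam. \<forall>i'\<le>i. \<forall>j'\<le>j. (i', j') \<in> lam)"

text \<open>The row reading tableau, a bijection from the boxes of \<open>\<lambda>\<close> to \<open>{1..card \<lambda>}\<close>.\<close>
definition tableau :: "diagram \<Rightarrow> nat \<times> nat \<Rightarrow> nat" where
  "tableau lam b = card {b' \<in> lam. fst b' < fst b \<or> fst b' = fst b \<and> snd b' \<le> snd b}"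

definition row_group :: "diagram \<Rightarrow> (nat \<Rightarrow> nat) set" where
  "row_group lam = {s \<in> sym_group (card lam).
     \<forall>b\<in>lam. \<forall>b'\<in>lam. s (tableau lam b) = tableau lam b' \<longrightarrow> fst b = fst b'}"

definition column_group :: "diagram \<Rightarrow> (nat \<Rightarrow> nat) set" where
  "column_group lam = {s \<in> sym_group (card lam).
     \<forall>b\<in>lam. \<forall>b'\<in>lam. s (tableau lam b) = tableau lam b' \<longrightarrow> snd b = snd b'}"

type_synonym group_ring_element = "(nat \<Rightarrow> nat) \<Rightarrow> complex"

definition group_ring :: "nat \<Rightarrow> group_ring_element set" where
  "group_ring m = {x. \<forall>s. s \<notin> sym_group m \<longrightarrow> x s = 0}"

definition group_basis :: "(nat \<Rightarrow> nat) \<Rightarrow> group_ring_element" where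
  "group_basis s = (\<lambda>r. if r = s then 1 else 0)"

definition group_ring_mult ::
    "nat \<Rightarrow> group_ring_element \<Rightarrow> group_ring_element \<Rightarrow> group_ring_element" where
  "group_ring_mult m x y = (\<Sum>p\<in>sym_group m. \<Sum>q\<in>sym_group m. (x p * y q) *\<^sub>C group_basis (p \<circ> q))"

definition young_symmetrizer :: "diagram \<Rightarrow> group_ring_element" where
  "young_symmetrizer lam =
     (\<Sum>p\<in>row_group lam. \<Sum>q\<in>column_group lam. of_int (sign q) *\<^sub>C group_basis (p \<circ> q))"

text \<open>
  The irreducible module of \<open>\<lambda>\<close> is the left ideal generated by the Young symmetrizer; it is trivial
  for a diagram with one row.
\<close>
definition specht_module :: "diagram \<Rightarrow> group_ring_element set" where
  "specht_module lam =
     (\<lambda>x. group_ring_mult (card lam) x (young_symmetrizer lam)) ` group_ring (card lam)"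

definition sym_action :: "nat \<Rightarrow> (nat \<Rightarrow> nat) \<Rightarrow> group_ring_element \<Rightarrow> group_ring_element" where
  "sym_action m s = group_ring_mult m (group_basis s)"

definition diagrams :: "nat \<Rightarrow> nat \<Rightarrow> diagram set" where
  "diagrams n N = {lam. young_diagram lam \<and> card {b\<in>lam. snd b < 2} \<le> N \<and>
     (\<exists>r \<in> {0..n div 2}. card lam = n - 2 * r)}"

text \<open>
  \<open>U(\<lambda>,N)\<close> and \<open>V(\<lambda>,n)\<close> are the multiplicity spaces of the decompositions
  \<open>\<Oplus> U(\<lambda>,N) \<otimes> S\<^sup>\<lambda>\<close> of the traceless tensors of degree \<open>card \<lambda>\<close> and \<open>\<Oplus> U(\<lambda>,N) \<otimes> V(\<lambda>,n)\<close> of all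
  tensors of degree \<open>n\<close>.  The orthogonal group, the centralizer algebra and the Brauer algebra
  act on them through the values of the homomorphisms.
\<close>
type_synonym weyl_vector = "group_ring_element \<Rightarrow> tensor"

definition weyl_module :: "nat \<Rightarrow> diagram \<Rightarrow> weyl_vector set" where
  "weyl_module N lam = Hom (sym_group (card lam)) (sym_action (card lam)) (specht_module lam)
     (perm_operator N (card lam)) (traceless_tensors N (card lam))"

type_synonym brauer_vector = "weyl_vector \<Rightarrow> tensor"

definition V_module :: "nat \<Rightarrow> diagram \<Rightarrow> nat \<Rightarrow> brauer_vector set" where
  "V_module N lam n = Hom (orthogonal_group N) (\<lambda>g \<phi>. tensor_power N (card lam) g \<circ> \<phi>) (weyl_module N lam)
     (tensor_power N n) (tensors N n)"

definition brauer_action :: "nat \<Rightarrow> nat \<Rightarrow> brauer_element \<Rightarrow> brauer_vector \<Rightarrow> brauer_vector" where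
  "brauer_action N n x v = brauer_operator N n x \<circ> v"

text \<open>
  The component \<open>V(\<mu>,k)\<close> of the restriction of \<open>V(\<lambda>,n)\<close> to the centralizer algebra of degree \<open>k\<close>,
  i.e. the isotypic component: the sum of all submodules isomorphic to \<open>V(\<mu>,k)\<close>.
\<close>
definition V_component :: "nat \<Rightarrow> diagram \<Rightarrow> nat \<Rightarrow> diagram \<Rightarrow> nat \<Rightarrow> brauer_vector set" where
  "V_component N lam n \<mu> k = cspan (\<Union>{W \<in> submodules (centralizer_algebra N k)
       (\<lambda>X v. ampliation N k n X \<circ> v) (V_module N lam n).
     isomorphic_modules (centralizer_algebra N k)
       (\<lambda>X v. X \<circ> v) (V_module N \<mu> k) (\<lambda>X v. ampliation N k n X \<circ> v) W})"

definition differ_by_one_box :: "diagram \<Rightarrow> diagram \<Rightarrow> bool" where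
  "differ_by_one_box lam \<mu> \<longleftrightarrow> (\<exists>b. b \<notin> lam \<and> \<mu> = insert b lam \<or> b \<notin> \<mu> \<and> lam = insert b \<mu>)"

text \<open>The sequences carry the additional term \<open>\<Lambda>(0)\<close>, the empty diagram.\<close>
definition diagram_paths :: "nat \<Rightarrow> diagram \<Rightarrow> nat \<Rightarrow> (nat \<Rightarrow> diagram) set" where
  "diagram_paths N lam n = {\<Lambda> \<in> (\<Pi>\<^sub>E k\<in>{0..n}. diagrams k N).
     \<Lambda> 0 = {} \<and> \<Lambda> n = lam \<and> (\<forall>k\<in>{1..<n}. differ_by_one_box (\<Lambda> k) (\<Lambda> (k + 1)))}"

definition canonical_vector :: "nat \<Rightarrow> diagram \<Rightarrow> nat \<Rightarrow> (nat \<Rightarrow> diagram) \<Rightarrow> brauer_vector \<Rightarrow> bool" where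
  "canonical_vector N lam n \<Lambda> v \<longleftrightarrow> v \<in> V_module N lam n \<and> v \<noteq> 0 \<and>
     (\<forall>k\<in>{1..n - 1}. v \<in> V_component N lam n (\<Lambda> k) k)"

end

theory Submission
  imports Defs "Jordan_Normal_Form.Determinant"
begin

text \<open>
  The diagram of \<open>sbar n k\<close> contracts the places \<open>k\<close> and \<open>k + 1\<close> of a tensor and puts the invariant
  \<open>\<Sum> u(i) \<otimes> u(i)\<close> there.  So it suffices that the contraction of \<open>v \<phi>\<close> at these places vanishes for all \<open>\<phi>\<close>.
  Write \<open>T\<^sub>p[\<kappa>]\<close> for the isotypic component \<open>isotypic N \<kappa> p\<close>, the span of all images of the module
  \<open>U(\<kappa>,N)\<close> in the \<open>p\<close>-th tensor power.  The orthogonal projection onto it belongs to the centralizer algebra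
  and is the identity on \<open>V(\<kappa>,p)\<close>, hence on the component \<open>V_component\<close> of this type
  (\<open>V_component_fixed\<close>).  Put \<open>p = k - 1\<close>, \<open>\<mu> = \<Lambda>(k - 1)\<close> and \<open>\<nu> = \<Lambda>(k + 1)\<close>.  The slices of \<open>v \<phi>\<close> in the
  first \<open>p + 2\<close> places are in \<open>T\<^sub>p\<^sub>+\<^sub>2[\<nu>]\<close>, and for \<open>p > 0\<close> those in the first \<open>p\<close> places are in \<open>T\<^sub>p[\<mu>]\<close>.
  Contraction of the last two places is equivariant, so it maps \<open>T\<^sub>p\<^sub>+\<^sub>2[\<nu>]\<close> to \<open>T\<^sub>p[\<nu>]\<close>.  Therefore the contraction
  of \<open>v \<phi>\<close> has its slices in \<open>T\<^sub>p[\<mu>]\<close> and in \<open>T\<^sub>p[\<nu>]\<close>, which are orthogonal if \<open>\<mu> \<noteq> \<nu>\<close>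
  (\<open>isotypic_orthogonal\<close>).  For \<open>p = 0\<close> the diagram \<open>\<mu>\<close> is empty, and \<open>T\<^sub>0[\<nu>]\<close> is zero for \<open>\<nu>\<close> not empty.

  The orthogonality replaces Schur's lemma and the classification of the modules \<open>U(\<kappa>,N)\<close>.  Every vector
  of \<open>U(\<kappa>,N)\<close> is the map \<open>x \<mapsto> x t\<close> on the Specht module for a traceless tensor \<open>t\<close> (\<open>weyl_map_surj\<close>).
  This turns elements of \<open>V(\<mu>,p)\<close> and \<open>V(\<nu>,p)\<close> into equivariant maps \<open>a\<close> and \<open>b\<close> on tensors of the degrees
  \<open>|\<mu>|\<close> and \<open>|\<nu>|\<close>, and \<open>\<langle>a \<delta>\<^sub>i, b \<delta>\<^sub>j\<rangle>\<close> is an array invariant under the real orthogonal group, without traces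
  inside the two blocks of indices.  If \<open>|\<mu>| = |\<nu>|\<close>, its complete traces between the blocks are given by
  bijections \<open>r\<close> of the entries of the tableaux.  They vanish if \<open>r\<close> takes two entries in a row to two entries in
  a column, because \<open>a\<close> is symmetric in the rows and \<open>b\<close> alternating in the columns.  For \<open>\<mu> \<noteq> \<nu>\<close> this happens for all
  \<open>r\<close>, possibly with \<open>\<mu>\<close> and \<open>\<nu>\<close> exchanged (\<open>separates_both_imp_eq\<close>).

  It remains to see that an invariant array is zero if all its complete traces vanish, a dual form of the
  first fundamental theorem for the orthogonal group.  The trace over two places is again invariant, so by
  induction it is enough to treat traceless arrays.  For these a computation with the Casimir
  element suffices (\<open>invariant_traceless_eq_0\<close>).
\<close>

section \<open>Arrays invariant under real orthogonal matrices\<close>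

text \<open>
  Multi-indices with places in \<open>K\<close> and values below \<open>N\<close>; an array is a function on them, its values
  elsewhere being irrelevant.
\<close>
abbreviation indices :: "nat \<Rightarrow> 'a set \<Rightarrow> ('a \<Rightarrow> nat) set" where
  "indices N K \<equiv> K \<rightarrow>\<^sub>E {..<N}"

text \<open>
  Real orthogonal \<open>N \<times> N\<close> matrices, given by their entries \<open>g c a\<close> in row \<open>c\<close>, column \<open>a\<close>.
\<close>
definition orthogonal_fun :: "nat \<Rightarrow> (nat \<Rightarrow> nat \<Rightarrow> real) \<Rightarrow> bool" where
  "orthogonal_fun N g \<longleftrightarrow> (\<forall>a<N. \<forall>b<N. (\<Sum>c<N. g c a * g c b) = of_bool (a = b))"

text \<open>
  Invariance of an array under the diagonal action of the real orthogonal group on all places.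
\<close>
definition invariant_array :: "nat \<Rightarrow> 'a set \<Rightarrow> (('a \<Rightarrow> nat) \<Rightarrow> complex) \<Rightarrow> bool" where
  "invariant_array N K t \<longleftrightarrow> (\<forall>g. orthogonal_fun N g \<longrightarrow> (\<forall>i\<in>indices N K.
     (\<Sum>j\<in>indices N K. of_real (\<Prod>m\<in>K. g (i m) (j m)) * t j) = t i))"

text \<open>
  The trace over the places \<open>a\<close> and \<open>b\<close>.  The values of \<open>i\<close> at \<open>a\<close> and \<open>b\<close> do not matter.
\<close>
definition contract :: "nat \<Rightarrow> 'a \<Rightarrow> 'a \<Rightarrow> (('a \<Rightarrow> nat) \<Rightarrow> complex) \<Rightarrow> ('a \<Rightarrow> nat) \<Rightarrow> complex" where
  "contract N a b t i = (\<Sum>c<N. t (i(a := c, b := c)))"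

text \<open>
  The action of an elementary matrix of \<open>gl(N)\<close>: the index \<open>a\<close> is replaced by \<open>b\<close> at one place,
  summed over the places where \<open>a\<close> occurs.
\<close>
definition replace :: "'a set \<Rightarrow> nat \<Rightarrow> nat \<Rightarrow> (('a \<Rightarrow> nat) \<Rightarrow> complex) \<Rightarrow> ('a \<Rightarrow> nat) \<Rightarrow> complex" where
  "replace K a b t i = (\<Sum>m\<in>K. if i m = a then t (i(m := b)) else 0)"

lemma indices_upd:
  assumes "i \<in> indices N K" "m \<in> K" "c < N"
  shows "i(m := c) \<in> indices N K"
  using assms by (auto simp: PiE_def extensional_def)

lemma prod_of_bool:
  assumes "finite K"
  shows "(\<Prod>m\<in>K. of_bool (P m) :: 'a::comm_semiring_1) = of_bool (\<forall>m\<in>K. P m)"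
  using assms by induction auto

text \<open>
  Rotation by the angle \<open>\<theta>\<close> in the plane of the coordinates \<open>a\<close> and \<open>b\<close>.
\<close>
definition rotation :: "nat \<Rightarrow> nat \<Rightarrow> real \<Rightarrow> nat \<Rightarrow> nat \<Rightarrow> real" where
  "rotation a b \<theta> c d =
     (if c = a \<and> d = a then cos \<theta> else if c = a \<and> d = b then - sin \<theta>
      else if c = b \<and> d = a then sin \<theta> else if c = b \<and> d = b then cos \<theta> else of_bool (c = d))"

lemma rotation_orthogonal:
  assumes "a < N" "b < N" "a \<noteq> b"
  shows "orthogonal_fun N (rotation a b \<theta>)"
  unfolding orthogonal_fun_def
proof (intro allI impI)
  fix d e assume de: "d < N" "e < N"
  let ?f = "\<lambda>c. rotation a b \<theta> c d * rotation a b \<theta> c e"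
  have "(\<Sum>c<N. ?f c) = ?f a + ?f b + (\<Sum>c\<in>{..<N} - {a, b}. ?f c)"
    using assms by (subst sum.subset_diff[of "{a, b}"]) auto
  also have "(\<Sum>c\<in>{..<N} - {a, b}. ?f c)
      = (\<Sum>c\<in>{..<N} - {a, b}. if c = d then of_bool (d = e) else 0)"
    by (rule sum.cong) (auto simp: rotation_def)
  also have "?f a + ?f b + \<dots> = of_bool (d = e)"
    using assms de sin_cos_squared_add[of \<theta>]
    by (auto simp: rotation_def power2_eq_square algebra_simps)
  finally show "(\<Sum>c<N. ?f c) = of_bool (d = e)" .
qed

lemma rotation_deriv:
  "((\<lambda>\<theta>. rotation a b \<theta> c d) has_field_derivative
     (if a = b then 0 else of_bool (c = b \<and> d = a) - of_bool (c = a \<and> d = b))) (at 0)"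
  if "a \<noteq> b"
proof -
  consider "c = a" "d = a" | "c = a" "d = b" | "c = b" "d = a" | "c = b" "d = b" | "c \<noteq> a \<and> c \<noteq> b \<or> d \<noteq> a \<and> d \<noteq> b"
    by blast
  then show ?thesis
    unfolding rotation_def using that
    by cases (auto intro!: derivative_eq_intros)
qed

lemma rotation_0: "rotation a b 0 c d = of_bool (c = d)"
  by (auto simp: rotation_def)

text \<open>
  The derivative at \<open>\<theta> = 0\<close> of the invariance under rotations says that the element \<open>E\<^sub>a\<^sub>b - E\<^sub>b\<^sub>a\<close> of the
  Lie algebra kills \<open>t\<close>.  For complex arrays this is applied to the real and the imaginary part.
\<close>
lemma replace_eq_real:
  fixes t :: "('a \<Rightarrow> nat) \<Rightarrow> real"
  assumes fin: "finite K" and ab: "a < N" "b < N" "a \<noteq> b" and i: "i \<in> indices N K"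
    and inv: "\<And>\<theta>. (\<Sum>j\<in>indices N K. (\<Prod>m\<in>K. rotation a b \<theta> (i m) (j m)) * t j) = t i"
  shows "(\<Sum>m\<in>K. if i m = a then t (i(m := b)) else 0) = (\<Sum>m\<in>K. if i m = b then t (i(m := a)) else 0)"
proof -
  let ?X = "\<lambda>c d. of_bool (c = b \<and> d = a) - of_bool (c = a \<and> d = b) :: real"
  have finM: "finite (indices N K)" using fin by (simp add: finite_PiE)
  have "((\<lambda>\<theta>. \<Sum>j\<in>indices N K. (\<Prod>m\<in>K. rotation a b \<theta> (i m) (j m)) * t j) has_field_derivative
     (\<Sum>j\<in>indices N K. (\<Sum>m\<in>K. ?X (i m) (j m) * (\<Prod>m'\<in>K - {m}. rotation a b 0 (i m') (j m'))) * t j)) (at 0)"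
    using rotation_deriv[OF ab(3)] ab(3)
    by (auto intro!: DERIV_sum DERIV_cmult_right has_field_derivative_prod simp del: of_bool_eq)
  moreover have "((\<lambda>\<theta>. \<Sum>j\<in>indices N K. (\<Prod>m\<in>K. rotation a b \<theta> (i m) (j m)) * t j) has_field_derivative 0) (at 0)"
    unfolding inv by simp
  ultimately have "(\<Sum>j\<in>indices N K. (\<Sum>m\<in>K. ?X (i m) (j m) * (\<Prod>m'\<in>K - {m}. rotation a b 0 (i m') (j m'))) * t j) = 0"
    by (rule DERIV_unique)
  then have "0 = (\<Sum>m\<in>K. \<Sum>j\<in>indices N K. ?X (i m) (j m) * (\<Prod>m'\<in>K - {m}. rotation a b 0 (i m') (j m')) * t j)"
    by (subst sum.swap) (simp add: sum_distrib_right)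
  also have "\<dots> = (\<Sum>m\<in>K. \<Sum>c<N. ?X (i m) c * t (i(m := c)))"
  proof (rule sum.cong[OF refl])
    fix m assume m: "m \<in> K"
    have "(\<Sum>j\<in>indices N K. ?X (i m) (j m) * (\<Prod>m'\<in>K - {m}. rotation a b 0 (i m') (j m')) * t j)
        = (\<Sum>j\<in>indices N K. if \<forall>m'\<in>K - {m}. i m' = j m' then ?X (i m) (j m) * t j else 0)"
      using fin by (intro sum.cong refl) (auto simp: rotation_0 prod_of_bool)
    also have "\<dots> = (\<Sum>j\<in>{j\<in>indices N K. \<forall>m'\<in>K - {m}. i m' = j m'}. ?X (i m) (j m) * t j)"
      by (simp add: sum.inter_filter[OF finM])
    also have "\<dots> = (\<Sum>c<N. ?X (i m) c * t (i(m := c)))"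
    proof (rule sum.reindex_bij_witness[where i = "\<lambda>c. i(m := c)" and j = "\<lambda>j. j m"])
      fix j assume j: "j \<in> {j \<in> indices N K. \<forall>m'\<in>K - {m}. i m' = j m'}"
      show "i(m := j m) = j"
      proof
        fix x show "(i(m := j m)) x = j x"
          using j i by (cases "x \<in> K") (auto simp: PiE_def extensional_def)
      qed
      then show "?X (i m) (j m) * t (i(m := j m)) = ?X (i m) (j m) * t j" by simp
      show "j m \<in> {..<N}" using j m by auto
    next
      fix c assume "c \<in> {..<N}"
      then show "i(m := c) \<in> {j \<in> indices N K. \<forall>m'\<in>K - {m}. i m' = j m'}"
        using indices_upd[OF i m, of c] by auto
    qed simp
    finally show "(\<Sum>j\<in>indices N K. ?X (i m) (j m) * (\<Prod>m'\<in>K - {m}. rotation a b 0 (i m') (j m')) * t j)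
        = (\<Sum>c<N. ?X (i m) c * t (i(m := c)))" .
  qed
  also have "\<dots> = (\<Sum>m\<in>K. (if i m = b then t (i(m := a)) else 0) - (if i m = a then t (i(m := b)) else 0))"
  proof (rule sum.cong[OF refl])
    fix m assume m: "m \<in> K"
    have "(\<Sum>c<N. ?X (i m) c * t (i(m := c)))
       = (\<Sum>c<N. (if c = a then (if i m = b then t (i(m := a)) else 0) else 0)
            - (if c = b then (if i m = a then t (i(m := b)) else 0) else 0))"
      by (intro sum.cong) auto
    also have "\<dots> = (if i m = b then t (i(m := a)) else 0) - (if i m = a then t (i(m := b)) else 0)"
      using ab by (simp add: sum_subtractf)
    finally show "(\<Sum>c<N. ?X (i m) c * t (i(m := c)))
       = (if i m = b then t (i(m := a)) else 0) - (if i m = a then t (i(m := b)) else 0)" .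
  qed
  finally show ?thesis by (simp add: sum_subtractf)
qed

lemma replace_eq:
  assumes fin: "finite K" and inv: "invariant_array N K t" and ab: "a < N" "b < N"
    and i: "i \<in> indices N K"
  shows "replace K a b t i = replace K b a t i"
proof (cases "a = b")
  case ab': False
  have eq: "(\<Sum>j\<in>indices N K. of_real (\<Prod>m\<in>K. rotation a b \<theta> (i m) (j m)) * t j) = t i" for \<theta>
    using inv rotation_orthogonal[OF ab ab'] i unfolding invariant_array_def by blast
  have "(\<Sum>j\<in>indices N K. (\<Prod>m\<in>K. rotation a b \<theta> (i m) (j m)) * Re (t j)) = Re (t i)"
    "(\<Sum>j\<in>indices N K. (\<Prod>m\<in>K. rotation a b \<theta> (i m) (j m)) * Im (t j)) = Im (t i)" for \<theta>
    unfolding eq[of \<theta>, symmetric] by (simp_all add: Re_sum Im_sum del: of_real_prod)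
  note this(1)[THEN replace_eq_real[OF fin ab ab' i]] this(2)[THEN replace_eq_real[OF fin ab ab' i]]
  then show ?thesis
    by (simp add: complex_eq_iff replace_def Re_sum Im_sum if_distrib[of Re] if_distrib[of Im] cong: if_cong)
qed simp

lemma replace_adjoint:
  assumes fin: "finite K" and ab: "a < N" "b < N"
  shows "(\<Sum>i\<in>indices N K. replace K b a t i * cnj (u i))
       = (\<Sum>i\<in>indices N K. t i * cnj (replace K a b u i))"
proof -
  have finM: "finite (indices N K)" using fin by (simp add: finite_PiE)
  have "(\<Sum>i\<in>indices N K. replace K b a t i * cnj (u i))
      = (\<Sum>m\<in>K. \<Sum>i\<in>indices N K. if i m = b then t (i(m := a)) * cnj (u i) else 0)"
    unfolding replace_def
    by (subst sum.swap) (auto simp: sum_distrib_right if_distrib intro!: sum.cong)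
  also have "\<dots> = (\<Sum>m\<in>K. \<Sum>i\<in>indices N K. if i m = a then t i * cnj (u (i(m := b))) else 0)"
  proof (rule sum.cong[OF refl])
    fix m assume m: "m \<in> K"
    have "(\<Sum>i\<in>{i\<in>indices N K. i m = b}. t (i(m := a)) * cnj (u i))
        = (\<Sum>i\<in>{i\<in>indices N K. i m = a}. t i * cnj (u (i(m := b))))"
      using indices_upd[OF _ m ab(1)] indices_upd[OF _ m ab(2)]
      by (intro sum.reindex_bij_witness[where i = "\<lambda>i. i(m := b)" and j = "\<lambda>i. i(m := a)"])
        (auto simp: fun_upd_idem)
    then show "(\<Sum>i\<in>indices N K. if i m = b then t (i(m := a)) * cnj (u i) else 0)
        = (\<Sum>i\<in>indices N K. if i m = a then t i * cnj (u (i(m := b))) else 0)"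
      by (simp add: sum.inter_filter[OF finM])
  qed
  also have "\<dots> = (\<Sum>i\<in>indices N K. t i * cnj (replace K a b u i))"
    unfolding replace_def
    by (subst sum.swap) (auto simp: sum_distrib_left if_distrib intro!: sum.cong)
  finally show ?thesis .
qed

text \<open>
  In \<open>\<Sum> E\<^sub>a\<^sub>b E\<^sub>a\<^sub>b t\<close> two replacements at one place occur only for \<open>a = b\<close>; those at two different
  places \<open>m, m'\<close> sum up to the contraction of \<open>t\<close> over \<open>m\<close> and \<open>m'\<close>.
\<close>
lemma replace_twice:
  assumes fin: "finite K" and i: "i \<in> indices N K"
    and tr: "\<And>m m'. m \<in> K \<Longrightarrow> m' \<in> K \<Longrightarrow> m \<noteq> m' \<Longrightarrow> contract N m m' t i = 0"
  shows "(\<Sum>a<N. \<Sum>b<N. replace K a b (replace K a b t) i) = of_nat (card K) * t i"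
proof -
  let ?f = "\<lambda>m m' b. if (i(m := b)) m' = i m then t (i(m := b, m' := b)) else 0"
  have "(\<Sum>a<N. \<Sum>b<N. replace K a b (replace K a b t) i)
      = (\<Sum>a<N. \<Sum>b<N. \<Sum>m\<in>K. \<Sum>m'\<in>K. if i m = a then ?f m m' b else 0)"
    unfolding replace_def by (intro sum.cong refl) (auto intro!: sum.cong)
  also have "\<dots> = (\<Sum>a<N. \<Sum>m\<in>K. \<Sum>b<N. \<Sum>m'\<in>K. if i m = a then ?f m m' b else 0)"
    by (rule sum.cong[OF refl], rule sum.swap)
  also have "\<dots> = (\<Sum>m\<in>K. \<Sum>a<N. \<Sum>b<N. \<Sum>m'\<in>K. if i m = a then ?f m m' b else 0)"
    by (rule sum.swap)
  also have "\<dots> = (\<Sum>m\<in>K. \<Sum>a<N. if i m = a then (\<Sum>b<N. \<Sum>m'\<in>K. ?f m m' b) else 0)"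
    by (intro sum.cong refl) auto
  also have "\<dots> = (\<Sum>m\<in>K. \<Sum>b<N. \<Sum>m'\<in>K. ?f m m' b)"
    by (rule sum.cong[OF refl], subst sum.delta') (use i in \<open>auto simp: PiE_iff\<close>)
  also have "\<dots> = (\<Sum>m\<in>K. \<Sum>m'\<in>K. \<Sum>b<N. ?f m m' b)"
    by (rule sum.cong[OF refl], rule sum.swap)
  also have "\<dots> = (\<Sum>m\<in>K. \<Sum>m'\<in>K. if m' = m then t i else 0)"
  proof (intro sum.cong refl)
    fix m m' assume m: "m \<in> K" "m' \<in> K"
    show "(\<Sum>b<N. ?f m m' b) = (if m' = m then t i else 0)"
    proof (cases "m' = m")
      case True
      have "(\<Sum>b<N. ?f m m' b) = (\<Sum>b<N. if b = i m then t i else 0)"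
        using True by (intro sum.cong) auto
      also have "\<dots> = t i"
        using m i by (auto simp: PiE_iff)
      finally show ?thesis using True by simp
    next
      case False
      then show ?thesis
        using tr[OF m] unfolding contract_def by (cases "i m' = i m") auto
    qed
  qed
  also have "\<dots> = of_nat (card K) * t i"
    using fin by simp
  finally show ?thesis .
qed

text \<open>
  The reflection in the coordinate \<open>a\<close> multiplies \<open>t i\<close> by \<open>-1\<close> to the number of occurrences of \<open>a\<close>.
\<close>
lemma invariant_array_even:
  assumes fin: "finite K" and inv: "invariant_array N K t" and i: "i \<in> indices N K" and nz: "t i \<noteq> 0"
  shows "even (card {m\<in>K. i m = a})"
proof -
  define g :: "nat \<Rightarrow> nat \<Rightarrow> real" where "g c d = (if c = d then if c = a then -1 else 1 else 0)" for c d
  have finM: "finite (indices N K)" using fin by (simp add: finite_PiE)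
  have "orthogonal_fun N g"
    unfolding orthogonal_fun_def
  proof (intro allI impI)
    fix d e assume "d < N" "e < N"
    have "(\<Sum>c<N. g c d * g c e) = (\<Sum>c<N. if c = d then of_bool (d = e) else 0)"
      by (intro sum.cong) (auto simp: g_def)
    then show "(\<Sum>c<N. g c d * g c e) = of_bool (d = e)"
      using \<open>d < N\<close> by simp
  qed
  then have "(\<Sum>j\<in>indices N K. of_real (\<Prod>m\<in>K. g (i m) (j m)) * t j) = t i"
    using inv i unfolding invariant_array_def by blast
  moreover have "(\<Sum>j\<in>indices N K. of_real (\<Prod>m\<in>K. g (i m) (j m)) * t j)
      = (\<Sum>j\<in>indices N K. if j = i then of_real ((-1) ^ card {m\<in>K. i m = a}) * t i else 0)"
  proof (rule sum.cong[OF refl])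
    fix j assume j: "j \<in> indices N K"
    show "of_real (\<Prod>m\<in>K. g (i m) (j m)) * t j
        = (if j = i then of_real ((-1) ^ card {m\<in>K. i m = a}) * t i else 0)"
    proof (cases "j = i")
      case True
      have "(\<Prod>m\<in>K. g (i m) (i m)) = (\<Prod>m\<in>K. if i m = a then -1 else 1)"
        by (intro prod.cong) (auto simp: g_def)
      also have "\<dots> = (\<Prod>m\<in>{m\<in>K. i m = a}. -1)"
        by (rule prod.inter_filter[OF fin, symmetric])
      finally show ?thesis using True by simp
    next
      case False
      then obtain m where "i m \<noteq> j m" by (metis ext)
      then have "m \<in> K" using i j by (auto simp: PiE_iff extensional_def) (metis)
      then have "(\<Prod>m\<in>K. g (i m) (j m)) = 0"
        using fin \<open>i m \<noteq> j m\<close> by (auto simp: g_def prod_zero_iff)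
      then show ?thesis using False by simp
    qed
  qed
  ultimately have "of_real ((-1) ^ card {m\<in>K. i m = a}) * t i = t i"
    using finM i by simp
  then show ?thesis
    using nz by (cases "even (card {m\<in>K. i m = a})") auto
qed

lemma contract_cong:
  assumes "\<And>x. x \<noteq> a \<Longrightarrow> x \<noteq> b \<Longrightarrow> i x = j x"
  shows "contract N a b t i = contract N a b t j"
proof -
  have "i(a := c, b := c) = j(a := c, b := c)" for c
    using assms by auto
  then show ?thesis by (simp add: contract_def)
qed

text \<open>
  There are no nonzero traceless invariants of positive degree.  Write \<open>E\<^sub>a\<^sub>b\<close> for \<open>replace K a b\<close>.
  The adjoint of \<open>E\<^sub>a\<^sub>b\<close> is \<open>E\<^sub>b\<^sub>a\<close>, and \<open>E\<^sub>a\<^sub>b t = E\<^sub>b\<^sub>a t\<close>, so the sum of all \<open>|E\<^sub>a\<^sub>b t|\<^sup>2\<close> is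
  \<open>\<langle>t, \<Sum> E\<^sub>a\<^sub>b E\<^sub>a\<^sub>b t\<rangle> = |K| |t|\<^sup>2\<close>.  Already the terms with \<open>a = b\<close> contribute
  \<open>\<Sum>\<^sub>a w\<^sub>a(i)\<^sup>2 |t i|\<^sup>2\<close> for each \<open>i\<close>, where \<open>w\<^sub>a(i)\<close> counts the places with index \<open>a\<close>.  When \<open>t i \<noteq> 0\<close>, the
  numbers \<open>w\<^sub>a(i)\<close> are even and have the sum \<open>|K|\<close>, hence \<open>\<Sum>\<^sub>a w\<^sub>a(i)\<^sup>2 \<ge> 2 |K|\<close>.
\<close>
lemma invariant_traceless_eq_0:
  assumes fin: "finite K" and ne: "K \<noteq> {}" and inv: "invariant_array N K t"
    and tr: "\<And>a b i. a \<in> K \<Longrightarrow> b \<in> K \<Longrightarrow> a \<noteq> b \<Longrightarrow> i \<in> indices N (K - {a, b}) \<Longrightarrow> contract N a b t i = 0"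
    and i: "i \<in> indices N K"
  shows "t i = 0"
proof -
  have finM: "finite (indices N K)" using fin by (simp add: finite_PiE)
  let ?p = "card K"
  define w where "w a i = card {m\<in>K. i m = a}" for a and i :: "'a \<Rightarrow> nat"
  have tr': "contract N a b t i = 0" if "a \<in> K" "b \<in> K" "a \<noteq> b" "i \<in> indices N K" for a b i
  proof -
    have "contract N a b t i = contract N a b t (restrict i (K - {a, b}))"
      using that by (intro contract_cong) (auto simp: PiE_iff extensional_def)
    also have "restrict i (K - {a, b}) \<in> indices N (K - {a, b})"
      using that(4) by auto
    then have "contract N a b t (restrict i (K - {a, b})) = 0"
      using tr that by blast
    finally show ?thesis .
  qed
  have sq: "of_real ((cmod z)\<^sup>2) = z * cnj z" for z
    by (rule complex_norm_square)
  have "complex_of_real (\<Sum>a<N. \<Sum>b<N. \<Sum>i\<in>indices N K. (cmod (replace K a b t i))\<^sup>2)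
      = (\<Sum>a<N. \<Sum>b<N. \<Sum>i\<in>indices N K. replace K a b t i * cnj (replace K a b t i))"
    by (simp only: of_real_sum sq)
  also have "\<dots> = (\<Sum>a<N. \<Sum>b<N. \<Sum>i\<in>indices N K. replace K b a t i * cnj (replace K a b t i))"
    using replace_eq[OF fin inv] by (intro sum.cong refl) auto
  also have "\<dots> = (\<Sum>a<N. \<Sum>b<N. \<Sum>i\<in>indices N K. t i * cnj (replace K a b (replace K a b t) i))"
    by (rule sum.cong[OF refl], rule sum.cong[OF refl], rule replace_adjoint[OF fin]) auto
  also have "\<dots> = (\<Sum>a<N. \<Sum>i\<in>indices N K. \<Sum>b<N. t i * cnj (replace K a b (replace K a b t) i))"
    by (rule sum.cong[OF refl], rule sum.swap)
  also have "\<dots> = (\<Sum>i\<in>indices N K. \<Sum>a<N. \<Sum>b<N. t i * cnj (replace K a b (replace K a b t) i))"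
    by (rule sum.swap)
  also have "\<dots> = (\<Sum>i\<in>indices N K. t i * cnj (\<Sum>a<N. \<Sum>b<N. replace K a b (replace K a b t) i))"
    by (simp add: sum_distrib_left)
  also have "\<dots> = (\<Sum>i\<in>indices N K. of_nat ?p * (t i * cnj (t i)))"
    using replace_twice[OF fin _ tr'] by (intro sum.cong refl) auto
  also have "\<dots> = complex_of_real (\<Sum>i\<in>indices N K. real ?p * (cmod (t i))\<^sup>2)"
    by (simp only: of_real_sum of_real_mult sq of_real_of_nat_eq)
  finally have upper: "(\<Sum>a<N. \<Sum>b<N. \<Sum>i\<in>indices N K. (cmod (replace K a b t i))\<^sup>2)
      = (\<Sum>i\<in>indices N K. real ?p * (cmod (t i))\<^sup>2)"
    by (simp only: of_real_eq_iff)
  have diag: "replace K a a t i = of_nat (w a i) * t i" if "i \<in> indices N K" for a i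
  proof -
    have "replace K a a t i = (\<Sum>m\<in>K. if i m = a then t i else 0)"
      unfolding replace_def by (intro sum.cong) auto
    also have "\<dots> = (\<Sum>m\<in>{m\<in>K. i m = a}. t i)"
      by (rule sum.inter_filter[OF fin, symmetric])
    finally show ?thesis by (simp add: w_def)
  qed
  have weights: "(\<Sum>a<N. w a i) = ?p" if "i \<in> indices N K" for i
  proof -
    have "?p = card (\<Union>a<N. {m\<in>K. i m = a})"
      using that by (intro arg_cong[of _ _ card]) auto
    also have "\<dots> = (\<Sum>a<N. w a i)"
      unfolding w_def using fin by (intro card_UN_disjoint) auto
    finally show ?thesis by simp
  qed
  have "2 * (real ?p * (cmod (t i))\<^sup>2) \<le> (\<Sum>a<N. (cmod (replace K a a t i))\<^sup>2)" if i: "i \<in> indices N K" for i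
  proof (cases "t i = 0")
    case False
    have "2 * w a i \<le> (w a i)\<^sup>2" for a
    proof -
      have "even (w a i)"
        unfolding w_def using invariant_array_even[OF fin inv i False] .
      then show ?thesis
        by (cases "w a i = 0") (auto simp: power2_eq_square dest: dvd_imp_le)
    qed
    then have "(\<Sum>a<N. 2 * w a i) \<le> (\<Sum>a<N. (w a i)\<^sup>2)"
      by (intro sum_mono)
    then have "2 * ?p \<le> (\<Sum>a<N. (w a i)\<^sup>2)"
      by (simp add: sum_distrib_left[symmetric] weights[OF i])
    then have "real (2 * ?p) \<le> real (\<Sum>a<N. (w a i)\<^sup>2)"
      by (simp only: of_nat_le_iff)
    then have "real (2 * ?p) * (cmod (t i))\<^sup>2 \<le> real (\<Sum>a<N. (w a i)\<^sup>2) * (cmod (t i))\<^sup>2"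
      by (intro mult_right_mono) auto
    also have "\<dots> = (\<Sum>a<N. (cmod (replace K a a t i))\<^sup>2)"
      by (simp add: diag[OF i] norm_mult power_mult_distrib sum_distrib_right)
    finally show ?thesis by (simp add: mult_ac)
  qed (simp add: sum_nonneg)
  then have "(\<Sum>i\<in>indices N K. 2 * (real ?p * (cmod (t i))\<^sup>2))
      \<le> (\<Sum>i\<in>indices N K. \<Sum>a<N. (cmod (replace K a a t i))\<^sup>2)"
    by (intro sum_mono)
  also have "\<dots> = (\<Sum>a<N. \<Sum>i\<in>indices N K. (cmod (replace K a a t i))\<^sup>2)"
    by (rule sum.swap)
  also have "\<dots> \<le> (\<Sum>a<N. \<Sum>b<N. \<Sum>i\<in>indices N K. (cmod (replace K a b t i))\<^sup>2)"
  proof (rule sum_mono)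
    fix a assume "a \<in> {..<N}"
    then show "(\<Sum>i\<in>indices N K. (cmod (replace K a a t i))\<^sup>2)
        \<le> (\<Sum>b<N. \<Sum>i\<in>indices N K. (cmod (replace K a b t i))\<^sup>2)"
      by (intro member_le_sum[of a "{..<N}" "\<lambda>b. \<Sum>i\<in>indices N K. (cmod (replace K a b t i))\<^sup>2"])
        (auto intro: sum_nonneg)
  qed
  finally have "(\<Sum>i\<in>indices N K. 2 * (real ?p * (cmod (t i))\<^sup>2)) \<le> (\<Sum>i\<in>indices N K. real ?p * (cmod (t i))\<^sup>2)"
    unfolding upper .
  then have "(\<Sum>i\<in>indices N K. real ?p * (cmod (t i))\<^sup>2) \<le> 0"
    by (simp add: sum_distrib_left[symmetric])
  then have "(\<Sum>i\<in>indices N K. real ?p * (cmod (t i))\<^sup>2) = 0"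
    by (intro antisym sum_nonneg) auto
  then have "real ?p * (cmod (t i))\<^sup>2 = 0"
    using i finM by (subst (asm) sum_nonneg_eq_0_iff) auto
  then show ?thesis
    using fin ne by auto
qed

lemma sum_indices_contract:
  assumes fin: "finite K" and ab: "a \<in> K" "b \<in> K" "a \<noteq> b"
  shows "(\<Sum>j\<in>indices N K. if j a = j b then f j else 0)
       = (\<Sum>j\<in>indices N (K - {a, b}). \<Sum>c<N. f (j(a := c, b := c)))"
proof -
  have finM: "finite (indices N K)" using fin by (simp add: finite_PiE)
  have "(\<Sum>j\<in>indices N K. if j a = j b then f j else 0) = (\<Sum>j\<in>{j\<in>indices N K. j a = j b}. f j)"
    by (simp add: sum.inter_filter[OF finM])
  also have "\<dots> = (\<Sum>(j, c)\<in>indices N (K - {a, b}) \<times> {..<N}. f (j(a := c, b := c)))"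
  proof (rule sum.reindex_bij_witness
      [where i = "\<lambda>(j, c). j(a := c, b := c)" and j = "\<lambda>j. (restrict j (K - {a, b}), j a)"])
    fix j assume j: "j \<in> {j \<in> indices N K. j a = j b}"
    have eq: "(restrict j (K - {a, b}))(a := j a, b := j a) = j"
    proof
      fix x
      show "((restrict j (K - {a, b}))(a := j a, b := j a)) x = j x"
        using j ab by (cases "x \<in> K") (auto simp: PiE_iff extensional_def)
    qed
    then show "(case (restrict j (K - {a, b}), j a) of (j, c) \<Rightarrow> j(a := c, b := c)) = j"
      by simp
    show "(restrict j (K - {a, b}), j a) \<in> indices N (K - {a, b}) \<times> {..<N}"
      using j ab by (auto simp: PiE_iff)
    show "(case (restrict j (K - {a, b}), j a) of (j, c) \<Rightarrow> f (j(a := c, b := c))) = f j"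
      using eq by simp
  next
    fix y assume "y \<in> indices N (K - {a, b}) \<times> {..<N}"
    then obtain j c where y: "y = (j, c)" "j \<in> indices N (K - {a, b})" "c < N" by auto
    have "restrict (j(a := c, b := c)) (K - {a, b}) = j"
      using y by (auto simp: fun_eq_iff PiE_iff extensional_def)
    then show "(restrict (case y of (j, c) \<Rightarrow> j(a := c, b := c)) (K - {a, b}),
        (case y of (j, c) \<Rightarrow> j(a := c, b := c)) a) = y"
      using y ab by simp
    show "(case y of (j, c) \<Rightarrow> j(a := c, b := c)) \<in> {j \<in> indices N K. j a = j b}"
      using y ab by (auto simp: PiE_iff extensional_def)
  qed
  finally show ?thesis by (simp add: sum.cartesian_product)
qed

text \<open>
  Contraction commutes with the action of a complex matrix \<open>g\<close> such that \<open>g\<^sup>T g = 1\<close>.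
\<close>
lemma contract_transform:
  fixes g :: "nat \<Rightarrow> nat \<Rightarrow> complex"
  assumes fin: "finite K" and ab: "a \<in> K" "b \<in> K" "a \<noteq> b"
    and g: "\<And>d e. d < N \<Longrightarrow> e < N \<Longrightarrow> (\<Sum>c<N. g c d * g c e) = of_bool (d = e)"
  shows "contract N a b (\<lambda>i. \<Sum>j\<in>indices N K. (\<Prod>m\<in>K. g (i m) (j m)) * t j) i
    = (\<Sum>j\<in>indices N (K - {a, b}). (\<Prod>m\<in>K - {a, b}. g (i m) (j m)) * contract N a b t j)"
proof -
  let ?K = "K - {a, b}"
  have prod_K: "(\<Prod>m\<in>K. h m) = (\<Prod>m\<in>?K. h m) * (h a * h b)" for h :: "'a \<Rightarrow> complex"
  proof -
    have "(\<Prod>m\<in>K. h m) = (\<Prod>m\<in>?K. h m) * (\<Prod>m\<in>{a, b}. h m)"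
      using fin ab by (intro prod.subset_diff) auto
    then show ?thesis using ab by simp
  qed
  have "contract N a b (\<lambda>i. \<Sum>j\<in>indices N K. (\<Prod>m\<in>K. g (i m) (j m)) * t j) i
      = (\<Sum>j\<in>indices N K. \<Sum>c<N. (\<Prod>m\<in>K. g ((i(a := c, b := c)) m) (j m)) * t j)"
    unfolding contract_def by (rule sum.swap)
  also have "\<dots> = (\<Sum>j\<in>indices N K. if j a = j b then (\<Prod>m\<in>?K. g (i m) (j m)) * t j else 0)"
  proof (rule sum.cong[OF refl])
    fix j assume j: "j \<in> indices N K"
    have "(\<Sum>c<N. (\<Prod>m\<in>K. g ((i(a := c, b := c)) m) (j m)) * t j)
        = (\<Sum>c<N. ((\<Prod>m\<in>?K. g (i m) (j m)) * (g c (j a) * g c (j b))) * t j)"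
      using ab by (simp add: prod_K)
    also have "\<dots> = ((\<Prod>m\<in>?K. g (i m) (j m)) * (\<Sum>c<N. g c (j a) * g c (j b))) * t j"
      by (simp only: sum_distrib_left sum_distrib_right)
    also have "(\<Sum>c<N. g c (j a) * g c (j b)) = of_bool (j a = j b)"
      using j ab by (intro g) (auto simp: PiE_iff)
    also have "((\<Prod>m\<in>?K. g (i m) (j m)) * of_bool (j a = j b)) * t j
        = (if j a = j b then (\<Prod>m\<in>?K. g (i m) (j m)) * t j else 0)"
      by simp
    finally show "(\<Sum>c<N. (\<Prod>m\<in>K. g ((i(a := c, b := c)) m) (j m)) * t j)
        = (if j a = j b then (\<Prod>m\<in>?K. g (i m) (j m)) * t j else 0)" .
  qed
  also have "\<dots> = (\<Sum>j\<in>indices N ?K. \<Sum>c<N. (\<Prod>m\<in>?K. g (i m) ((j(a := c, b := c)) m)) * t (j(a := c, b := c)))"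
    by (rule sum_indices_contract[OF fin ab])
  also have "\<dots> = (\<Sum>j\<in>indices N ?K. (\<Prod>m\<in>?K. g (i m) (j m)) * contract N a b t j)"
    unfolding contract_def sum_distrib_left
    by (intro sum.cong refl arg_cong2[of _ _ _ _ "(*)"] prod.cong) auto
  finally show ?thesis .
qed

lemma contract_invariant:
  assumes fin: "finite K" and ab: "a \<in> K" "b \<in> K" "a \<noteq> b" and inv: "invariant_array N K t"
  shows "invariant_array N (K - {a, b}) (contract N a b t)"
  unfolding invariant_array_def
proof (intro allI impI ballI)
  fix g i assume g: "orthogonal_fun N g" and i: "i \<in> indices N (K - {a, b})"
  have all: "\<forall>i\<in>indices N K. (\<Sum>j\<in>indices N K. of_real (\<Prod>m\<in>K. g (i m) (j m)) * t j) = t i"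
    using inv g unfolding invariant_array_def by blast
  have orth: "(\<Sum>c<N. complex_of_real (g c d) * of_real (g c e)) = of_bool (d = e)" if "d < N" "e < N" for d e
  proof -
    have "(\<Sum>c<N. complex_of_real (g c d) * of_real (g c e)) = of_real (\<Sum>c<N. g c d * g c e)" by simp
    also have "(\<Sum>c<N. g c d * g c e) = of_bool (d = e)"
      using g that unfolding orthogonal_fun_def by blast
    finally show ?thesis by simp
  qed
  have "contract N a b t i
      = contract N a b (\<lambda>i. \<Sum>j\<in>indices N K. (\<Prod>m\<in>K. of_real (g (i m) (j m))) * t j) i"
    unfolding contract_def
  proof (rule sum.cong[OF refl])
    fix c assume "c \<in> {..<N}"
    then have "i(a := c, b := c) \<in> indices N K"
      using i ab by (auto simp: PiE_iff extensional_def)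
    from bspec[OF all this] show "t (i(a := c, b := c))
        = (\<Sum>j\<in>indices N K. (\<Prod>m\<in>K. of_real (g ((i(a := c, b := c)) m) (j m))) * t j)"
      by (simp only: of_real_prod)
  qed
  also have "\<dots> = (\<Sum>j\<in>indices N (K - {a, b}).
      (\<Prod>m\<in>K - {a, b}. of_real (g (i m) (j m))) * contract N a b t j)"
    by (rule contract_transform[OF fin ab orth])
  finally show "(\<Sum>j\<in>indices N (K - {a, b}). of_real (\<Prod>m\<in>K - {a, b}. g (i m) (j m)) * contract N a b t j)
      = contract N a b t i"
    by (simp only: of_real_prod)
qed

lemma contract_commute:
  assumes "a \<notin> {c, d}" "b \<notin> {c, d}"
  shows "contract N a b (contract N c d t) i = contract N c d (contract N a b t) i"
proof -
  have "contract N a b (contract N c d t) i = (\<Sum>e<N. \<Sum>f<N. t (i(a := e, b := e, c := f, d := f)))"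
    by (simp add: contract_def)
  also have "\<dots> = (\<Sum>f<N. \<Sum>e<N. t (i(a := e, b := e, c := f, d := f)))"
    by (rule sum.swap)
  also have "\<dots> = (\<Sum>f<N. \<Sum>e<N. t (i(c := f, d := f, a := e, b := e)))"
    using assms by (intro sum.cong refl arg_cong[of _ _ t]) (auto simp: fun_eq_iff)
  finally show ?thesis by (simp add: contract_def)
qed

lemma if_sum: "(if P then \<Sum>x\<in>A. f x else 0) = (\<Sum>x\<in>A. if P then f x else 0)"
  by simp

text \<open>
  If the places form two blocks, without traces inside the blocks, then the array is zero as soon as
  its complete contractions, along the bijections of the blocks, vanish.  By induction a contraction
  of one place in each block is zero, so that the array is traceless.
\<close>
lemma two_block_eq_0:
  assumes "finite I" "finite J" "I \<inter> J = {}" "invariant_array N (I \<union> J) t"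
    and "\<And>a b i. a \<in> I \<Longrightarrow> b \<in> I \<Longrightarrow> a \<noteq> b \<Longrightarrow> i \<in> indices N (I \<union> J - {a, b}) \<Longrightarrow> contract N a b t i = 0"
    and "\<And>a b i. a \<in> J \<Longrightarrow> b \<in> J \<Longrightarrow> a \<noteq> b \<Longrightarrow> i \<in> indices N (I \<union> J - {a, b}) \<Longrightarrow> contract N a b t i = 0"
    and "\<And>\<sigma>. bij_betw \<sigma> I J \<Longrightarrow> (\<Sum>k\<in>{k\<in>indices N (I \<union> J). \<forall>x\<in>I. k (\<sigma> x) = k x}. t k) = 0"
    and "i \<in> indices N (I \<union> J)"
  shows "t i = 0"
  using assms
proof (induction "card I" arbitrary: I J t i)
  case (0 I J t i)
  then have [simp]: "I = {}" by simp
  show ?case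
  proof (cases "J = {}")
    case True
    have "(\<Sum>k\<in>{k\<in>indices N (I \<union> J). \<forall>x\<in>I. k (id x) = k x}. t k) = 0"
      by (rule "0.prems"(7)) (use True in \<open>simp add: bij_betw_def\<close>)
    then show ?thesis using True "0.prems"(8) by simp
  next
    case False
    then show ?thesis
      using 0 by (intro invariant_traceless_eq_0[of J N t]) auto
  qed
next
  case (Suc p I J t i)
  let ?K = "I \<union> J"
  have fin: "finite ?K" using Suc.prems by blast
  have mixed: "contract N a b t k = 0" if ab: "a \<in> I" "b \<in> J" and k: "k \<in> indices N (?K - {a, b})" for a b k
  proof -
    let ?I = "I - {a}" and ?J = "J - {b}"
    have nab: "a \<noteq> b" "a \<notin> J" "b \<notin> I" using ab Suc.prems(3) by auto
    have K: "?I \<union> ?J = ?K - {a, b}" using nab by auto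
    have vanish: "contract N c d (contract N a b t) k = 0"
      if cd: "c \<noteq> d" "c \<in> ?K - {a, b}" "d \<in> ?K - {a, b}" and k: "k \<in> indices N (?K - {a, b} - {c, d})"
        and z: "\<And>k. k \<in> indices N (?K - {c, d}) \<Longrightarrow> contract N c d t k = 0" for c d k
    proof -
      have "contract N c d (contract N a b t) k = contract N a b (contract N c d t) k"
        using cd by (intro contract_commute) auto
      also have "\<dots> = (\<Sum>e<N. 0)"
        unfolding contract_def[of N a b]
      proof (rule sum.cong[OF refl])
        fix e assume "e \<in> {..<N}"
        then show "contract N c d t (k(a := e, b := e)) = 0"
          using k cd ab by (intro z) (auto simp: PiE_iff extensional_def)
      qed
      finally show ?thesis by simp
    qed
    show ?thesis
    proof (rule Suc.hyps(1)[of ?I ?J])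
      show "p = card ?I" using Suc.hyps(2) Suc.prems(1) ab by simp
      show "finite ?I" "finite ?J" "?I \<inter> ?J = {}" using Suc.prems by auto
      show "invariant_array N (?I \<union> ?J) (contract N a b t)"
        unfolding K using ab nab by (intro contract_invariant[OF fin] Suc.prems) auto
      show "contract N c d (contract N a b t) k = 0"
        if "c \<in> ?I" "d \<in> ?I" "c \<noteq> d" "k \<in> indices N (?I \<union> ?J - {c, d})" for c d k
        using that nab by (intro vanish Suc.prems(5)) (auto simp: K)
      show "contract N c d (contract N a b t) k = 0"
        if "c \<in> ?J" "d \<in> ?J" "c \<noteq> d" "k \<in> indices N (?I \<union> ?J - {c, d})" for c d k
        using that nab by (intro vanish Suc.prems(6)) (auto simp: K)
      show "k \<in> indices N (?I \<union> ?J)" using k by (simp add: K)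
    next
      fix \<sigma> assume \<sigma>: "bij_betw \<sigma> ?I ?J"
      have \<sigma>': "bij_betw (\<sigma>(a := b)) I J"
      proof -
        have "bij_betw (\<sigma>(a := b)) ?I ?J"
          using \<sigma> by (subst bij_betw_cong[of _ _ \<sigma>]) auto
        then have "bij_betw (\<sigma>(a := b)) (?I \<union> {a}) (?J \<union> {b})"
          by (rule bij_betw_combine) (auto simp: bij_betw_def)
        then show ?thesis using ab by (simp add: insert_absorb)
      qed
      have mem: "\<sigma> x \<in> J" "\<sigma> x \<noteq> b" "\<sigma> x \<noteq> a" if "x \<in> ?I" for x
        using bij_betwE[OF \<sigma>] that nab by auto
      have finK': "finite (indices N (?K - {a, b}))" "finite (indices N ?K)"
        using fin by (auto intro: finite_PiE)
      let ?f = "\<lambda>k. if \<forall>x\<in>?I. k (\<sigma> x) = k x then t k else 0"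
      have "(\<Sum>k\<in>{k\<in>indices N (?I \<union> ?J). \<forall>x\<in>?I. k (\<sigma> x) = k x}. contract N a b t k)
          = (\<Sum>k\<in>indices N (?K - {a, b}). \<Sum>c<N. ?f (k(a := c, b := c)))"
        unfolding K sum.inter_filter[OF finK'(1)]
      proof (rule sum.cong[OF refl])
        fix k :: "'a \<Rightarrow> nat"
        have eqv: "(\<forall>x\<in>?I. (k(a := c, b := c)) (\<sigma> x) = (k(a := c, b := c)) x) \<longleftrightarrow> (\<forall>x\<in>?I. k (\<sigma> x) = k x)" for c
          using mem nab by (intro ball_cong) auto
        show "(if \<forall>x\<in>?I. k (\<sigma> x) = k x then contract N a b t k else 0)
            = (\<Sum>c<N. ?f (k(a := c, b := c)))"
          unfolding contract_def eqv if_sum by (rule refl)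
      qed
      also have "\<dots> = (\<Sum>k\<in>indices N ?K. if k a = k b then ?f k else 0)"
        using ab nab by (intro sum_indices_contract[OF fin, symmetric]) auto
      also have "\<dots> = (\<Sum>k\<in>{k\<in>indices N ?K. \<forall>x\<in>I. k ((\<sigma>(a := b)) x) = k x}. t k)"
        unfolding sum.inter_filter[OF finK'(2)] using ab by (intro sum.cong refl) auto
      also have "\<dots> = 0"
        by (rule Suc.prems(7)[OF \<sigma>'])
      finally show "(\<Sum>k\<in>{k\<in>indices N (?I \<union> ?J). \<forall>x\<in>?I. k (\<sigma> x) = k x}. contract N a b t k) = 0" .
    qed
  qed
  have sym: "contract N b a t k = contract N a b t k" for a b and k :: "'a \<Rightarrow> nat"
    unfolding contract_def by (cases "a = b") (auto simp: fun_upd_twist)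
  show ?case
  proof (rule invariant_traceless_eq_0[OF fin _ Suc.prems(4)])
    show "?K \<noteq> {}" using Suc.hyps(2) by auto
    show "i \<in> indices N ?K" by fact
    fix a b :: 'a and k :: "'a \<Rightarrow> nat" assume abk: "a \<in> ?K" "b \<in> ?K" "a \<noteq> b" "k \<in> indices N (?K - {a, b})"
    consider "a \<in> I" "b \<in> I" | "a \<in> J" "b \<in> J" | "a \<in> I" "b \<in> J" | "a \<in> J" "b \<in> I"
      using abk by blast
    then show "contract N a b t k = 0"
    proof cases
      case 4
      then show ?thesis using mixed[of b a k] abk by (simp add: sym insert_commute)
    qed (use abk Suc.prems(5,6) mixed in auto)
  qed
qed

section \<open>Orthogonal projections in spaces of finitely supported functions\<close>

text \<open>
  The Hermitian form, linear in the first argument.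
\<close>
definition cinner_on :: "'a set \<Rightarrow> ('a \<Rightarrow> complex) \<Rightarrow> ('a \<Rightarrow> complex) \<Rightarrow> complex" where
  "cinner_on A f g = (\<Sum>a\<in>A. f a * cnj (g a))"

definition supported_on :: "'a set \<Rightarrow> ('a \<Rightarrow> complex) set" where
  "supported_on A = {f. \<forall>a. a \<notin> A \<longrightarrow> f a = 0}"

lemma scaleC_apply: "(c *\<^sub>C f) a = c * f a" for f :: "'a \<Rightarrow> complex"
  by (simp add: scaleC_fun_def scaleC_complex_def)

lemma fun_sum_apply: "(\<Sum>x\<in>A. f x) a = (\<Sum>x\<in>A. f x a)" for f :: "'x \<Rightarrow> 'a \<Rightarrow> complex"
  by (induction A rule: infinite_finite_induct) auto

lemma cinner_add_left: "cinner_on A (f + g) h = cinner_on A f h + cinner_on A g h"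
  by (simp add: cinner_on_def algebra_simps sum.distrib)

lemma cinner_add_right: "cinner_on A h (f + g) = cinner_on A h f + cinner_on A h g"
  by (simp add: cinner_on_def algebra_simps sum.distrib)

lemma cinner_diff_left: "cinner_on A (f - g) h = cinner_on A f h - cinner_on A g h"
  by (simp add: cinner_on_def algebra_simps sum_subtractf)

lemma cinner_scale_left: "cinner_on A (c *\<^sub>C f) h = c * cinner_on A f h"
  by (simp add: cinner_on_def scaleC_apply sum_distrib_left algebra_simps)

lemma cinner_scale_right: "cinner_on A h (c *\<^sub>C f) = cnj c * cinner_on A h f"
  by (simp add: cinner_on_def scaleC_apply sum_distrib_left algebra_simps)

lemma cinner_zero [simp]: "cinner_on A 0 h = 0" "cinner_on A h 0 = 0"
  by (simp_all add: cinner_on_def)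

lemma cinner_commute: "cinner_on A g f = cnj (cinner_on A f g)"
  by (simp add: cinner_on_def mult.commute)

lemma cinner_sum_left: "cinner_on A (\<Sum>x\<in>X. f x) h = (\<Sum>x\<in>X. cinner_on A (f x) h)"
  by (induction X rule: infinite_finite_induct) (simp_all only: sum.infinite sum.empty sum.insert cinner_add_left cinner_zero not_False_eq_True)

lemma cinner_sum_right: "cinner_on A h (\<Sum>x\<in>X. f x) = (\<Sum>x\<in>X. cinner_on A h (f x))"
  by (induction X rule: infinite_finite_induct) (simp_all only: sum.infinite sum.empty sum.insert cinner_add_right cinner_zero not_False_eq_True)

lemma cinner_eq_0:
  assumes "finite A" "f \<in> supported_on A" "cinner_on A f f = 0"
  shows "f = 0"
proof
  fix a
  have "complex_of_real (\<Sum>a\<in>A. (cmod (f a))\<^sup>2) = 0"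
    using assms(3) unfolding cinner_on_def by (simp only: of_real_sum complex_norm_square)
  then have "(\<Sum>a\<in>A. (cmod (f a))\<^sup>2) = 0" by (simp only: of_real_eq_0_iff)
  then have "f a = 0" if "a \<in> A"
    using that assms(1) by (subst (asm) sum_nonneg_eq_0_iff) auto
  then show "f a = 0 a" using assms(2) by (auto simp: supported_on_def)
qed

lemma csubspace_supported_on: "csubspace (supported_on A)"
  by (auto simp: cvec.subspace_def supported_on_def scaleC_apply)

text \<open>
  Gram-Schmidt orthogonalization, as an induction over the spanning set.
\<close>
lemma finite_span_decomposition:
  assumes "finite A" "finite B" "B \<subseteq> supported_on A"
  shows "\<exists>y\<in>cspan B. \<forall>z\<in>cspan B. cinner_on A (x - y) z = 0"
  using assms(2,3)
proof (induction B arbitrary: x rule: finite_induct)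
  case empty
  show ?case
    unfolding cvec.span_empty by (rule bexI[of _ 0]) (simp_all only: singleton_iff cinner_zero ball_simps)
next
  case (insert v B)
  have sub: "cspan B \<subseteq> cspan (insert v B)" by (rule cvec.span_mono) auto
  obtain v1 where v1: "v1 \<in> cspan B" "\<And>z. z \<in> cspan B \<Longrightarrow> cinner_on A (v - v1) z = 0"
    using insert by blast
  obtain y where y: "y \<in> cspan B" "\<And>z. z \<in> cspan B \<Longrightarrow> cinner_on A (x - y) z = 0"
    using insert by blast
  define w where "w = v - v1"
  have w: "w \<in> cspan (insert v B)"
    unfolding w_def using v1 sub by (intro cvec.span_diff) (auto intro: cvec.span_base)
  have split: "\<exists>c. z - c *\<^sub>C w \<in> cspan B" if z: "z \<in> cspan (insert v B)" for z
  proof -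
    obtain c where c: "z - c *\<^sub>C v \<in> cspan B"
      using z cvec.span_breakdown_eq by blast
    have "z - c *\<^sub>C w = (z - c *\<^sub>C v) + c *\<^sub>C v1"
      unfolding w_def by (simp add: cvec.scale_right_diff_distrib)
    then show ?thesis using c v1 by (metis cvec.span_add cvec.span_scale)
  qed
  \<comment> \<open>If \<open>w = 0\<close>, then \<open>d = 0\<close> by the convention for division by zero, which is the right value.\<close>
  define d where "d = cinner_on A (x - y) w / cinner_on A w w"
  define y' where "y' = y + d *\<^sub>C w"
  have dw: "d * cinner_on A w w = cinner_on A (x - y) w"
  proof (cases "cinner_on A w w = 0")
    case True
    have "cspan (insert v B) \<subseteq> supported_on A"
      using insert.prems csubspace_supported_on by (rule cvec.span_minimal)
    then have "w = 0" using w True cinner_eq_0[OF assms(1)] by auto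
    then show ?thesis by simp
  qed (simp add: d_def)
  have orth_w: "cinner_on A (x - y') w = 0"
    unfolding y'_def by (simp add: diff_add_eq_diff_diff_swap cinner_diff_left cinner_scale_left dw)
  have orth_B: "cinner_on A (x - y') z = 0" if "z \<in> cspan B" for z
  proof -
    have eq: "x - y' = (x - y) - d *\<^sub>C w" by (simp add: y'_def)
    show ?thesis
      unfolding eq cinner_diff_left[of A "x - y"] cinner_scale_left
      using y(2)[OF that] v1(2)[OF that] by (simp add: w_def)
  qed
  have "y' \<in> cspan (insert v B)"
    unfolding y'_def using y sub w by (intro cvec.span_add cvec.span_scale) auto
  moreover have "cinner_on A (x - y') z = 0" if z: "z \<in> cspan (insert v B)" for z
  proof -
    obtain c where c: "z - c *\<^sub>C w \<in> cspan B" using split[OF z] by blast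
    have "cinner_on A (x - y') z = cinner_on A (x - y') ((z - c *\<^sub>C w) + c *\<^sub>C w)" by simp
    also have "\<dots> = 0"
      unfolding cinner_add_right cinner_scale_right using orth_w orth_B[OF c] by simp
    finally show ?thesis .
  qed
  ultimately show ?case by blast
qed

lemma supported_on_expand:
  assumes "finite A" "f \<in> supported_on A"
  shows "f = (\<Sum>a\<in>A. f a *\<^sub>C (\<lambda>b. if b = a then 1 else 0))"
proof
  fix b
  have "(\<Sum>a\<in>A. f a *\<^sub>C (\<lambda>b. if b = a then 1 else 0)) b = (\<Sum>a\<in>A. if b = a then f b else 0)"
    unfolding fun_sum_apply scaleC_apply by (intro sum.cong) auto
  then show "f b = (\<Sum>a\<in>A. f a *\<^sub>C (\<lambda>b. if b = a then 1 else 0)) b"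
    using assms by (auto simp: supported_on_def)
qed

lemma supported_on_span:
  assumes "finite A"
  shows "supported_on A \<subseteq> cspan ((\<lambda>a. (\<lambda>b. if b = a then 1 else 0)) ` A)"
proof
  fix f assume f: "f \<in> supported_on A"
  show "f \<in> cspan ((\<lambda>a. (\<lambda>b. if b = a then 1 else 0)) ` A)"
    by (subst supported_on_expand[OF assms f]) (intro cvec.span_sum cvec.span_scale cvec.span_base imageI)
qed

lemma orthogonal_decomposition:
  assumes "finite A" "csubspace W" "W \<subseteq> supported_on A"
  shows "\<exists>y\<in>W. \<forall>z\<in>W. cinner_on A (x - y) z = 0"
proof -
  obtain B where B: "B \<subseteq> W" "cvec.independent B" "W \<subseteq> cspan B"
    by (rule cvec.basis_exists)
  have "W \<subseteq> cspan ((\<lambda>a. (\<lambda>b. if b = a then 1 else 0)) ` A)"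
    using assms(3) supported_on_span[OF assms(1)] by (rule order_trans)
  then have "finite B"
    using cvec.independent_span_bound[OF finite_imageI[OF assms(1)] B(2)] B(1) by (meson order_trans)
  moreover have "cspan B = W"
    using B assms(2) by (metis cvec.span_minimal subset_antisym)
  ultimately show ?thesis
    using finite_span_decomposition[OF assms(1)] B(1) assms(3) by (metis order_trans)
qed

text \<open>
  The orthogonal projection onto \<open>W\<close>; only the values of \<open>x\<close> on \<open>A\<close> matter.
\<close>
definition proj :: "'a set \<Rightarrow> ('a \<Rightarrow> complex) set \<Rightarrow> ('a \<Rightarrow> complex) \<Rightarrow> 'a \<Rightarrow> complex" where
  "proj A W x = (SOME y. y \<in> W \<and> (\<forall>z\<in>W. cinner_on A (x - y) z = 0))"

locale finite_subspace =
  fixes A :: "'a set" and W :: "('a \<Rightarrow> complex) set"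
  assumes finite_A: "finite A" and subspace: "csubspace W" and supp: "W \<subseteq> supported_on A"
begin

lemma proj_in: "proj A W x \<in> W"
  and proj_orthogonal: "z \<in> W \<Longrightarrow> cinner_on A (x - proj A W x) z = 0"
proof -
  have "\<exists>y. y \<in> W \<and> (\<forall>z\<in>W. cinner_on A (x - y) z = 0)"
    using orthogonal_decomposition[OF finite_A subspace supp] by blast
  from someI_ex[OF this] show "proj A W x \<in> W" "z \<in> W \<Longrightarrow> cinner_on A (x - proj A W x) z = 0"
    unfolding proj_def by auto
qed

lemma proj_eqI:
  assumes "y \<in> W" "\<And>z. z \<in> W \<Longrightarrow> cinner_on A (x - y) z = 0"
  shows "proj A W x = y"
proof -
  let ?d = "proj A W x - y"
  have d: "?d \<in> W" using proj_in assms(1) subspace by (rule cvec.subspace_diff[rotated])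
  have "cinner_on A ?d ?d = cinner_on A ((x - y) - (x - proj A W x)) ?d" by simp
  also have "\<dots> = 0"
    unfolding cinner_diff_left[of _ "x - y"] using assms(2)[OF d] proj_orthogonal[OF d] by simp
  finally have "?d = 0" using d supp by (intro cinner_eq_0[OF finite_A]) auto
  then show ?thesis by simp
qed

lemma proj_id: "y \<in> W \<Longrightarrow> proj A W y = y"
  by (rule proj_eqI) auto

lemma proj_eq_0: "(\<And>z. z \<in> W \<Longrightarrow> cinner_on A x z = 0) \<Longrightarrow> proj A W x = 0"
  by (rule proj_eqI) (auto intro: cvec.subspace_0[OF subspace])

lemma proj_add: "proj A W (x + y) = proj A W x + proj A W y"
proof (rule proj_eqI)
  show "proj A W x + proj A W y \<in> W" by (intro cvec.subspace_add[OF subspace] proj_in)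
  fix z assume z: "z \<in> W"
  have "x + y - (proj A W x + proj A W y) = (x - proj A W x) + (y - proj A W y)" by simp
  then show "cinner_on A (x + y - (proj A W x + proj A W y)) z = 0"
    using proj_orthogonal[OF z] by (simp only: cinner_add_left) simp
qed

lemma proj_scale: "proj A W (c *\<^sub>C x) = c *\<^sub>C proj A W x"
proof (rule proj_eqI)
  show "c *\<^sub>C proj A W x \<in> W" by (intro cvec.subspace_scale[OF subspace] proj_in)
  fix z assume z: "z \<in> W"
  have "c *\<^sub>C x - c *\<^sub>C proj A W x = c *\<^sub>C (x - proj A W x)"
    by (simp add: cvec.scale_right_diff_distrib)
  then show "cinner_on A (c *\<^sub>C x - c *\<^sub>C proj A W x) z = 0"
    using proj_orthogonal[OF z] by (simp only: cinner_scale_left) simp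
qed

text \<open>
  An operator commutes with the projection onto \<open>W\<close> if it and its adjoint preserve \<open>W\<close>.
\<close>
lemma proj_commute:
  assumes X: "\<And>x. x \<in> supported_on A \<Longrightarrow> X x \<in> supported_on A"
    and lin: "\<And>x y. x \<in> supported_on A \<Longrightarrow> y \<in> supported_on A \<Longrightarrow> X (x - y) = X x - X y"
    and W: "\<And>x. x \<in> W \<Longrightarrow> X x \<in> W" and W': "\<And>x. x \<in> W \<Longrightarrow> Y x \<in> W"
    and adj: "\<And>x y. x \<in> supported_on A \<Longrightarrow> y \<in> W \<Longrightarrow> cinner_on A (X x) y = cinner_on A x (Y y)"
    and x: "x \<in> supported_on A"
  shows "proj A W (X x) = X (proj A W x)"
proof (rule proj_eqI)
  have px: "proj A W x \<in> supported_on A" using proj_in supp by blast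
  show "X (proj A W x) \<in> W" by (intro W proj_in)
  fix z assume z: "z \<in> W"
  have d: "x - proj A W x \<in> supported_on A"
    using x px csubspace_supported_on by (metis cvec.subspace_diff)
  have "cinner_on A (X x - X (proj A W x)) z = cinner_on A (x - proj A W x) (Y z)"
    by (simp add: lin[OF x px, symmetric] adj[OF d z])
  also have "\<dots> = 0" by (rule proj_orthogonal[OF W'[OF z]])
  finally show "cinner_on A (X x - X (proj A W x)) z = 0" .
qed

end

section \<open>Tableaux and the dominance order\<close>

text \<open>
  For \<open>f = fst\<close> or \<open>f = snd\<close>: two entries of the tableau are in the same row or column.
\<close>
definition same_line :: "(nat \<times> nat \<Rightarrow> nat) \<Rightarrow> diagram \<Rightarrow> nat \<Rightarrow> nat \<Rightarrow> bool" where
  "same_line f lam x y \<longleftrightarrow> (\<exists>b\<in>lam. \<exists>b'\<in>lam. x = tableau lam b \<and> y = tableau lam b' \<and> f b = f b')"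

text \<open>
  The common form of \<open>row_group\<close> (for \<open>f = fst\<close>) and \<open>column_group\<close> (for \<open>f = snd\<close>).
\<close>
definition line_group :: "(nat \<times> nat \<Rightarrow> nat) \<Rightarrow> diagram \<Rightarrow> (nat \<Rightarrow> nat) set" where
  "line_group f lam = {s \<in> sym_group (card lam).
     \<forall>b\<in>lam. \<forall>b'\<in>lam. s (tableau lam b) = tableau lam b' \<longrightarrow> f b = f b'}"

lemma row_group_eq: "row_group lam = line_group fst lam"
  and column_group_eq: "column_group lam = line_group snd lam"
  by (simp_all add: row_group_def column_group_def line_group_def)

lemma bij_betw_tableau:
  assumes "finite lam"
  shows "bij_betw (tableau lam) lam {1..card lam}"
proof -
  define P where "P b b' \<longleftrightarrow> fst b' < fst b \<or> fst b' = fst b \<and> snd b' \<le> snd b" for b b' :: "nat \<times> nat"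
  have tab: "tableau lam b = card {b'\<in>lam. P b b'}" for b
    by (simp add: tableau_def P_def)
  have less: "tableau lam b < tableau lam b'" if "b \<in> lam" "b' \<in> lam" "P b' b" "b \<noteq> b'" for b b'
  proof -
    have "b' \<notin> {c\<in>lam. P b c}" "b' \<in> {c\<in>lam. P b' c}"
      using that by (auto simp: P_def prod_eq_iff)
    moreover have "{c\<in>lam. P b c} \<subseteq> {c\<in>lam. P b' c}"
      using that by (auto simp: P_def)
    ultimately show ?thesis
      unfolding tab using assms by (intro psubset_card_mono) auto
  qed
  have "inj_on (tableau lam) lam"
  proof (rule inj_onI)
    fix b b' assume bb: "b \<in> lam" "b' \<in> lam" "tableau lam b = tableau lam b'"
    have "P b b' \<or> P b' b" by (auto simp: P_def)
    then show "b = b'" using less[of b b'] less[of b' b] bb by auto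
  qed
  moreover have "tableau lam ` lam \<subseteq> {1..card lam}"
  proof
    fix x assume "x \<in> tableau lam ` lam"
    then obtain b where b: "b \<in> lam" "x = tableau lam b" by blast
    have "b \<in> {b'\<in>lam. P b b'}" using b by (simp add: P_def)
    then have "{b'\<in>lam. P b b'} \<noteq> {}" by blast
    then have "card {b'\<in>lam. P b b'} > 0"
      using assms by (simp add: card_gt_0_iff)
    moreover have "card {b'\<in>lam. P b b'} \<le> card lam"
      using assms by (intro card_mono) auto
    ultimately show "x \<in> {1..card lam}" using b by (simp add: tab)
  qed
  ultimately show ?thesis
    unfolding bij_betw_def using card_image[of "tableau lam" lam] by (metis card_atLeastAtMost card_subset_eq diff_Suc_1 finite_atLeastAtMost)
qed

lemma line_group_comp:
  assumes "finite lam" "s \<in> line_group f lam" "r \<in> line_group f lam"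
  shows "s \<circ> r \<in> line_group f lam"
proof -
  have perm: "s permutes {1..card lam}" "r permutes {1..card lam}"
    using assms by (auto simp: line_group_def sym_group_def)
  have "f b = f b'" if b: "b \<in> lam" "b' \<in> lam" "(s \<circ> r) (tableau lam b) = tableau lam b'" for b b'
  proof -
    have "tableau lam b \<in> {1..card lam}"
      using bij_betw_tableau[OF assms(1)] b by (auto dest: bij_betwE)
    then have "r (tableau lam b) \<in> tableau lam ` lam"
      using permutes_in_image[OF perm(2)] bij_betw_tableau[OF assms(1)] by (simp add: bij_betw_def)
    then obtain c where c: "c \<in> lam" "r (tableau lam b) = tableau lam c" by auto
    then show ?thesis using assms b by (auto simp: line_group_def)
  qed
  then show ?thesis
    using permutes_compose[OF perm(2,1)] by (auto simp: line_group_def sym_group_def)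
qed

lemma transpose_in_line_group:
  assumes "finite lam" "same_line f lam x y"
  shows "transpose x y \<in> line_group f lam"
proof -
  obtain b b' where b: "b \<in> lam" "b' \<in> lam" "x = tableau lam b" "y = tableau lam b'" "f b = f b'"
    using assms(2) by (auto simp: same_line_def)
  have inj: "tableau lam c = tableau lam d \<longleftrightarrow> c = d" if "c \<in> lam" "d \<in> lam" for c d
    using bij_betw_tableau[OF assms(1)] that by (auto simp: bij_betw_def inj_on_def)
  have "x \<in> {1..card lam}" "y \<in> {1..card lam}"
    using bij_betw_tableau[OF assms(1)] b by (auto dest: bij_betwE)
  then have "transpose x y permutes {1..card lam}" by (rule permutes_swap_id)
  moreover have "f c = f d" if "c \<in> lam" "d \<in> lam" "transpose x y (tableau lam c) = tableau lam d" for c d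
    using that b inj by (auto simp: transpose_def split: if_splits)
  ultimately show ?thesis by (auto simp: line_group_def sym_group_def)
qed

text \<open>
  Half of the dominance order.  Boxes in one row go to different columns, so at most \<open>k\<close> boxes of the
  first \<open>k\<close> rows of \<open>lam\<close> go to the column \<open>j\<close> of \<open>mu\<close>; their number is also bounded by the height
  of this column.  The smaller one of the two bounds is the number of boxes that the column \<open>j\<close>
  has in the first \<open>k\<close> rows.
\<close>
lemma card_first_rows_le:
  assumes mu: "young_diagram mu" and fin: "finite lam"
    and inj: "inj_on \<beta> lam" and img: "\<beta> ` lam \<subseteq> mu"
    and sep: "\<And>b b'. b \<in> lam \<Longrightarrow> b' \<in> lam \<Longrightarrow> b \<noteq> b' \<Longrightarrow> fst b = fst b' \<Longrightarrow> snd (\<beta> b) \<noteq> snd (\<beta> b')"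
  shows "card {b\<in>lam. fst b < k} \<le> card {b\<in>mu. fst b < k}"
proof -
  have fin_mu: "finite mu" using mu by (simp add: young_diagram_def)
  let ?L = "\<lambda>j. {b\<in>lam. fst b < k \<and> snd (\<beta> b) = j}" and ?M = "\<lambda>j. {b\<in>mu. fst b < k \<and> snd b = j}"
  have le: "card (?L j) \<le> card (?M j)" for j
  proof (cases "\<forall>b\<in>mu. snd b = j \<longrightarrow> fst b < k")
    case True
    have "card (?L j) = card (\<beta> ` ?L j)"
      using inj by (intro card_image[symmetric]) (auto simp: inj_on_def)
    also have "\<dots> \<le> card (?M j)"
      using True img fin_mu by (intro card_mono) auto
    finally show ?thesis .
  next
    case False
    then obtain b where b: "b \<in> mu" "snd b = j" "k \<le> fst b" by force
    have "(i, j) \<in> mu" if "i < k" for i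
      using mu b that unfolding young_diagram_def by (cases b) fastforce
    then have "(\<lambda>i. (i, j)) ` {..<k} \<subseteq> ?M j" by auto
    then have "card ((\<lambda>i. (i, j)) ` {..<k}) \<le> card (?M j)"
      using fin_mu by (intro card_mono) auto
    then have "k \<le> card (?M j)" by (simp add: card_image inj_on_def)
    moreover have "inj_on fst (?L j)"
    proof (rule inj_onI)
      fix x y assume "x \<in> ?L j" "y \<in> ?L j" "fst x = fst y"
      then show "x = y" using sep[of x y] by (cases "x = y") auto
    qed
    then have "card (?L j) = card (fst ` ?L j)" by (simp add: card_image)
    moreover have "card (fst ` ?L j) \<le> card {..<k}"
      by (intro card_mono) auto
    ultimately show ?thesis by simp
  qed
  have "{b\<in>lam. fst b < k} = (\<Union>j\<in>snd ` mu. ?L j)"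
    using img by auto
  then have "card {b\<in>lam. fst b < k} = (\<Sum>j\<in>snd ` mu. card (?L j))"
    using fin fin_mu by (simp only:) (subst card_UN_disjoint, auto)
  also have "\<dots> \<le> (\<Sum>j\<in>snd ` mu. card (?M j))"
    by (intro sum_mono le)
  also have "\<dots> = card {b\<in>mu. fst b < k}"
  proof -
    have "{b\<in>mu. fst b < k} = (\<Union>j\<in>snd ` mu. ?M j)" by auto
    then show ?thesis
      using fin_mu by (simp only:) (subst card_UN_disjoint, auto)
  qed
  finally show ?thesis .
qed

lemma young_diagram_subset:
  assumes lam: "young_diagram lam" and mu: "young_diagram mu"
    and eq: "\<And>k. card {b\<in>lam. fst b < k} = card {b\<in>mu. fst b < k}"
  shows "lam \<subseteq> mu"
proof
  fix b assume "b \<in> lam"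
  obtain i j where b: "b = (i, j)" by (cases b)
  have fin: "finite lam" "finite mu" using lam mu by (simp_all add: young_diagram_def)
  have row: "card {b\<in>\<kappa>. fst b < Suc i} = card {b\<in>\<kappa>. fst b < i} + card {b\<in>\<kappa>. fst b = i}"
    if "finite \<kappa>" for \<kappa> :: diagram
  proof -
    have "{b\<in>\<kappa>. fst b < Suc i} = {b\<in>\<kappa>. fst b < i} \<union> {b\<in>\<kappa>. fst b = i}" by auto
    then show ?thesis using that by (simp only:) (subst card_Un_disjoint, auto)
  qed
  \<comment> \<open>Row lengths are differences of the numbers of boxes in the first rows.\<close>
  have rows: "card {b\<in>lam. fst b = i} = card {b\<in>mu. fst b = i}"
    using row[OF fin(1)] row[OF fin(2)] eq[of i] eq[of "Suc i"] by simp
  show "b \<in> mu"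
  proof (rule ccontr)
    assume "b \<notin> mu"
    then have "j' < j" if "(i, j') \<in> mu" for j'
      using mu that b unfolding young_diagram_def by (metis (no_types, lifting) case_prodD le_refl not_le)
    then have "{b\<in>mu. fst b = i} \<subseteq> Pair i ` {..<j}" by auto
    then have "card {b\<in>mu. fst b = i} \<le> card (Pair i ` {..<j})" by (intro card_mono) auto
    then have "card {b\<in>mu. fst b = i} \<le> j" by (simp add: card_image inj_on_def)
    moreover have "Pair i ` {..j} \<subseteq> {b\<in>lam. fst b = i}"
      using lam \<open>b \<in> lam\<close> b unfolding young_diagram_def by fastforce
    then have "card (Pair i ` {..j}) \<le> card {b\<in>lam. fst b = i}"
      using fin by (intro card_mono) auto
    then have "Suc j \<le> card {b\<in>lam. fst b = i}" by (simp add: card_image inj_on_def)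
    ultimately show False using rows by simp
  qed
qed

text \<open>
  The map \<open>r\<close> of the entries sends different entries in a row of \<open>lam\<close> to different columns of \<open>mu\<close>.
\<close>
definition separates :: "(nat \<Rightarrow> nat) \<Rightarrow> diagram \<Rightarrow> diagram \<Rightarrow> bool" where
  "separates r lam mu \<longleftrightarrow> (\<forall>x y. x \<noteq> y \<longrightarrow> same_line fst lam x y \<longrightarrow> \<not> same_line snd mu (r x) (r y))"

lemma separates_card_le:
  assumes lam: "young_diagram lam" and mu: "young_diagram mu"
    and r: "bij_betw r {1..card lam} {1..card mu}" and sep: "separates r lam mu"
  shows "card {b\<in>lam. fst b < k} \<le> card {b\<in>mu. fst b < k}"
proof -
  have fin: "finite lam" "finite mu" using lam mu by (simp_all add: young_diagram_def)
  note tl = bij_betw_tableau[OF fin(1)] and tm = bij_betw_tableau[OF fin(2)]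
  define \<beta> where "\<beta> = inv_into mu (tableau mu) \<circ> (r \<circ> tableau lam)"
  have bij: "bij_betw \<beta> lam mu"
    unfolding \<beta>_def by (intro bij_betw_trans[OF bij_betw_trans[OF tl r]] bij_betw_inv_into tm)
  have tab: "tableau mu (\<beta> b) = r (tableau lam b)" if "b \<in> lam" for b
  proof -
    have "r (tableau lam b) \<in> tableau mu ` mu"
      using that tl r tm by (metis bij_betwE bij_betw_imp_surj_on)
    then show ?thesis by (simp add: \<beta>_def f_inv_into_f)
  qed
  have "snd (\<beta> b) \<noteq> snd (\<beta> b')" if b: "b \<in> lam" "b' \<in> lam" "b \<noteq> b'" "fst b = fst b'" for b b'
  proof
    assume "snd (\<beta> b) = snd (\<beta> b')"
    then have "same_line snd mu (r (tableau lam b)) (r (tableau lam b'))"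
      using b bij_betwE[OF bij] by (auto simp: same_line_def simp flip: tab)
    moreover have "same_line fst lam (tableau lam b) (tableau lam b')"
      using b by (auto simp: same_line_def)
    moreover have "tableau lam b \<noteq> tableau lam b'"
      using b tl by (auto simp: bij_betw_def inj_on_def)
    ultimately show False using sep by (auto simp: separates_def)
  qed
  then show ?thesis
    using bij by (intro card_first_rows_le[OF mu fin(1), of \<beta>]) (auto simp: bij_betw_def)
qed

lemma separates_both_imp_eq:
  assumes "young_diagram lam" "young_diagram mu"
    and "bij_betw r {1..card lam} {1..card mu}" "separates r lam mu"
    and "bij_betw r' {1..card mu} {1..card lam}" "separates r' mu lam"
  shows "lam = mu"
proof -
  have "card {b\<in>lam. fst b < k} = card {b\<in>mu. fst b < k}" for k
    using separates_card_le[OF assms(1-4)] separates_card_le[OF assms(2,1,5,6)] by (intro antisym)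
  then show ?thesis
    using young_diagram_subset[OF assms(1,2)] young_diagram_subset[OF assms(2,1)] by (intro subset_antisym) simp_all
qed

section \<open>The group ring of the symmetric group\<close>

text \<open>
  The inverse of a permutation, as a function; \<open>inv\<close> would be read as the inverse in a group.
\<close>
abbreviation finv :: "(nat \<Rightarrow> nat) \<Rightarrow> nat \<Rightarrow> nat" where
  "finv \<equiv> inv_into UNIV"

lemma finite_sym_group: "finite (sym_group m)"
  unfolding sym_group_def by (rule finite_permutations) simp

lemma sym_group_id: "id \<in> sym_group m"
  by (simp add: sym_group_def permutes_id)

lemma sym_group_comp: "p \<in> sym_group m \<Longrightarrow> q \<in> sym_group m \<Longrightarrow> p \<circ> q \<in> sym_group m"
  by (simp add: sym_group_def permutes_compose)

lemma sym_group_inv: "p \<in> sym_group m \<Longrightarrow> finv p \<in> sym_group m"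
  by (simp add: sym_group_def permutes_inv)

lemma sym_group_inv_simps [simp]:
  assumes "p \<in> sym_group m"
  shows "finv p \<circ> p = id" "p \<circ> finv p = id" "finv (finv p) = p"
    "p \<circ> (finv p \<circ> q) = q" "finv p \<circ> (p \<circ> q) = q" "(q \<circ> p) \<circ> finv p = q" "(q \<circ> finv p) \<circ> p = q"
proof -
  have p: "p permutes {1..m}" using assms by (simp add: sym_group_def)
  note finv = permutes_inv_o[OF p]
  show "finv p \<circ> p = id" "p \<circ> finv p = id" by (rule finv(2), rule finv(1))
  show "finv (finv p) = p" by (rule permutes_inv_inv[OF p])
  show "p \<circ> (finv p \<circ> q) = q" "finv p \<circ> (p \<circ> q) = q" by (simp_all add: o_assoc finv)
  show "(q \<circ> p) \<circ> finv p = q" "(q \<circ> finv p) \<circ> p = q" by (simp_all add: finv flip: o_assoc)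
qed

lemma sum_left_translate:
  assumes "p \<in> sym_group m"
  shows "(\<Sum>q\<in>sym_group m. f (p \<circ> q)) = (\<Sum>q\<in>sym_group m. f q)"
  using assms
  by (intro sum.reindex_bij_witness[where i = "\<lambda>q. finv p \<circ> q" and j = "\<lambda>q. p \<circ> q"])
    (auto intro: sym_group_comp sym_group_inv)

lemma sum_sym_inv:
  "(\<Sum>q\<in>sym_group m. f (finv q)) = (\<Sum>q\<in>sym_group m. f q)"
  by (intro sum.reindex_bij_witness[where i = finv and j = finv]) (auto intro: sym_group_inv)

lemma group_ring_eq: "group_ring m = supported_on (sym_group m)"
  by (simp add: group_ring_def supported_on_def)

abbreviation "gmult \<equiv> group_ring_mult"

lemma gmult_apply:
  "gmult m x y g = (\<Sum>p\<in>sym_group m. \<Sum>q\<in>sym_group m. if g = p \<circ> q then x p * y q else 0)"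
  unfolding group_ring_mult_def fun_sum_apply scaleC_apply
  by (intro sum.cong refl) (simp add: group_basis_def)

lemma gmult_in [simp]: "gmult m x y \<in> group_ring m"
  unfolding group_ring_def mem_Collect_eq gmult_apply
  by (intro allI impI sum.neutral ballI) (auto intro: sym_group_comp)

text \<open>
  The product as convolution, tested against a function on the group.
\<close>
lemma gmult_pairing:
  fixes \<psi> :: "(nat \<Rightarrow> nat) \<Rightarrow> complex"
  shows "(\<Sum>g\<in>sym_group m. gmult m x y g * \<psi> g)
    = (\<Sum>p\<in>sym_group m. \<Sum>q\<in>sym_group m. x p * y q * \<psi> (p \<circ> q))"
proof -
  let ?S = "sym_group m"
  have "(\<Sum>g\<in>?S. gmult m x y g * \<psi> g)
      = (\<Sum>g\<in>?S. \<Sum>p\<in>?S. \<Sum>q\<in>?S. if g = p \<circ> q then x p * y q * \<psi> (p \<circ> q) else 0)"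
    unfolding gmult_apply sum_distrib_right by (intro sum.cong refl) simp
  also have "\<dots> = (\<Sum>p\<in>?S. \<Sum>g\<in>?S. \<Sum>q\<in>?S. if g = p \<circ> q then x p * y q * \<psi> (p \<circ> q) else 0)"
    by (rule sum.swap)
  also have "\<dots> = (\<Sum>p\<in>?S. \<Sum>q\<in>?S. \<Sum>g\<in>?S. if g = p \<circ> q then x p * y q * \<psi> (p \<circ> q) else 0)"
    by (rule sum.cong[OF refl], rule sum.swap)
  also have "\<dots> = (\<Sum>p\<in>?S. \<Sum>q\<in>?S. x p * y q * \<psi> (p \<circ> q))"
    by (rule sum.cong[OF refl], rule sum.cong[OF refl], subst sum.delta)
      (simp_all add: finite_sym_group sym_group_comp)
  finally show ?thesis .
qed

lemma gmult_left:
  assumes g: "g \<in> sym_group m"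
  shows "gmult m x y g = (\<Sum>p\<in>sym_group m. x p * y (finv p \<circ> g))"
  unfolding gmult_apply
proof (rule sum.cong[OF refl])
  fix p assume p: "p \<in> sym_group m"
  have "(\<Sum>q\<in>sym_group m. if g = p \<circ> q then x p * y q else 0)
      = (\<Sum>q\<in>sym_group m. if q = finv p \<circ> g then x p * y q else 0)"
    using p by (intro sum.cong refl if_cong) auto
  then show "(\<Sum>q\<in>sym_group m. if g = p \<circ> q then x p * y q else 0) = x p * y (finv p \<circ> g)"
    using p g by (simp add: finite_sym_group sym_group_comp sym_group_inv)
qed

lemma gmult_right:
  assumes g: "g \<in> sym_group m"
  shows "gmult m x y g = (\<Sum>q\<in>sym_group m. x (g \<circ> finv q) * y q)"
proof -
  have "(\<Sum>q\<in>sym_group m. x (g \<circ> finv q) * y q) = (\<Sum>p\<in>sym_group m. x (g \<circ> p) * y (finv p))"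
    by (subst sum_sym_inv[symmetric]) (rule sum.cong, auto)
  also have "\<dots> = (\<Sum>p\<in>sym_group m. x (g \<circ> (finv g \<circ> p)) * y (finv (finv g \<circ> p)))"
    by (rule sum_left_translate[OF sym_group_inv[OF g], symmetric])
  also have "\<dots> = (\<Sum>p\<in>sym_group m. x p * y (finv p \<circ> g))"
  proof (rule sum.cong[OF refl])
    fix p assume p: "p \<in> sym_group m"
    have "finv (finv g \<circ> p) = finv p \<circ> finv (finv g)"
      using p sym_group_inv[OF g] unfolding sym_group_def by (simp add: o_inv_distrib permutes_bij)
    then show "x (g \<circ> (finv g \<circ> p)) * y (finv (finv g \<circ> p)) = x p * y (finv p \<circ> g)"
      using g by simp
  qed
  finally show ?thesis by (simp add: gmult_left[OF g])
qed

lemma group_ring_eqI: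
  assumes "x \<in> group_ring m" "y \<in> group_ring m" "\<And>g. g \<in> sym_group m \<Longrightarrow> x g = y g"
  shows "x = y"
  using assms by (force simp: group_ring_def fun_eq_iff)

lemma gmult_assoc: "gmult m (gmult m x y) z = gmult m x (gmult m y z)"
proof (rule group_ring_eqI[where m = m])
  fix g assume g: "g \<in> sym_group m"
  let ?S = "sym_group m"
  have "gmult m (gmult m x y) z g = (\<Sum>p\<in>?S. \<Sum>q\<in>?S. x p * y q * z (finv (p \<circ> q) \<circ> g))"
    unfolding gmult_left[OF g] by (rule gmult_pairing)
  also have "\<dots> = (\<Sum>p\<in>?S. x p * (\<Sum>q\<in>?S. y q * z (finv q \<circ> (finv p \<circ> g))))"
  proof (unfold sum_distrib_left, intro sum.cong refl)
    fix p q assume "p \<in> ?S" "q \<in> ?S"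
    then have "finv (p \<circ> q) = finv q \<circ> finv p"
      unfolding sym_group_def by (simp add: o_inv_distrib permutes_bij)
    then show "x p * y q * z (finv (p \<circ> q) \<circ> g) = x p * (y q * z (finv q \<circ> (finv p \<circ> g)))"
      by (simp add: o_assoc)
  qed
  also have "\<dots> = (\<Sum>p\<in>?S. x p * gmult m y z (finv p \<circ> g))"
    using g by (intro sum.cong refl) (simp only: gmult_left sym_group_comp sym_group_inv)
  finally show "gmult m (gmult m x y) z g = gmult m x (gmult m y z) g"
    by (simp add: gmult_left[OF g])
qed simp_all

lemma gmult_add_left: "gmult m (x + y) z = gmult m x z + gmult m y z"
  and gmult_diff_left: "gmult m (x - y) z = gmult m x z - gmult m y z"
  and gmult_scale_left: "gmult m (c *\<^sub>C x) z = c *\<^sub>C gmult m x z"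
  by (auto simp: fun_eq_iff gmult_apply scaleC_apply sum_distrib_left algebra_simps
      simp flip: sum.distrib sum_subtractf intro!: sum.cong)

lemma gmult_basis_left:
  assumes "p \<in> sym_group m" "g \<in> sym_group m"
  shows "gmult m (group_basis p) x g = x (finv p \<circ> g)"
proof -
  have "gmult m (group_basis p) x g = (\<Sum>r\<in>sym_group m. if r = p then x (finv p \<circ> g) else 0)"
    unfolding gmult_left[OF assms(2)] group_basis_def by (intro sum.cong) auto
  then show ?thesis using assms by (simp add: finite_sym_group)
qed

lemma gmult_basis_right:
  assumes "p \<in> sym_group m" "g \<in> sym_group m"
  shows "gmult m x (group_basis p) g = x (g \<circ> finv p)"
proof -
  have "gmult m x (group_basis p) g = (\<Sum>r\<in>sym_group m. if r = p then x (g \<circ> finv p) else 0)"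
    unfolding gmult_right[OF assms(2)] group_basis_def by (intro sum.cong) auto
  then show ?thesis using assms by (simp add: finite_sym_group)
qed

lemma group_basis_in: "p \<in> sym_group m \<Longrightarrow> group_basis p \<in> group_ring m"
  by (auto simp: group_ring_def group_basis_def)

lemma gmult_one_left: "x \<in> group_ring m \<Longrightarrow> gmult m (group_basis id) x = x"
  by (rule group_ring_eqI[where m = m]) (simp_all add: gmult_basis_left sym_group_id)

text \<open>
  The adjoint in the group ring, for the Hermitian form in which the permutations are orthonormal.
\<close>
definition star :: "nat \<Rightarrow> group_ring_element \<Rightarrow> group_ring_element" where
  "star m x = (\<lambda>s. if s \<in> sym_group m then cnj (x (finv s)) else 0)"

lemma star_in [simp]: "star m x \<in> group_ring m"
  by (simp add: star_def group_ring_def)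

lemma star_star: "x \<in> group_ring m \<Longrightarrow> star m (star m x) = x"
  by (auto simp: star_def group_ring_def fun_eq_iff sym_group_inv)

lemma star_mult: "star m (gmult m x y) = gmult m (star m y) (star m x)"
proof (rule group_ring_eqI[where m = m])
  fix g assume g: "g \<in> sym_group m"
  have "star m (gmult m x y) g = (\<Sum>q\<in>sym_group m. cnj (x (finv g \<circ> finv q)) * cnj (y q))"
    using g by (simp add: star_def gmult_right sym_group_inv)
  also have "\<dots> = (\<Sum>q\<in>sym_group m. cnj (x (finv g \<circ> q)) * cnj (y (finv q)))"
    by (subst sum_sym_inv[symmetric]) (rule sum.cong, auto)
  also have "\<dots> = (\<Sum>p\<in>sym_group m. star m y p * star m x (finv p \<circ> g))"
  proof (rule sum.cong[OF refl])
    fix p assume p: "p \<in> sym_group m"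
    have "finv (finv p \<circ> g) = finv g \<circ> finv (finv p)"
      using g sym_group_inv[OF p] unfolding sym_group_def by (simp add: o_inv_distrib permutes_bij)
    then show "cnj (x (finv g \<circ> p)) * cnj (y (finv p)) = star m y p * star m x (finv p \<circ> g)"
      using p g by (simp add: star_def sym_group_comp sym_group_inv)
  qed
  finally show "star m (gmult m x y) g = gmult m (star m y) (star m x) g"
    by (simp add: gmult_left[OF g])
qed simp_all

lemma star_basis:
  assumes "p \<in> sym_group m"
  shows "star m (group_basis p) = group_basis (finv p)"
proof (rule group_ring_eqI[where m = m])
  fix g assume g: "g \<in> sym_group m"
  have "finv g = p \<longleftrightarrow> g = finv p" using g assms by auto
  then show "star m (group_basis p) g = group_basis (finv p) g"
    using g by (simp add: star_def group_basis_def)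
qed (simp_all add: group_basis_in sym_group_inv assms)

lemma cinner_gmult_right:
  "cinner_on (sym_group m) (gmult m x y) z = cinner_on (sym_group m) x (gmult m z (star m y))"
proof -
  let ?S = "sym_group m"
  have "cinner_on ?S (gmult m x y) z = (\<Sum>p\<in>?S. \<Sum>q\<in>?S. x p * y q * cnj (z (p \<circ> q)))"
    unfolding cinner_on_def by (rule gmult_pairing)
  also have "\<dots> = (\<Sum>p\<in>?S. x p * cnj (\<Sum>q\<in>?S. z (p \<circ> finv q) * star m y q))"
  proof (rule sum.cong[OF refl])
    fix p assume "p \<in> ?S"
    have "(\<Sum>q\<in>?S. z (p \<circ> finv q) * star m y q) = (\<Sum>q\<in>?S. z (p \<circ> finv (finv q)) * star m y (finv q))"
      by (rule sum_sym_inv[symmetric])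
    also have "\<dots> = (\<Sum>q\<in>?S. z (p \<circ> q) * cnj (y q))"
      by (intro sum.cong refl) (simp add: star_def sym_group_inv)
    finally show "(\<Sum>q\<in>?S. x p * y q * cnj (z (p \<circ> q))) = x p * cnj (\<Sum>q\<in>?S. z (p \<circ> finv q) * star m y q)"
      by (simp add: sum_distrib_left mult_ac)
  qed
  also have "\<dots> = cinner_on ?S x (gmult m z (star m y))"
    unfolding cinner_on_def by (intro sum.cong refl) (simp add: gmult_right)
  finally show ?thesis .
qed

lemma group_ring_definite:
  assumes "x \<in> group_ring m" "cinner_on (sym_group m) x x = 0"
  shows "x = 0"
  using assms cinner_eq_0[OF finite_sym_group] by (simp add: group_ring_eq)

text \<open>
  The left ideals generated by \<open>e\<close> and by \<open>e\<^sup>* e\<close> coincide.  Indeed, the component \<open>b\<close> of \<open>e\<close>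
  orthogonal to the latter satisfies \<open>b e\<^sup>* e = 0\<close>, so that \<open>b e\<^sup>* = 0\<close>, and then \<open>\<langle>b, b\<rangle> = 0\<close> because
  \<open>b\<close> is a left multiple of \<open>e\<close>.
\<close>
lemma exists_left_factor:
  assumes e: "e \<in> group_ring m"
  shows "\<exists>x\<in>group_ring m. e = gmult m x (gmult m (star m e) e)"
proof -
  let ?S = "sym_group m" and ?h = "gmult m (star m e) e"
  define K where "K = (\<lambda>x. gmult m x ?h) ` group_ring m"
  have sub: "csubspace (group_ring m)" unfolding group_ring_eq by (rule csubspace_supported_on)
  have "csubspace K"
    unfolding K_def cvec.subspace_def
  proof (intro conjI ballI allI)
    have "gmult m 0 ?h = 0" using gmult_diff_left[of m 0 0 ?h] by simp
    then show "0 \<in> (\<lambda>x. gmult m x ?h) ` group_ring m"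
      using cvec.subspace_0[OF sub] by (metis imageI)
  next
    fix x y assume "x \<in> (\<lambda>x. gmult m x ?h) ` group_ring m" "y \<in> (\<lambda>x. gmult m x ?h) ` group_ring m"
    then show "x + y \<in> (\<lambda>x. gmult m x ?h) ` group_ring m"
      using cvec.subspace_add[OF sub] by (auto simp flip: gmult_add_left)
  next
    fix c x assume "x \<in> (\<lambda>x. gmult m x ?h) ` group_ring m"
    then show "c *\<^sub>C x \<in> (\<lambda>x. gmult m x ?h) ` group_ring m"
      using cvec.subspace_scale[OF sub] by (auto simp flip: gmult_scale_left)
  qed
  moreover have "K \<subseteq> supported_on ?S"
    by (auto simp: K_def simp flip: group_ring_eq)
  ultimately obtain y where y: "y \<in> K" "\<And>z. z \<in> K \<Longrightarrow> cinner_on ?S (e - y) z = 0"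
    using orthogonal_decomposition[OF finite_sym_group] by metis
  then obtain x where x: "x \<in> group_ring m" "y = gmult m x ?h" by (auto simp: K_def)
  define b where "b = e - y"
  have h: "star m ?h = ?h" by (simp add: star_mult star_star e)
  have "cinner_on ?S (gmult m b ?h) (gmult m b ?h) = cinner_on ?S b (gmult m (gmult m b ?h) ?h)"
    by (subst cinner_gmult_right) (simp add: h)
  also have "\<dots> = 0"
    using y(2)[of "gmult m (gmult m b ?h) ?h"] by (auto simp: b_def K_def)
  finally have "gmult m b ?h = 0" by (intro group_ring_definite[where m = m]) simp_all
  then have "gmult m (gmult m b (star m e)) e = 0" by (simp add: gmult_assoc)
  then have "cinner_on ?S (gmult m b (star m e)) (gmult m b (star m e)) = 0"
    using cinner_gmult_right[of m b "star m e" "gmult m b (star m e)"] by (simp add: star_star e)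
  then have be: "gmult m b (star m e) = 0" by (intro group_ring_definite[where m = m]) simp_all
  have "b = gmult m (group_basis id - gmult m x (star m e)) e"
    unfolding b_def x(2) by (simp add: gmult_diff_left gmult_one_left e gmult_assoc)
  then have "cinner_on ?S b b = cinner_on ?S b (gmult m (group_basis id - gmult m x (star m e)) e)"
    by simp
  also have "\<dots> = cnj (cinner_on ?S (gmult m (group_basis id - gmult m x (star m e)) e) b)"
    by (rule cinner_commute)
  also have "\<dots> = 0"
    by (subst cinner_gmult_right) (simp add: be)
  finally have "b = 0"
    using e x by (intro group_ring_definite[where m = m])
      (simp_all add: b_def cvec.subspace_diff[OF sub])
  then show ?thesis using x by (auto simp: b_def)
qed

lemma exists_right_factor:
  assumes e: "e \<in> group_ring m"
  shows "\<exists>w\<in>group_ring m. e = gmult m e (gmult m (star m e) w)"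
proof -
  obtain x where x: "x \<in> group_ring m" "star m e = gmult m x (gmult m (star m (star m e)) (star m e))"
    using exists_left_factor[OF star_in] by blast
  have "e = star m (star m e)" by (simp add: star_star e)
  also have "\<dots> = gmult m e (gmult m (star m e) (star m x))"
    by (subst x(2)) (simp add: star_mult star_star e gmult_assoc)
  finally show ?thesis by (metis star_in)
qed

text \<open>
  The group ring is von Neumann regular.  If \<open>e = x h\<close> with \<open>h = e\<^sup>* e\<close>, then \<open>h = h\<^sup>* = h x\<^sup>* e\<close>, so
  that \<open>e = e x\<^sup>* e\<close>.
\<close>
lemma group_ring_regular:
  assumes e: "e \<in> group_ring m"
  shows "\<exists>z\<in>group_ring m. e = gmult m e (gmult m z e)"
proof -
  let ?h = "gmult m (star m e) e"
  obtain x where x: "x \<in> group_ring m" "e = gmult m x ?h"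
    using exists_left_factor[OF e] by blast
  have "?h = star m ?h" by (simp add: star_mult star_star e)
  also have "\<dots> = star m (gmult m (star m e) (gmult m x ?h))" using x(2) by simp
  also have "\<dots> = gmult m ?h (gmult m (star m x) e)"
    by (simp add: star_mult star_star e gmult_assoc)
  finally have h: "?h = gmult m ?h (gmult m (star m x) e)" .
  have "e = gmult m x (gmult m ?h (gmult m (star m x) e))"
    by (subst h[symmetric]) (rule x(2))
  also have "\<dots> = gmult m (gmult m x ?h) (gmult m (star m x) e)"
    by (rule gmult_assoc[symmetric])
  also have "gmult m x ?h = e" by (rule x(2)[symmetric])
  finally show ?thesis using star_in by blast
qed

lemma young_symmetrizer_apply:
  "young_symmetrizer lam g = (\<Sum>p\<in>row_group lam. \<Sum>q\<in>column_group lam. if g = p \<circ> q then of_int (sign q) else 0)"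
  unfolding young_symmetrizer_def fun_sum_apply scaleC_apply
  by (intro sum.cong refl) (simp add: group_basis_def)

lemma line_group_sym: "s \<in> line_group f lam \<Longrightarrow> s \<in> sym_group (card lam)"
  by (simp add: line_group_def)

lemma young_symmetrizer_in: "young_symmetrizer lam \<in> group_ring (card lam)"
  unfolding group_ring_def mem_Collect_eq young_symmetrizer_apply row_group_eq column_group_eq
  by (intro allI impI sum.neutral ballI) (auto dest: line_group_sym sym_group_comp)

lemma young_symmetrizer_column:
  assumes fin: "finite lam" and xy: "same_line snd lam x y" "x \<noteq> y"
  shows "gmult (card lam) (young_symmetrizer lam) (group_basis (transpose x y)) = - young_symmetrizer lam"
proof (rule group_ring_eqI[where m = "card lam"])
  let ?\<tau> = "transpose x y" and ?C = "column_group lam"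
  have \<tau>: "?\<tau> \<in> ?C" using transpose_in_line_group[OF fin xy(1)] by (simp add: column_group_eq)
  then have \<tau>S: "?\<tau> \<in> sym_group (card lam)" by (auto simp: column_group_eq dest: line_group_sym)
  have closed: "q \<circ> ?\<tau> \<in> ?C" if "q \<in> ?C" for q
    using that \<tau> line_group_comp[OF fin] by (simp add: column_group_eq)
  have tt: "q \<circ> ?\<tau> \<circ> ?\<tau> = q" for q by (simp add: comp_assoc)
  fix g assume g: "g \<in> sym_group (card lam)"
  have "gmult (card lam) (young_symmetrizer lam) (group_basis ?\<tau>) g = young_symmetrizer lam (g \<circ> ?\<tau>)"
    using gmult_basis_right[OF \<tau>S g] by simp
  also have "\<dots> = (\<Sum>p\<in>row_group lam. \<Sum>q\<in>?C. if g = p \<circ> q then - of_int (sign q) else 0)"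
    unfolding young_symmetrizer_apply
  proof (rule sum.cong[OF refl], rule sum.reindex_bij_witness[where i = "\<lambda>q. q \<circ> ?\<tau>" and j = "\<lambda>q. q \<circ> ?\<tau>"])
    fix p q assume p: "p \<in> row_group lam" and q: "q \<in> ?C"
    have "g = p \<circ> (q \<circ> ?\<tau>) \<longleftrightarrow> g \<circ> ?\<tau> = p \<circ> q"
      using tt by (metis comp_assoc)
    moreover have "sign (q \<circ> ?\<tau>) = - sign q"
    proof -
      have "q permutes {1..card lam}"
        using q by (simp add: column_group_eq line_group_def sym_group_def)
      then have "permutation q" using permutation_permutes finite_atLeastAtMost by blast
      moreover have "permutation ?\<tau>" by (rule permutation_swap_id)
      ultimately show ?thesis using xy by (simp add: sign_compose sign_swap_id)
    qed
    ultimately show "(if g = p \<circ> (q \<circ> ?\<tau>) then - of_int (sign (q \<circ> ?\<tau>)) else 0)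
        = (if g \<circ> ?\<tau> = p \<circ> q then of_int (sign q) else (0::complex))"
      by simp
  qed (auto simp: tt closed)
  also have "\<dots> = - young_symmetrizer lam g"
    unfolding young_symmetrizer_apply by (simp add: sum_negf[symmetric] if_distrib cong: if_cong)
  finally show "gmult (card lam) (young_symmetrizer lam) (group_basis ?\<tau>) g = (- young_symmetrizer lam) g"
    by simp
next
  show "- young_symmetrizer lam \<in> group_ring (card lam)"
    using young_symmetrizer_in[of lam] by (simp add: group_ring_def)
qed simp

lemma young_symmetrizer_row:
  assumes fin: "finite lam" and xy: "same_line fst lam x y"
  shows "gmult (card lam) (group_basis (transpose x y)) (young_symmetrizer lam) = young_symmetrizer lam"
proof (rule group_ring_eqI[where m = "card lam"])
  let ?\<tau> = "transpose x y" and ?R = "row_group lam"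
  have \<tau>: "?\<tau> \<in> ?R" using transpose_in_line_group[OF fin xy(1)] by (simp add: row_group_eq)
  then have \<tau>S: "?\<tau> \<in> sym_group (card lam)" by (auto simp: row_group_eq dest: line_group_sym)
  have closed: "?\<tau> \<circ> p \<in> ?R" if "p \<in> ?R" for p
    using that \<tau> line_group_comp[OF fin] by (simp add: row_group_eq)
  have tt: "?\<tau> \<circ> (?\<tau> \<circ> p) = p" for p by (simp add: o_assoc)
  fix g assume g: "g \<in> sym_group (card lam)"
  have "gmult (card lam) (group_basis ?\<tau>) (young_symmetrizer lam) g = young_symmetrizer lam (?\<tau> \<circ> g)"
    using gmult_basis_left[OF \<tau>S g] by simp
  also have "\<dots> = young_symmetrizer lam g"
    unfolding young_symmetrizer_apply
  proof (rule sum.reindex_bij_witness[where i = "\<lambda>p. ?\<tau> \<circ> p" and j = "\<lambda>p. ?\<tau> \<circ> p"])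
    fix p assume p: "p \<in> ?R"
    have "g = (?\<tau> \<circ> p) \<circ> q \<longleftrightarrow> ?\<tau> \<circ> g = p \<circ> q" for q
      using tt by (metis comp_assoc)
    then show "(\<Sum>q\<in>column_group lam. if g = ?\<tau> \<circ> p \<circ> q then of_int (sign q) else 0)
        = (\<Sum>q\<in>column_group lam. if ?\<tau> \<circ> g = p \<circ> q then of_int (sign q) else (0::complex))"
      by simp
  qed (auto simp: tt closed)
  finally show "gmult (card lam) (group_basis ?\<tau>) (young_symmetrizer lam) g = young_symmetrizer lam g" .
qed (simp_all add: young_symmetrizer_in)

section \<open>Tensors and the action of the orthogonal group\<close>

lemma tensors_eq: "tensors N n = supported_on (multi_indices N n)"
  by (simp add: tensors_def supported_on_def)

lemma csubspace_tensors: "csubspace (tensors N n)"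
  unfolding tensors_eq by (rule csubspace_supported_on)

lemmas tensors_closed =
  cvec.subspace_0[OF csubspace_tensors] cvec.subspace_add[OF csubspace_tensors]
  cvec.subspace_diff[OF csubspace_tensors] cvec.subspace_scale[OF csubspace_tensors]
  cvec.subspace_sum[OF csubspace_tensors]

text \<open>
  The basis tensor \<open>u(i 1) \<otimes> \<dots> \<otimes> u(i n)\<close>.
\<close>
definition unit_tensor :: "(nat \<Rightarrow> nat) \<Rightarrow> tensor" where
  "unit_tensor i = (\<lambda>j. if j = i then 1 else 0)"

lemma unit_tensor_in: "i \<in> multi_indices N n \<Longrightarrow> unit_tensor i \<in> tensors N n"
  by (auto simp: unit_tensor_def tensors_def)

lemma tensor_expand:
  assumes "t \<in> tensors N n"
  shows "t = (\<Sum>i\<in>multi_indices N n. t i *\<^sub>C unit_tensor i)"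
  unfolding unit_tensor_def
  by (rule supported_on_expand[OF finite_multi_indices assms[unfolded tensors_eq]])

abbreviation tensor_inner :: "nat \<Rightarrow> nat \<Rightarrow> tensor \<Rightarrow> tensor \<Rightarrow> complex" where
  "tensor_inner N n \<equiv> cinner_on (multi_indices N n)"

lemma tensor_power_in [simp]: "tensor_power N n g t \<in> tensors N n"
  by (simp add: tensor_power_def tensors_def)

lemma tensor_power_add: "tensor_power N n g (x + y) = tensor_power N n g x + tensor_power N n g y"
  and tensor_power_diff: "tensor_power N n g (x - y) = tensor_power N n g x - tensor_power N n g y"
  by (auto simp: tensor_power_def fun_eq_iff algebra_simps sum.distrib sum_subtractf)

lemma tensor_power_scale: "tensor_power N n g (c *\<^sub>C x) = c *\<^sub>C tensor_power N n g x"
  by (auto simp: tensor_power_def fun_eq_iff scaleC_apply sum_distrib_left mult_ac)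

lemma tensor_power_zero: "tensor_power N n g 0 = 0"
  by (auto simp: tensor_power_def fun_eq_iff)

lemma orthogonal_group_columns:
  assumes "g \<in> orthogonal_group N" "a < N" "b < N"
  shows "(\<Sum>c<N. g $$ (c, a) * g $$ (c, b)) = of_bool (a = b)"
proof -
  have g: "g \<in> carrier_mat N N" "transpose_mat g * g = 1\<^sub>m N"
    using assms by (auto simp: orthogonal_group_def)
  have "(transpose_mat g * g) $$ (a, b) = (\<Sum>c<N. g $$ (c, a) * g $$ (c, b))"
    using g(1) assms(2,3) by (auto simp: times_mat_def scalar_prod_def atLeast0LessThan intro!: sum.cong)
  then show ?thesis
    unfolding g(2) index_one_mat(1)[OF assms(2,3)] by (cases "a = b") simp_all
qed

lemma transpose_orthogonal:
  assumes "g \<in> orthogonal_group N"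
  shows "transpose_mat g \<in> orthogonal_group N"
proof -
  have g: "g \<in> carrier_mat N N" "transpose_mat g * g = 1\<^sub>m N"
    using assms by (auto simp: orthogonal_group_def)
  then have "g * transpose_mat g = 1\<^sub>m N"
    by (intro mat_mult_left_right_inverse[of "transpose_mat g"]) auto
  then show ?thesis using g(1) by (simp add: orthogonal_group_def)
qed

lemma orthogonal_group_rows:
  assumes "g \<in> orthogonal_group N" "a < N" "b < N"
  shows "(\<Sum>c<N. g $$ (a, c) * g $$ (b, c)) = of_bool (a = b)"
proof -
  have g: "g \<in> carrier_mat N N" using assms by (auto simp: orthogonal_group_def)
  have "(\<Sum>c<N. g $$ (a, c) * g $$ (b, c)) = (\<Sum>c<N. transpose_mat g $$ (c, a) * transpose_mat g $$ (c, b))"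
    using g assms by (intro sum.cong) auto
  then show ?thesis
    using orthogonal_group_columns[OF transpose_orthogonal[OF assms(1)] assms(2,3)] by simp
qed

lemma orthogonal_groupI:
  assumes "\<And>a b. a < N \<Longrightarrow> b < N \<Longrightarrow> (\<Sum>c<N. h c a * h c b) = of_bool (a = b)"
  shows "mat N N (\<lambda>(i, j). h i j) \<in> orthogonal_group N"
proof -
  have "transpose_mat (mat N N (\<lambda>(i, j). h i j)) * mat N N (\<lambda>(i, j). h i j) = 1\<^sub>m N"
    using assms by (intro eq_matI) (auto simp: scalar_prod_def atLeast0LessThan)
  then show ?thesis by (simp add: orthogonal_group_def)
qed

text \<open>
  The conjugate transpose.  The complex orthogonal group is closed under it, which makes the
  orthogonal complement of an invariant subspace of tensors invariant.
\<close>
definition adjoint_matrix :: "nat \<Rightarrow> complex mat \<Rightarrow> complex mat" where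
  "adjoint_matrix N g = mat N N (\<lambda>(i, j). cnj (g $$ (j, i)))"

lemma adjoint_orthogonal:
  assumes "g \<in> orthogonal_group N"
  shows "adjoint_matrix N g \<in> orthogonal_group N"
  unfolding adjoint_matrix_def
proof (rule orthogonal_groupI)
  fix a b assume ab: "a < N" "b < N"
  have "(\<Sum>c<N. cnj (g $$ (a, c)) * cnj (g $$ (b, c))) = cnj (\<Sum>c<N. g $$ (a, c) * g $$ (b, c))"
    by simp
  then show "(\<Sum>c<N. cnj (g $$ (a, c)) * cnj (g $$ (b, c))) = of_bool (a = b)"
    using orthogonal_group_rows[OF assms ab] by simp
qed

lemma multi_indices_less: "i \<in> multi_indices N n \<Longrightarrow> m \<in> {1..n} \<Longrightarrow> i m < N"
  by (auto simp: multi_indices_def)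

lemma tensor_power_adjoint:
  "tensor_inner N n (tensor_power N n g x) y = tensor_inner N n x (tensor_power N n (adjoint_matrix N g) y)"
proof -
  let ?M = "multi_indices N n"
  have "tensor_inner N n (tensor_power N n g x) y
      = (\<Sum>i\<in>?M. \<Sum>j\<in>?M. (\<Prod>m=1..n. g $$ (i m, j m)) * x j * cnj (y i))"
    unfolding cinner_on_def tensor_power_def by (intro sum.cong) (auto simp: sum_distrib_right)
  also have "\<dots> = (\<Sum>j\<in>?M. \<Sum>i\<in>?M. (\<Prod>m=1..n. g $$ (i m, j m)) * x j * cnj (y i))"
    by (rule sum.swap)
  also have "\<dots> = (\<Sum>j\<in>?M. x j * cnj (\<Sum>i\<in>?M. (\<Prod>m=1..n. adjoint_matrix N g $$ (j m, i m)) * y i))"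
  proof (rule sum.cong[OF refl])
    fix j assume j: "j \<in> ?M"
    have "cnj (\<Prod>m=1..n. adjoint_matrix N g $$ (j m, i m)) = (\<Prod>m=1..n. g $$ (i m, j m))"
      if i: "i \<in> ?M" for i
      unfolding cnj_prod
      using multi_indices_less[OF i] multi_indices_less[OF j]
      by (intro prod.cong) (auto simp: adjoint_matrix_def)
    then show "(\<Sum>i\<in>?M. (\<Prod>m=1..n. g $$ (i m, j m)) * x j * cnj (y i))
        = x j * cnj (\<Sum>i\<in>?M. (\<Prod>m=1..n. adjoint_matrix N g $$ (j m, i m)) * y i)"
      by (simp add: sum_distrib_left mult_ac del: cnj_prod)
  qed
  also have "\<dots> = tensor_inner N n x (tensor_power N n (adjoint_matrix N g) y)"
    unfolding cinner_on_def tensor_power_def by (intro sum.cong) auto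
  finally show ?thesis .
qed

lemma tensor_power_inverse:
  assumes g: "g \<in> orthogonal_group N" and t: "t \<in> tensors N n"
  shows "tensor_power N n (transpose_mat g) (tensor_power N n g t) = t"
proof
  fix i
  let ?M = "multi_indices N n" and ?h = "transpose_mat g"
  show "tensor_power N n ?h (tensor_power N n g t) i = t i"
  proof (cases "i \<in> ?M")
    case i: True
    have car: "g \<in> carrier_mat N N" using g by (simp add: orthogonal_group_def)
    have "tensor_power N n ?h (tensor_power N n g t) i
        = (\<Sum>j\<in>?M. \<Sum>k\<in>?M. (\<Prod>m=1..n. ?h $$ (i m, j m)) * ((\<Prod>m=1..n. g $$ (j m, k m)) * t k))"
      using i unfolding tensor_power_def by (simp add: sum_distrib_left)
    also have "\<dots> = (\<Sum>k\<in>?M. \<Sum>j\<in>?M. (\<Prod>m=1..n. ?h $$ (i m, j m)) * ((\<Prod>m=1..n. g $$ (j m, k m)) * t k))"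
      by (rule sum.swap)
    also have "\<dots> = (\<Sum>k\<in>?M. (if k = i then t i else 0))"
    proof (rule sum.cong[OF refl])
      fix k assume k: "k \<in> ?M"
      have "(\<Sum>j\<in>?M. (\<Prod>m=1..n. ?h $$ (i m, j m)) * ((\<Prod>m=1..n. g $$ (j m, k m)) * t k))
          = (\<Sum>j\<in>?M. \<Prod>m=1..n. ?h $$ (i m, j m) * g $$ (j m, k m)) * t k"
        by (simp add: sum_distrib_right prod.distrib mult.assoc)
      also have "(\<Sum>j\<in>?M. \<Prod>m=1..n. ?h $$ (i m, j m) * g $$ (j m, k m))
          = (\<Prod>m=1..n. \<Sum>c<N. ?h $$ (i m, c) * g $$ (c, k m))"
        unfolding multi_indices_def by (rule prod_sum_PiE[symmetric]) auto
      also have "\<dots> = (\<Prod>m\<in>{1..n}. of_bool (i m = k m))"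
      proof (rule prod.cong[OF refl])
        fix m assume m: "m \<in> {1..n}"
        have less: "i m < N" "k m < N" using multi_indices_less[OF i m] multi_indices_less[OF k m] .
        have "(\<Sum>c<N. ?h $$ (i m, c) * g $$ (c, k m)) = (\<Sum>c<N. g $$ (c, i m) * g $$ (c, k m))"
          using car less by (intro sum.cong) auto
        then show "(\<Sum>c<N. ?h $$ (i m, c) * g $$ (c, k m)) = of_bool (i m = k m)"
          using orthogonal_group_columns[OF g less] by simp
      qed
      also have "\<dots> = of_bool (\<forall>m\<in>{1..n}. i m = k m)"
        by (rule prod_of_bool) simp
      also have "(\<forall>m\<in>{1..n}. i m = k m) \<longleftrightarrow> k = i"
      proof
        assume "\<forall>m\<in>{1..n}. i m = k m"
        then show "k = i"
          using i k unfolding multi_indices_def by (intro PiE_ext[of k "{1..n}" _ i]) simp_all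
      qed simp
      finally show "(\<Sum>j\<in>?M. (\<Prod>m=1..n. ?h $$ (i m, j m)) * ((\<Prod>m=1..n. g $$ (j m, k m)) * t k))
          = (if k = i then t i else 0)" by auto
    qed
    also have "\<dots> = t i" using i by (simp add: finite_multi_indices)
    finally show ?thesis .
  next
    case False
    then show ?thesis using t by (auto simp: tensor_power_def tensors_def)
  qed
qed

lemma tensor_power_unit:
  assumes "i \<in> multi_indices N n"
  shows "tensor_power N n g (unit_tensor i) = (\<Sum>j\<in>multi_indices N n. (\<Prod>m=1..n. g $$ (j m, i m)) *\<^sub>C unit_tensor j)"
proof -
  have "tensor_power N n g (unit_tensor i) j = (\<Prod>m=1..n. g $$ (j m, i m))" if "j \<in> multi_indices N n" for j
  proof -
    have "tensor_power N n g (unit_tensor i) j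
        = (\<Sum>k\<in>multi_indices N n. if k = i then (\<Prod>m=1..n. g $$ (j m, i m)) else 0)"
      using that unfolding tensor_power_def unit_tensor_def by (auto intro!: sum.cong)
    then show ?thesis using assms by (simp add: finite_multi_indices)
  qed
  then show ?thesis
    by (subst tensor_expand[OF tensor_power_in]) (auto intro!: sum.cong)
qed

section \<open>Permutation of the tensor factors\<close>

lemma perm_operator_eq:
  assumes "s \<in> sym_group n"
  shows "perm_operator N n s t = (\<lambda>i. if i \<in> multi_indices N n then t (i \<circ> s) else 0)"
proof
  fix i
  show "perm_operator N n s t i = (if i \<in> multi_indices N n then t (i \<circ> s) else 0)"
  proof (cases "i \<in> multi_indices N n")
    case False
    have "perm_operator N n s t i = diagram_operator N n (perm_diagram n s) t i"
      by (simp add: perm_operator_def brauer_operator_basis[OF perm_diagram_in[OF assms]])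
    then show ?thesis using False by (simp add: diagram_operator_def)
  qed (simp add: perm_operator_apply[OF assms])
qed

lemma comp_in_indices:
  assumes "s \<in> sym_group n" "i \<in> multi_indices N n"
  shows "i \<circ> s \<in> multi_indices N n"
proof -
  have s: "s permutes {1..n}" using assms by (simp add: sym_group_def)
  have "(i \<circ> s) m < N" if "m \<in> {1..n}" for m
    using multi_indices_less[OF assms(2)] permutes_in_image[OF s] that by simp
  moreover have "(i \<circ> s) m = undefined" if "m \<notin> {1..n}" for m
    using assms(2) permutes_not_in[OF s that] that unfolding multi_indices_def
    by (simp add: PiE_iff extensional_def)
  ultimately show ?thesis
    unfolding multi_indices_def PiE_iff extensional_def by blast
qed

lemma perm_operator_in: "s \<in> sym_group n \<Longrightarrow> perm_operator N n s t \<in> tensors N n"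
  by (simp add: perm_operator_eq tensors_def)

lemma perm_operator_diff:
  "s \<in> sym_group n \<Longrightarrow> perm_operator N n s (x - y) = perm_operator N n s x - perm_operator N n s y"
  by (auto simp: perm_operator_eq fun_eq_iff)

lemma comp_inv_cancel:
  assumes "s \<in> sym_group n"
  shows "i \<circ> s \<circ> finv s = i" "i \<circ> finv s \<circ> s = i"
proof -
  have "s permutes {1..n}" using assms by (simp add: sym_group_def)
  note inv = permutes_inv_o[OF this]
  show "i \<circ> s \<circ> finv s = i" "i \<circ> finv s \<circ> s = i" by (simp_all only: comp_assoc inv comp_id)
qed

lemma sum_indices_comp:
  assumes "s \<in> sym_group n"
  shows "(\<Sum>i\<in>multi_indices N n. f (i \<circ> s)) = (\<Sum>i\<in>multi_indices N n. f i)"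
proof (rule sum.reindex_bij_witness[where i = "\<lambda>i. i \<circ> finv s" and j = "\<lambda>i. i \<circ> s"])
  fix i assume "i \<in> multi_indices N n"
  then show "i \<circ> s \<in> multi_indices N n" "i \<circ> finv s \<in> multi_indices N n"
    using assms by (simp_all only: comp_in_indices sym_group_inv)
qed (simp_all only: comp_inv_cancel[OF assms])

lemma perm_operator_adjoint:
  assumes s: "s \<in> sym_group n"
  shows "tensor_inner N n (perm_operator N n s x) y = tensor_inner N n x (perm_operator N n (finv s) y)"
proof -
  let ?M = "multi_indices N n"
  have "tensor_inner N n (perm_operator N n s x) y = (\<Sum>i\<in>?M. x (i \<circ> s) * cnj (y (i \<circ> s \<circ> finv s)))"
    unfolding cinner_on_def perm_operator_eq[OF s] comp_inv_cancel(1)[OF s] by (rule sum.cong) simp_all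
  also have "\<dots> = (\<Sum>i\<in>?M. x i * cnj (y (i \<circ> finv s)))"
    by (rule sum_indices_comp[OF s, of "\<lambda>i. x i * cnj (y (i \<circ> finv s))"])
  finally show ?thesis
    unfolding cinner_on_def perm_operator_eq[OF sym_group_inv[OF s]] by simp
qed

lemma tensor_power_perm:
  assumes s: "s \<in> sym_group n"
  shows "tensor_power N n g (perm_operator N n s t) = perm_operator N n s (tensor_power N n g t)"
proof
  fix i
  let ?M = "multi_indices N n"
  have perm: "s permutes {1..n}" using s by (simp add: sym_group_def)
  show "tensor_power N n g (perm_operator N n s t) i = perm_operator N n s (tensor_power N n g t) i"
  proof (cases "i \<in> ?M")
    case i: True
    have "perm_operator N n s (tensor_power N n g t) i
        = (\<Sum>j\<in>?M. (\<Prod>m=1..n. g $$ ((i \<circ> s) m, j m)) * t j)"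
      using i comp_in_indices[OF s i] by (simp add: perm_operator_eq[OF s] tensor_power_def)
    also have "\<dots> = (\<Sum>j\<in>?M. (\<Prod>m=1..n. g $$ ((i \<circ> s) m, (j \<circ> s) m)) * t (j \<circ> s))"
      by (rule sum_indices_comp[OF s, symmetric])
    also have "\<dots> = (\<Sum>j\<in>?M. (\<Prod>m=1..n. g $$ (i m, j m)) * t (j \<circ> s))"
    proof (rule sum.cong[OF refl])
      fix j
      have "(\<Prod>m=1..n. g $$ (i m, j m)) = (\<Prod>m=1..n. g $$ (i (s m), j (s m)))"
        using prod.permute[OF perm, of "\<lambda>m. g $$ (i m, j m)"] by (simp add: o_def)
      then show "(\<Prod>m=1..n. g $$ ((i \<circ> s) m, (j \<circ> s) m)) * t (j \<circ> s) = (\<Prod>m=1..n. g $$ (i m, j m)) * t (j \<circ> s)"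
        by simp
    qed
    also have "\<dots> = tensor_power N n g (perm_operator N n s t) i"
      using i unfolding tensor_power_def by (auto simp: perm_operator_eq[OF s] intro!: sum.cong)
    finally show ?thesis by simp
  qed (simp add: tensor_power_def perm_operator_eq[OF s])
qed

lemma perm_operator_transpose_unit:
  assumes "transpose x y \<in> sym_group n" "i \<in> multi_indices N n"
  shows "perm_operator N n (transpose x y) (unit_tensor i) = unit_tensor (i \<circ> transpose x y)"
proof
  fix j
  have "j \<circ> transpose x y = i \<longleftrightarrow> j = i \<circ> transpose x y"
    by (metis comp_assoc comp_id transpose_comp_involutory)
  moreover have "i \<circ> transpose x y \<in> multi_indices N n"
    by (rule comp_in_indices[OF assms])
  ultimately show "perm_operator N n (transpose x y) (unit_tensor i) j = unit_tensor (i \<circ> transpose x y) j"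
    by (auto simp: perm_operator_eq[OF assms(1)] unit_tensor_def)
qed

section \<open>Traceless tensors\<close>

text \<open>
  The invariant \<open>\<Sum>\<^sub>c u(c) \<otimes> u(c)\<close> at the places \<open>x\<close> and \<open>y\<close>, times the basis tensor of \<open>i\<close> at the
  other places.  The traceless tensors are those orthogonal to all such tensors with \<open>x \<noteq> y\<close>.
\<close>
definition cup_tensor :: "nat \<Rightarrow> nat \<Rightarrow> nat \<Rightarrow> (nat \<Rightarrow> nat) \<Rightarrow> tensor" where
  "cup_tensor N x y i = (\<Sum>c<N. unit_tensor (i(x := c, y := c)))"

lemma multi_indices_upd2:
  assumes "i \<in> indices N ({1..n} - {x, y})" "x \<in> {1..n}" "y \<in> {1..n}" "c < N"
  shows "i(x := c, y := c) \<in> multi_indices N n"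
  using assms unfolding multi_indices_def by (auto simp: PiE_iff extensional_def)

lemma cup_tensor_in:
  assumes "i \<in> indices N ({1..n} - {x, y})" "x \<in> {1..n}" "y \<in> {1..n}"
  shows "cup_tensor N x y i \<in> tensors N n"
  unfolding cup_tensor_def
  by (intro tensors_closed unit_tensor_in multi_indices_upd2[OF assms]) simp

lemma inner_cup_tensor:
  assumes "i \<in> indices N ({1..n} - {x, y})" "x \<in> {1..n}" "y \<in> {1..n}"
  shows "tensor_inner N n t (cup_tensor N x y i) = contract N x y t i"
proof -
  have "tensor_inner N n t (cup_tensor N x y i) = (\<Sum>c<N. tensor_inner N n t (unit_tensor (i(x := c, y := c))))"
    by (simp only: cup_tensor_def cinner_sum_right)
  also have "\<dots> = (\<Sum>c<N. t (i(x := c, y := c)))"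
  proof (rule sum.cong[OF refl])
    fix c assume c: "c \<in> {..<N}"
    let ?j = "i(x := c, y := c)"
    have "tensor_inner N n t (unit_tensor ?j) = (\<Sum>k\<in>multi_indices N n. if k = ?j then t ?j else 0)"
      unfolding cinner_on_def unit_tensor_def by (rule sum.cong) simp_all
    then show "tensor_inner N n t (unit_tensor ?j) = t ?j"
      using multi_indices_upd2[OF assms, of c] c by (simp add: finite_multi_indices del: fun_upd_apply)
  qed
  finally show ?thesis by (simp add: contract_def)
qed

lemma contraction_operator:
  assumes k: "k \<in> {1..n}" and l: "l \<in> {1..n}" and kl: "k \<noteq> l"
  shows "brauer_operator N n (brauer_basis (contraction_diagram n k l)) t i
    = (if i \<in> multi_indices N n \<and> i k = i l then contract N k l t i else 0)"
proof (cases "i \<in> multi_indices N n")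
  case i: True
  let ?C = "\<lambda>j. i k = i l \<and> j k = j l \<and> (\<forall>m\<in>{1..n} - {k, l}. i m = j m)"
  have compat: "compatible (contraction_diagram n k l) i j \<longleftrightarrow> ?C j" for j
  proof
    assume "compatible (contraction_diagram n k l) i j"
    then have *: "case_vertex i j x = case_vertex i j y"
      if "e \<in> contraction_diagram n k l" "x \<in> e" "y \<in> e" for e x y
      using that unfolding compatible_def by blast
    have "i m = j m" if "m \<in> {1..n} - {k, l}" for m
      using that *[of "{Plain m, Bar m}" "Plain m" "Bar m"] by (auto simp: contraction_diagram_def)
    moreover have "i k = i l" "j k = j l"
      using *[of "{Plain k, Plain l}" "Plain k" "Plain l"] *[of "{Bar k, Bar l}" "Bar k" "Bar l"]
      by (simp_all add: contraction_diagram_def)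
    ultimately show "?C j" by blast
  qed (auto simp: compatible_def contraction_diagram_def)
  have "brauer_operator N n (brauer_basis (contraction_diagram n k l)) t i
      = (\<Sum>j\<in>multi_indices N n. if ?C j then t j else 0)"
    using i unfolding brauer_operator_basis[OF contraction_diagram_in[OF k l kl]] diagram_operator_def
    by (simp add: compat)
  also have "\<dots> = (if i k = i l then \<Sum>j\<in>{j\<in>multi_indices N n. ?C j}. t j else 0)"
    by (simp add: sum.inter_filter[OF finite_multi_indices] if_sum)
  also have "\<dots> = (if i k = i l then contract N k l t i else 0)"
  proof (rule if_cong[OF refl _ refl])
    assume ikl: "i k = i l"
    show "(\<Sum>j\<in>{j\<in>multi_indices N n. ?C j}. t j) = contract N k l t i"
      unfolding contract_def
    proof (rule sum.reindex_bij_witness[where i = "\<lambda>c. i(k := c, l := c)" and j = "\<lambda>j. j k"])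
      fix j assume j: "j \<in> {j\<in>multi_indices N n. ?C j}"
      have "i(k := j k, l := j k) = j"
      proof
        fix m show "(i(k := j k, l := j k)) m = j m"
          using i j by (cases "m \<in> {1..n}") (auto simp: multi_indices_def PiE_iff extensional_def)
      qed
      then show "i(k := j k, l := j k) = j" "t (i(k := j k, l := j k)) = t j" by simp_all
      have "j \<in> multi_indices N n" using j by blast
      from multi_indices_less[OF this k] show "j k \<in> {..<N}" by simp
    next
      fix c assume "c \<in> {..<N}"
      then show "i(k := c, l := c) \<in> {j\<in>multi_indices N n. ?C j}"
        using i k l ikl by (auto simp: multi_indices_def PiE_iff extensional_def)
      show "(i(k := c, l := c)) k = c" by simp
    qed
  qed
  finally show ?thesis using i by simp
next
  case False
  then show ?thesis
    unfolding brauer_operator_basis[OF contraction_diagram_in[OF k l kl]] by (simp add: diagram_operator_def)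
qed

lemma traceless_iff:
  "t \<in> traceless_tensors N n \<longleftrightarrow> t \<in> tensors N n \<and>
     (\<forall>x\<in>{1..n}. \<forall>y\<in>{1..n}. x \<noteq> y \<longrightarrow> (\<forall>i\<in>indices N ({1..n} - {x, y}). contract N x y t i = 0))"
proof -
  have "brauer_operator N n (brauer_basis (contraction_diagram n x y)) t = 0
      \<longleftrightarrow> (\<forall>i\<in>indices N ({1..n} - {x, y}). contract N x y t i = 0)"
    if xy: "x \<in> {1..n}" "y \<in> {1..n}" "x \<noteq> y" for x y
  proof
    assume z: "brauer_operator N n (brauer_basis (contraction_diagram n x y)) t = 0"
    show "\<forall>i\<in>indices N ({1..n} - {x, y}). contract N x y t i = 0"
    proof
      fix i assume i: "i \<in> indices N ({1..n} - {x, y})"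
      show "contract N x y t i = 0"
      proof (cases "N = 0")
        case False
        let ?i = "i(x := 0, y := 0)"
        have "?i \<in> multi_indices N n" using False by (intro multi_indices_upd2[OF i xy(1,2)]) simp
        moreover have "?i x = ?i y" by simp
        ultimately have "brauer_operator N n (brauer_basis (contraction_diagram n x y)) t ?i = contract N x y t ?i"
          unfolding contraction_operator[OF xy] by (simp only: simp_thms if_True)
        then have "contract N x y t ?i = 0" unfolding z by simp
        moreover have "contract N x y t ?i = contract N x y t i" by (rule contract_cong) simp
        ultimately show ?thesis by simp
      qed (simp add: contract_def)
    qed
  next
    assume z: "\<forall>i\<in>indices N ({1..n} - {x, y}). contract N x y t i = 0"
    show "brauer_operator N n (brauer_basis (contraction_diagram n x y)) t = 0"
    proof
      fix i
      have "contract N x y t i = 0" if i: "i \<in> multi_indices N n"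
      proof -
        have "contract N x y t i = contract N x y t (restrict i ({1..n} - {x, y}))"
          using i by (intro contract_cong) (auto simp: multi_indices_def PiE_iff extensional_def)
        also have "\<dots> = 0"
          using z i unfolding multi_indices_def by (auto simp: PiE_iff)
        finally show ?thesis .
      qed
      then show "brauer_operator N n (brauer_basis (contraction_diagram n x y)) t i = 0 i"
        unfolding contraction_operator[OF xy] by simp
    qed
  qed
  then show ?thesis unfolding traceless_tensors_def by blast
qed

lemma contract_add: "contract N x y (s + t) i = contract N x y s i + contract N x y t i"
  by (simp add: contract_def sum.distrib)

lemma contract_zero: "contract N x y 0 i = 0"
  by (simp add: contract_def)

lemma contract_scale: "contract N x y (c *\<^sub>C t) i = c * contract N x y t i"
  by (simp add: contract_def scaleC_apply sum_distrib_left)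

lemma traceless_subset: "traceless_tensors N n \<subseteq> tensors N n"
  by (auto simp: traceless_tensors_def)

lemma csubspace_traceless: "csubspace (traceless_tensors N n)"
proof (unfold cvec.subspace_def, intro conjI ballI allI)
  show "0 \<in> traceless_tensors N n"
    unfolding traceless_iff by (simp add: contract_zero tensors_closed)
next
  fix x y assume "x \<in> traceless_tensors N n" "y \<in> traceless_tensors N n"
  then show "x + y \<in> traceless_tensors N n"
    unfolding traceless_iff by (simp add: contract_add tensors_closed)
next
  fix c x assume "x \<in> traceless_tensors N n"
  then show "c *\<^sub>C x \<in> traceless_tensors N n"
    unfolding traceless_iff by (simp add: contract_scale tensors_closed)
qed

lemma traceless_perm:
  assumes s: "s \<in> sym_group n" and t: "t \<in> traceless_tensors N n"
  shows "perm_operator N n s t \<in> traceless_tensors N n"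
  unfolding traceless_iff
proof (intro conjI ballI impI)
  show "perm_operator N n s t \<in> tensors N n" by (rule perm_operator_in[OF s])
  fix x y i assume xy: "x \<in> {1..n}" "y \<in> {1..n}" "x \<noteq> y" and i: "i \<in> indices N ({1..n} - {x, y})"
  have perm: "s permutes {1..n}" using s by (simp add: sym_group_def)
  let ?x = "finv s x" and ?y = "finv s y"
  have inv: "s m = z \<longleftrightarrow> m = finv s z" for m z
    using permutes_inverses[OF perm] by auto
  have xy': "?x \<in> {1..n}" "?y \<in> {1..n}" "?x \<noteq> ?y"
    using xy permutes_in_image[OF permutes_inv[OF perm]] permutes_inj[OF permutes_inv[OF perm]]
    by (auto dest: injD)
  have upd: "i(x := c, y := c) \<circ> s = (i \<circ> s)(?x := c, ?y := c)" for c
    by (auto simp: fun_eq_iff inv)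
  have "contract N x y (perm_operator N n s t) i = (\<Sum>c<N. t (i(x := c, y := c) \<circ> s))"
    unfolding contract_def using multi_indices_upd2[OF i xy(1,2)]
    by (intro sum.cong refl) (simp add: perm_operator_eq[OF s] del: fun_upd_apply)
  also have "\<dots> = contract N ?x ?y t (i \<circ> s)"
    by (simp only: upd contract_def)
  also have "\<dots> = contract N ?x ?y t (restrict (i \<circ> s) ({1..n} - {?x, ?y}))"
  proof (rule contract_cong)
    fix z assume z: "z \<noteq> ?x" "z \<noteq> ?y"
    show "(i \<circ> s) z = restrict (i \<circ> s) ({1..n} - {?x, ?y}) z"
    proof (cases "z \<in> {1..n}")
      case False
      then show ?thesis
        using i permutes_not_in[OF perm False] by (auto simp: PiE_iff extensional_def)
    qed (use z in simp)
  qed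
  also have "\<dots> = 0"
  proof -
    have "restrict (i \<circ> s) ({1..n} - {?x, ?y}) \<in> indices N ({1..n} - {?x, ?y})"
    proof (rule restrict_PiE_iff[THEN iffD2], rule ballI)
      fix z assume z: "z \<in> {1..n} - {?x, ?y}"
      then have "s z \<in> {1..n} - {x, y}" using permutes_in_image[OF perm] by (auto simp: inv)
      then show "(i \<circ> s) z \<in> {..<N}" using i by (auto simp: PiE_iff)
    qed
    then show ?thesis using t xy' unfolding traceless_iff by blast
  qed
  finally show "contract N x y (perm_operator N n s t) i = 0" .
qed

lemma contract_tensor_power:
  assumes g: "g \<in> orthogonal_group N" and xy: "x \<in> {1..n}" "y \<in> {1..n}" "x \<noteq> y"
    and i: "i \<in> indices N ({1..n} - {x, y})"
  shows "contract N x y (tensor_power N n g t) i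
    = (\<Sum>j\<in>indices N ({1..n} - {x, y}). (\<Prod>m\<in>{1..n} - {x, y}. g $$ (i m, j m)) * contract N x y t j)"
proof -
  have "contract N x y (tensor_power N n g t) i
      = contract N x y (\<lambda>i. \<Sum>j\<in>indices N {1..n}. (\<Prod>m\<in>{1..n}. g $$ (i m, j m)) * t j) i"
    unfolding contract_def using multi_indices_upd2[OF i xy(1,2)]
    by (intro sum.cong refl) (simp add: tensor_power_def del: fun_upd_apply, simp add: multi_indices_def)
  also have "\<dots> = (\<Sum>j\<in>indices N ({1..n} - {x, y}). (\<Prod>m\<in>{1..n} - {x, y}. g $$ (i m, j m)) * contract N x y t j)"
    using orthogonal_group_columns[OF g] xy
    by (intro contract_transform[of "{1..n}" x y N "\<lambda>i j. g $$ (i, j)"]) auto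
  finally show ?thesis .
qed

lemma traceless_tensor_power:
  assumes g: "g \<in> orthogonal_group N" and t: "t \<in> traceless_tensors N n"
  shows "tensor_power N n g t \<in> traceless_tensors N n"
  unfolding traceless_iff
proof (intro conjI ballI impI)
  fix x y i assume xy: "x \<in> {1..n}" "y \<in> {1..n}" "x \<noteq> y" and i: "i \<in> indices N ({1..n} - {x, y})"
  show "contract N x y (tensor_power N n g t) i = 0"
    unfolding contract_tensor_power[OF g xy i] using t xy unfolding traceless_iff
    by (intro sum.neutral ballI) simp
qed simp

section \<open>Orthogonality of images of equivariant maps\<close>

lemma HomD:
  assumes "f \<in> Hom A \<alpha> V \<beta> W"
  shows Hom_add: "x \<in> V \<Longrightarrow> y \<in> V \<Longrightarrow> f (x + y) = f x + f y"
    and Hom_scale: "x \<in> V \<Longrightarrow> f (c *\<^sub>C x) = c *\<^sub>C f x"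
    and Hom_in: "x \<in> V \<Longrightarrow> f x \<in> W"
    and Hom_equivariant: "g \<in> A \<Longrightarrow> x \<in> V \<Longrightarrow> f (\<alpha> g x) = \<beta> g (f x)"
    and Hom_outside: "x \<notin> V \<Longrightarrow> f x = 0"
  using assms by (auto simp: Hom_def linear_on_def)

lemma Hom_zero:
  assumes "f \<in> Hom A \<alpha> V \<beta> W"
  shows "f 0 = 0"
proof (cases "0 \<in> V")
  case True
  then show ?thesis using Hom_scale[OF assms True, of 0] by simp
qed (rule Hom_outside[OF assms])

lemma Hom_sum:
  assumes f: "f \<in> Hom A \<alpha> V \<beta> W" and V: "csubspace V" and x: "\<And>i. i \<in> I \<Longrightarrow> x i \<in> V"
  shows "f (\<Sum>i\<in>I. c i *\<^sub>C x i) = (\<Sum>i\<in>I. c i *\<^sub>C f (x i))"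
  using x
proof (induction I rule: infinite_finite_induct)
  case (insert i I)
  have "(\<Sum>i\<in>I. c i *\<^sub>C x i) \<in> V"
    using insert.prems by (intro cvec.subspace_sum[OF V] cvec.subspace_scale[OF V]) auto
  moreover have "c i *\<^sub>C x i \<in> V"
    using insert.prems by (intro cvec.subspace_scale[OF V]) auto
  ultimately have "f (c i *\<^sub>C x i + (\<Sum>i\<in>I. c i *\<^sub>C x i)) = c i *\<^sub>C f (x i) + f (\<Sum>i\<in>I. c i *\<^sub>C x i)"
    using Hom_add[OF f] Hom_scale[OF f] insert.prems by auto
  then show ?case
    using insert by (simp only: sum.insert[OF insert.hyps]) auto
qed (simp_all only: sum.infinite sum.empty Hom_zero[OF f] not_False_eq_True)

text \<open>
  The maps between tensor powers that commute with the complex orthogonal group.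
\<close>
abbreviation equivariant :: "nat \<Rightarrow> nat \<Rightarrow> nat \<Rightarrow> (tensor \<Rightarrow> tensor) set" where
  "equivariant N m p \<equiv>
     Hom (orthogonal_group N) (tensor_power N m) (tensors N m) (tensor_power N p) (tensors N p)"

definition kills_cups :: "nat \<Rightarrow> nat \<Rightarrow> (tensor \<Rightarrow> tensor) \<Rightarrow> bool" where
  "kills_cups N m a \<longleftrightarrow> (\<forall>x\<in>{1..m}. \<forall>y\<in>{1..m}. x \<noteq> y \<longrightarrow>
     (\<forall>i\<in>indices N ({1..m} - {x, y}). a (cup_tensor N x y i) = 0))"

text \<open>
  A multi-index on the disjoint union of the places of two tensors, the left ones of degree \<open>m\<close> and the
  right ones of degree \<open>l\<close>, consists of a left and a right part.
\<close>
definition left_index :: "nat \<Rightarrow> (nat + nat \<Rightarrow> nat) \<Rightarrow> nat \<Rightarrow> nat" where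
  "left_index m k = restrict (k \<circ> Inl) {1..m}"

definition right_index :: "nat \<Rightarrow> (nat + nat \<Rightarrow> nat) \<Rightarrow> nat \<Rightarrow> nat" where
  "right_index l k = restrict (k \<circ> Inr) {1..l}"

definition two_blocks :: "nat \<Rightarrow> nat \<Rightarrow> (nat + nat) set" where
  "two_blocks m l = Inl ` {1..m} \<union> Inr ` {1..l}"

lemma left_index_in: "k \<in> indices N (two_blocks m l) \<Longrightarrow> left_index m k \<in> multi_indices N m"
  and right_index_in: "k \<in> indices N (two_blocks m l) \<Longrightarrow> right_index l k \<in> multi_indices N l"
  by (auto simp: left_index_def right_index_def two_blocks_def multi_indices_def PiE_iff)

lemma two_blocks_iff: "Inl x \<in> two_blocks m l \<longleftrightarrow> x \<in> {1..m}" "Inr y \<in> two_blocks m l \<longleftrightarrow> y \<in> {1..l}"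
  by (auto simp: two_blocks_def)

lemma case_sum_in:
  assumes "i \<in> multi_indices N m" "j \<in> multi_indices N l"
  shows "case_sum i j \<in> indices N (two_blocks m l)"
proof (rule PiE_I)
  fix z assume "z \<in> two_blocks m l"
  then show "case_sum i j z \<in> {..<N}"
    using assms by (cases z) (auto simp: two_blocks_iff multi_indices_def PiE_iff)
next
  fix z assume "z \<notin> two_blocks m l"
  then show "case_sum i j z = undefined"
    using assms by (cases z) (auto simp: two_blocks_iff multi_indices_def PiE_iff extensional_def)
qed

lemma left_index_case_sum: "i \<in> multi_indices N m \<Longrightarrow> left_index m (case_sum i j) = i"
  and right_index_case_sum: "j \<in> multi_indices N l \<Longrightarrow> right_index l (case_sum i j) = j"
  by (auto simp: left_index_def right_index_def multi_indices_def PiE_iff extensional_def fun_eq_iff)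

lemma case_sum_index:
  assumes "k \<in> indices N (two_blocks m l)"
  shows "case_sum (left_index m k) (right_index l k) = k"
proof
  fix z show "case_sum (left_index m k) (right_index l k) z = k z"
  proof (cases "z \<in> two_blocks m l")
    case True
    then show ?thesis
      by (cases z) (simp_all add: two_blocks_iff left_index_def right_index_def)
  next
    case False
    moreover have "k z = undefined" by (rule PiE_arb[OF assms False])
    ultimately show ?thesis
      by (cases z) (auto simp: two_blocks_iff left_index_def right_index_def)
  qed
qed

lemma sum_two_blocks:
  "(\<Sum>k\<in>indices N (two_blocks m l). f (left_index m k) (right_index l k))
    = (\<Sum>i\<in>multi_indices N m. \<Sum>j\<in>multi_indices N l. f i j)"
proof -
  have "(\<Sum>k\<in>indices N (two_blocks m l). f (left_index m k) (right_index l k))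
      = (\<Sum>y\<in>multi_indices N m \<times> multi_indices N l. f (fst y) (snd y))"
    by (rule sum.reindex_bij_witness[where i = "\<lambda>y. case_sum (fst y) (snd y)"
          and j = "\<lambda>k. (left_index m k, right_index l k)"])
      (simp_all add: mem_Times_iff case_sum_index left_index_in right_index_in case_sum_in
        left_index_case_sum[of _ N] right_index_case_sum[of _ N] prod_eq_iff)
  then show ?thesis by (simp add: sum.cartesian_product split_beta)
qed

lemma prod_two_blocks:
  fixes g :: "nat \<Rightarrow> nat \<Rightarrow> real"
  shows "(\<Prod>z\<in>two_blocks m l. g (i z) (j z))
    = (\<Prod>x=1..m. g (left_index m i x) (left_index m j x)) * (\<Prod>x=1..l. g (right_index l i x) (right_index l j x))"
proof -
  have "(\<Prod>z\<in>two_blocks m l. g (i z) (j z))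
      = (\<Prod>z\<in>Inl ` {1..m}. g (i z) (j z)) * (\<Prod>z\<in>Inr ` {1..l}. g (i z) (j z))"
    unfolding two_blocks_def by (rule prod.union_disjoint) auto
  then show ?thesis
    by (simp add: prod.reindex left_index_def right_index_def)
qed

lemma inner_linear_combinations:
  "tensor_inner N p (\<Sum>i\<in>I. c i *\<^sub>C x i) (\<Sum>j\<in>J. d j *\<^sub>C y j)
    = (\<Sum>i\<in>I. \<Sum>j\<in>J. c i * cnj (d j) * tensor_inner N p (x i) (y j))"
  by (simp only: cinner_sum_left cinner_scale_left)
    (simp only: cinner_sum_right cinner_scale_right sum_distrib_left mult.assoc)

text \<open>
  For a complex matrix the invariance of a Hermitian form involves the complex conjugate of the matrix;
  for a real orthogonal one both arguments transform in the same way.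
\<close>
lemma pairing_invariant:
  assumes a: "a \<in> equivariant N m p" and b: "b \<in> equivariant N l p"
  shows "invariant_array N (two_blocks m l)
    (\<lambda>k. tensor_inner N p (a (unit_tensor (left_index m k))) (b (unit_tensor (right_index l k))))"
  unfolding invariant_array_def
proof (intro allI impI ballI)
  fix g k assume g: "orthogonal_fun N g" and k: "k \<in> indices N (two_blocks m l)"
  define h where "h = mat N N (\<lambda>(c, d). complex_of_real (g c d))"
  define G where "G = transpose_mat h"
  have h: "h \<in> orthogonal_group N"
    unfolding h_def
  proof (rule orthogonal_groupI)
    fix c d assume cd: "c < N" "d < N"
    have "(\<Sum>e<N. complex_of_real (g e c) * of_real (g e d)) = of_real (\<Sum>e<N. g e c * g e d)" by simp
    also have "(\<Sum>e<N. g e c * g e d) = of_bool (c = d)"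
      using g cd unfolding orthogonal_fun_def by blast
    finally show "(\<Sum>e<N. complex_of_real (g e c) * of_real (g e d)) = of_bool (c = d)" by simp
  qed
  have G: "G \<in> orthogonal_group N" unfolding G_def by (rule transpose_orthogonal[OF h])
  have entry: "G $$ (c, d) = of_real (g d c)" if "c < N" "d < N" for c d
    using that by (simp add: G_def h_def)
  have adj: "adjoint_matrix N G = transpose_mat G"
    unfolding adjoint_matrix_def G_def h_def by (rule eq_matI) auto
  let ?i = "left_index m k" and ?j = "right_index l k"
  let ?A = "\<lambda>i. complex_of_real (\<Prod>x=1..m. g (?i x) (i x))" and ?B = "\<lambda>j. complex_of_real (\<Prod>x=1..l. g (?j x) (j x))"
  note i = left_index_in[OF k] and j = right_index_in[OF k]
  have Gi: "tensor_power N m G (unit_tensor ?i) = (\<Sum>i\<in>multi_indices N m. ?A i *\<^sub>C unit_tensor i)"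
    unfolding tensor_power_unit[OF i] of_real_prod
    using multi_indices_less[OF i] multi_indices_less[of _ N m]
    by (intro sum.cong refl arg_cong2[of _ _ _ _ scaleC] prod.cong entry) auto
  have Gj: "tensor_power N l G (unit_tensor ?j) = (\<Sum>j\<in>multi_indices N l. ?B j *\<^sub>C unit_tensor j)"
    unfolding tensor_power_unit[OF j] of_real_prod
    using multi_indices_less[OF j] multi_indices_less[of _ N l]
    by (intro sum.cong refl arg_cong2[of _ _ _ _ scaleC] prod.cong entry) auto
  have ai: "a (\<Sum>i\<in>multi_indices N m. ?A i *\<^sub>C unit_tensor i) = (\<Sum>i\<in>multi_indices N m. ?A i *\<^sub>C a (unit_tensor i))"
    by (rule Hom_sum[OF a csubspace_tensors unit_tensor_in])
  have bj: "b (\<Sum>j\<in>multi_indices N l. ?B j *\<^sub>C unit_tensor j) = (\<Sum>j\<in>multi_indices N l. ?B j *\<^sub>C b (unit_tensor j))"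
    by (rule Hom_sum[OF b csubspace_tensors unit_tensor_in])
  have "(\<Sum>k'\<in>indices N (two_blocks m l). of_real (\<Prod>z\<in>two_blocks m l. g (k z) (k' z)) *
      tensor_inner N p (a (unit_tensor (left_index m k'))) (b (unit_tensor (right_index l k'))))
    = (\<Sum>i\<in>multi_indices N m. \<Sum>j\<in>multi_indices N l. ?A i * cnj (?B j) *
        tensor_inner N p (a (unit_tensor i)) (b (unit_tensor j)))"
    unfolding prod_two_blocks of_real_mult complex_cnj_complex_of_real
    by (rule sum_two_blocks[where f = "\<lambda>i j. ?A i * ?B j * tensor_inner N p (a (unit_tensor i)) (b (unit_tensor j))"])
  also have "\<dots> = tensor_inner N p (\<Sum>i\<in>multi_indices N m. ?A i *\<^sub>C a (unit_tensor i))
      (\<Sum>j\<in>multi_indices N l. ?B j *\<^sub>C b (unit_tensor j))"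
    by (rule inner_linear_combinations[symmetric])
  also have "\<dots> = tensor_inner N p (a (tensor_power N m G (unit_tensor ?i))) (b (tensor_power N l G (unit_tensor ?j)))"
    unfolding Gi Gj ai bj ..
  also have "\<dots> = tensor_inner N p (tensor_power N p G (a (unit_tensor ?i))) (tensor_power N p G (b (unit_tensor ?j)))"
    using Hom_equivariant[OF a G] Hom_equivariant[OF b G] unit_tensor_in[OF i] unit_tensor_in[OF j] by simp
  also have "\<dots> = tensor_inner N p (a (unit_tensor ?i)) (b (unit_tensor ?j))"
    unfolding tensor_power_adjoint adj
    using tensor_power_inverse[OF G] Hom_in[OF b] unit_tensor_in[OF j] by simp
  finally show "(\<Sum>k'\<in>indices N (two_blocks m l). of_real (\<Prod>z\<in>two_blocks m l. g (k z) (k' z)) *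
      tensor_inner N p (a (unit_tensor (left_index m k'))) (b (unit_tensor (right_index l k'))))
    = tensor_inner N p (a (unit_tensor ?i)) (b (unit_tensor ?j))" .
qed

lemma sum_cup_image:
  assumes a: "a \<in> equivariant N m p" and cup: "kills_cups N m a"
    and xy: "x \<in> {1..m}" "y \<in> {1..m}" "x \<noteq> y" and i: "i \<in> indices N ({1..m} - {x, y})"
  shows "(\<Sum>c<N. a (unit_tensor (i(x := c, y := c)))) = 0"
proof -
  have "a (\<Sum>c<N. 1 *\<^sub>C unit_tensor (i(x := c, y := c))) = (\<Sum>c<N. 1 *\<^sub>C a (unit_tensor (i(x := c, y := c))))"
    using multi_indices_upd2[OF i xy(1,2)] by (intro Hom_sum[OF a csubspace_tensors] unit_tensor_in) auto
  moreover have "a (cup_tensor N x y i) = 0"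
    using cup i xy unfolding kills_cups_def by blast
  ultimately show ?thesis by (simp only: scaleC_one cup_tensor_def)
qed

text \<open>
  The pairing \<open>\<langle>a \<delta>\<^sub>i, b \<delta>\<^sub>j\<rangle>\<close> is an invariant array with the two blocks of places of \<open>i\<close> and \<open>j\<close>.
  Its traces inside the blocks vanish because \<open>a\<close> and \<open>b\<close> kill cups.  Its trace along a bijection \<open>r\<close>
  of the blocks changes the sign under the transposition of two places \<open>x, y\<close> on the left together with
  \<open>r x, r y\<close> on the right.
\<close>
lemma equivariant_images_orthogonal:
  assumes a: "a \<in> equivariant N m p" and b: "b \<in> equivariant N l p"
    and cup_a: "kills_cups N m a" and cup_b: "kills_cups N l b"
    and sym: "\<And>r. bij_betw r {1..m} {1..l} \<Longrightarrow> \<exists>x\<in>{1..m}. \<exists>y\<in>{1..m}. \<exists>\<alpha> \<beta>. x \<noteq> y \<and> \<alpha> * cnj \<beta> = -1 \<and>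
      (\<forall>t\<in>tensors N m. a (perm_operator N m (transpose x y) t) = \<alpha> *\<^sub>C a t) \<and>
      (\<forall>t\<in>tensors N l. b (perm_operator N l (transpose (r x) (r y)) t) = \<beta> *\<^sub>C b t)"
    and s: "s \<in> tensors N m" and t: "t \<in> tensors N l"
  shows "tensor_inner N p (a s) (b t) = 0"
proof -
  let ?K = "two_blocks m l" and ?I = "Inl ` {1..m} :: (nat + nat) set" and ?J = "Inr ` {1..l} :: (nat + nat) set"
  let ?f = "\<lambda>i j. tensor_inner N p (a (unit_tensor i)) (b (unit_tensor j))"
  define F where "F k = ?f (left_index m k) (right_index l k)" for k
  have K: "?K = ?I \<union> ?J" by (simp add: two_blocks_def)
  have "F k = 0" if "k \<in> indices N (?I \<union> ?J)" for k
  proof (rule two_block_eq_0[of ?I ?J N F k])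
    show "finite ?I" "finite ?J" "?I \<inter> ?J = {}" by auto
    show "k \<in> indices N (?I \<union> ?J)" by fact
    show "invariant_array N (?I \<union> ?J) F"
      unfolding F_def[abs_def] K[symmetric] by (rule pairing_invariant[OF a b])
  next
    fix u v k assume uv: "u \<in> ?I" "v \<in> ?I" "u \<noteq> v" and k: "k \<in> indices N (?I \<union> ?J - {u, v})"
    obtain x where x: "u = Inl x" "x \<in> {1..m}" using uv(1) by blast
    obtain y where y: "v = Inl y" "y \<in> {1..m}" using uv(2) by blast
    have xy: "u = Inl x" "v = Inl y" "x \<in> {1..m}" "y \<in> {1..m}" "x \<noteq> y" using x y uv(3) by simp_all
    let ?i = "restrict (k \<circ> Inl) ({1..m} - {x, y})"
    have i: "?i \<in> indices N ({1..m} - {x, y})"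
      using k xy by (auto simp: PiE_iff)
    have left: "left_index m (k(u := c, v := c)) = ?i(x := c, y := c)" for c
      using xy by (auto simp: left_index_def fun_eq_iff)
    have right: "right_index l (k(u := c, v := c)) = right_index l k" for c
      using xy by (auto simp: right_index_def fun_eq_iff)
    have "contract N u v F k = (\<Sum>c<N. ?f (?i(x := c, y := c)) (right_index l k))"
      unfolding contract_def F_def left right ..
    also have "\<dots> = tensor_inner N p (\<Sum>c<N. a (unit_tensor (?i(x := c, y := c)))) (b (unit_tensor (right_index l k)))"
      by (simp only: cinner_sum_left)
    finally show "contract N u v F k = 0"
      by (simp only: sum_cup_image[OF a cup_a xy(3-5) i] cinner_zero)
  next
    fix u v k assume uv: "u \<in> ?J" "v \<in> ?J" "u \<noteq> v" and k: "k \<in> indices N (?I \<union> ?J - {u, v})"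
    obtain x where x: "u = Inr x" "x \<in> {1..l}" using uv(1) by blast
    obtain y where y: "v = Inr y" "y \<in> {1..l}" using uv(2) by blast
    have xy: "u = Inr x" "v = Inr y" "x \<in> {1..l}" "y \<in> {1..l}" "x \<noteq> y" using x y uv(3) by simp_all
    let ?i = "restrict (k \<circ> Inr) ({1..l} - {x, y})"
    have i: "?i \<in> indices N ({1..l} - {x, y})"
      using k xy by (auto simp: PiE_iff)
    have right: "right_index l (k(u := c, v := c)) = ?i(x := c, y := c)" for c
      using xy by (auto simp: right_index_def fun_eq_iff)
    have left: "left_index m (k(u := c, v := c)) = left_index m k" for c
      using xy by (auto simp: left_index_def fun_eq_iff)
    have "contract N u v F k = (\<Sum>c<N. ?f (left_index m k) (?i(x := c, y := c)))"
      unfolding contract_def F_def left right ..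
    also have "\<dots> = tensor_inner N p (a (unit_tensor (left_index m k))) (\<Sum>c<N. b (unit_tensor (?i(x := c, y := c))))"
      by (simp only: cinner_sum_right)
    finally show "contract N u v F k = 0"
      by (simp only: sum_cup_image[OF b cup_b xy(3-5) i] cinner_zero)
  next
    fix \<sigma> assume \<sigma>: "bij_betw \<sigma> ?I ?J"
    define r where "r = projr \<circ> (\<sigma> \<circ> Inl)"
    have "bij_betw r {1..m} {1..l}"
    proof -
      have "bij_betw Inl {1..m} ?I" "bij_betw projr ?J {1..l}"
        by (auto simp: bij_betw_def inj_on_def image_image)
      then show ?thesis
        unfolding r_def using \<sigma> by (intro bij_betw_trans)
    qed
    note r = this
    have \<sigma>r: "\<sigma> (Inl x) = Inr (r x)" if "x \<in> {1..m}" for x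
    proof -
      have "\<sigma> (Inl x) \<in> ?J" using bij_betwE[OF \<sigma>] that by blast
      then show ?thesis by (auto simp: r_def)
    qed
    obtain x y \<alpha> \<beta> where xy: "x \<in> {1..m}" "y \<in> {1..m}" "x \<noteq> y" "\<alpha> * cnj \<beta> = -1"
      and a_sym: "\<And>t. t \<in> tensors N m \<Longrightarrow> a (perm_operator N m (transpose x y) t) = \<alpha> *\<^sub>C a t"
      and b_sym: "\<And>t. t \<in> tensors N l \<Longrightarrow> b (perm_operator N l (transpose (r x) (r y)) t) = \<beta> *\<^sub>C b t"
      using sym[OF r] by blast
    let ?\<tau> = "transpose x y" and ?\<tau>' = "transpose (r x) (r y)"
    have rxy: "r x \<in> {1..l}" "r y \<in> {1..l}" using bij_betwE[OF r] xy by auto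
    have perm: "?\<tau> \<in> sym_group m" "?\<tau>' \<in> sym_group l"
      using xy rxy by (simp_all add: sym_group_def permutes_swap_id)
    have r\<tau>: "r (?\<tau> z) = ?\<tau>' (r z)" if "z \<in> {1..m}" for z
    proof -
      have "inj_on r {1..m}" using r by (rule bij_betw_imp_inj_on)
      then have "r z = r x \<longleftrightarrow> z = x" "r z = r y \<longleftrightarrow> z = y"
        using inj_on_eq_iff that xy(1,2) by metis+
      then show ?thesis by (simp add: transpose_def)
    qed
    \<comment> \<open>The involution of the terms of the trace that changes their sign.\<close>
    define \<theta> where "\<theta> k = case_sum (left_index m k \<circ> ?\<tau>) (right_index l k \<circ> ?\<tau>')" for k
    let ?S = "{k \<in> indices N (?I \<union> ?J). \<forall>x\<in>?I. k (\<sigma> x) = k x}"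
    have S_iff: "k \<in> ?S \<longleftrightarrow> k \<in> indices N ?K \<and> (\<forall>z\<in>{1..m}. right_index l k (r z) = left_index m k z)" for k
    proof -
      have "k (\<sigma> (Inl z)) = k (Inl z) \<longleftrightarrow> right_index l k (r z) = left_index m k z" if "z \<in> {1..m}" for z
        using that \<sigma>r[OF that] bij_betwE[OF r] by (simp add: right_index_def left_index_def)
      then show ?thesis unfolding K by auto
    qed
    have in\<theta>: "left_index m k \<circ> ?\<tau> \<in> multi_indices N m" "right_index l k \<circ> ?\<tau>' \<in> multi_indices N l"
      if "k \<in> indices N ?K" for k
      using comp_in_indices[OF perm(1) left_index_in[OF that]] comp_in_indices[OF perm(2) right_index_in[OF that]] .
    have left\<theta>: "left_index m (\<theta> k) = left_index m k \<circ> ?\<tau>" and right\<theta>: "right_index l (\<theta> k) = right_index l k \<circ> ?\<tau>'"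
      if "k \<in> indices N ?K" for k
      unfolding \<theta>_def by (rule left_index_case_sum[OF in\<theta>(1)[OF that]], rule right_index_case_sum[OF in\<theta>(2)[OF that]])
    have \<theta>_in: "\<theta> k \<in> indices N ?K" if "k \<in> indices N ?K" for k
      unfolding \<theta>_def by (rule case_sum_in[OF in\<theta>[OF that]])
    have \<theta>S: "\<theta> k \<in> ?S" if "k \<in> ?S" for k
    proof -
      have k: "k \<in> indices N ?K" and eq: "\<And>z. z \<in> {1..m} \<Longrightarrow> right_index l k (r z) = left_index m k z"
        using that unfolding S_iff by auto
      have "right_index l (\<theta> k) (r z) = left_index m (\<theta> k) z" if z: "z \<in> {1..m}" for z
      proof -
        have "?\<tau> z \<in> {1..m}" using xy z by (auto simp: transpose_def)
        then show ?thesis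
          unfolding left\<theta>[OF k] right\<theta>[OF k] comp_apply r\<tau>[OF z, symmetric] by (rule eq)
      qed
      then show ?thesis unfolding S_iff using \<theta>_in[OF k] by blast
    qed
    have \<theta>\<theta>: "\<theta> (\<theta> k) = k" if "k \<in> indices N ?K" for k
    proof -
      have "\<theta> (\<theta> k) = case_sum (left_index m (\<theta> k) \<circ> ?\<tau>) (right_index l (\<theta> k) \<circ> ?\<tau>')"
        by (simp only: \<theta>_def)
      also have "\<dots> = case_sum (left_index m k) (right_index l k)"
        unfolding left\<theta>[OF that] right\<theta>[OF that] comp_assoc transpose_comp_involutory comp_id ..
      finally show ?thesis using case_sum_index[OF that] by simp
    qed
    have F\<theta>: "F (\<theta> k) = - F k" if k: "k \<in> indices N ?K" for k
    proof -
      have "a (unit_tensor (left_index m k \<circ> ?\<tau>)) = \<alpha> *\<^sub>C a (unit_tensor (left_index m k))"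
        using a_sym[OF unit_tensor_in[OF left_index_in[OF k]]]
          perm_operator_transpose_unit[OF perm(1) left_index_in[OF k]] by simp
      moreover have "b (unit_tensor (right_index l k \<circ> ?\<tau>')) = \<beta> *\<^sub>C b (unit_tensor (right_index l k))"
        using b_sym[OF unit_tensor_in[OF right_index_in[OF k]]]
          perm_operator_transpose_unit[OF perm(2) right_index_in[OF k]] by simp
      ultimately have "F (\<theta> k) = (\<alpha> * cnj \<beta>) * F k"
        unfolding F_def left\<theta>[OF k] right\<theta>[OF k]
        by (simp only: cinner_scale_left cinner_scale_right mult_ac)
      then show ?thesis using xy(4) by simp
    qed
    have "(\<Sum>k\<in>?S. F k) = (\<Sum>k\<in>?S. F (\<theta> k))"
      using \<theta>S \<theta>\<theta> by (intro sum.reindex_bij_witness[where i = \<theta> and j = \<theta>]) (auto simp only: S_iff)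
    also have "\<dots> = (\<Sum>k\<in>?S. - F k)"
      by (rule sum.cong[OF refl], rule F\<theta>) (simp only: S_iff)
    finally show "(\<Sum>k\<in>?S. F k) = 0" by (simp add: sum_negf)
  qed
  then have z: "?f i j = 0" if "i \<in> multi_indices N m" "j \<in> multi_indices N l" for i j
    using case_sum_in[OF that] left_index_case_sum[OF that(1)] right_index_case_sum[OF that(2)]
    unfolding K F_def by metis
  have "a s = (\<Sum>i\<in>multi_indices N m. s i *\<^sub>C a (unit_tensor i))"
    by (subst tensor_expand[OF s], rule Hom_sum[OF a csubspace_tensors unit_tensor_in])
  moreover have "b t = (\<Sum>j\<in>multi_indices N l. t j *\<^sub>C b (unit_tensor j))"
    by (subst tensor_expand[OF t], rule Hom_sum[OF b csubspace_tensors unit_tensor_in])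
  ultimately show ?thesis
    by (simp add: inner_linear_combinations z)
qed

section \<open>The Weyl modules\<close>

text \<open>
  The action of the group ring on tensors.
\<close>
definition act :: "nat \<Rightarrow> nat \<Rightarrow> group_ring_element \<Rightarrow> tensor \<Rightarrow> tensor" where
  "act N m x t = (\<Sum>s\<in>sym_group m. x s *\<^sub>C perm_operator N m s t)"

lemma act_apply:
  "act N m x t i = (if i \<in> multi_indices N m then \<Sum>s\<in>sym_group m. x s * t (i \<circ> s) else 0)"
proof -
  have "act N m x t i = (\<Sum>s\<in>sym_group m. x s * (if i \<in> multi_indices N m then t (i \<circ> s) else 0))"
    unfolding act_def fun_sum_apply scaleC_apply
    by (intro sum.cong refl) (simp only: perm_operator_eq)
  then show ?thesis by simp
qed

lemma act_add_left: "act N m (x + y) t = act N m x t + act N m y t"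
  and act_add_right: "act N m x (t + u) = act N m x t + act N m x u"
  by (auto simp: fun_eq_iff act_apply algebra_simps sum.distrib)

lemma act_scale_left: "act N m (c *\<^sub>C x) t = c *\<^sub>C act N m x t"
  and act_scale_right: "act N m x (c *\<^sub>C t) = c *\<^sub>C act N m x t"
  by (auto simp: fun_eq_iff act_apply scaleC_apply sum_distrib_left mult_ac)

lemma act_traceless: "t \<in> traceless_tensors N m \<Longrightarrow> act N m x t \<in> traceless_tensors N m"
  unfolding act_def
  by (intro cvec.subspace_sum[OF csubspace_traceless] cvec.subspace_scale[OF csubspace_traceless] traceless_perm)

lemma act_basis:
  assumes "s \<in> sym_group m"
  shows "act N m (group_basis s) t = perm_operator N m s t"
proof
  fix i
  have "(\<Sum>r\<in>sym_group m. group_basis s r * t (i \<circ> r)) = (\<Sum>r\<in>sym_group m. if r = s then t (i \<circ> s) else 0)"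
    by (intro sum.cong) (auto simp: group_basis_def)
  then show "act N m (group_basis s) t i = perm_operator N m s t i"
    using assms by (simp add: act_apply perm_operator_eq finite_sym_group)
qed

lemma act_mult: "act N m (group_ring_mult m x y) t = act N m x (act N m y t)"
proof
  fix i
  let ?S = "sym_group m"
  show "act N m (gmult m x y) t i = act N m x (act N m y t) i"
  proof (cases "i \<in> multi_indices N m")
    case i: True
    have "act N m (gmult m x y) t i = (\<Sum>p\<in>?S. \<Sum>q\<in>?S. x p * y q * t (i \<circ> (p \<circ> q)))"
      using i by (simp only: act_apply if_True gmult_pairing)
    also have "\<dots> = (\<Sum>p\<in>?S. x p * act N m y t (i \<circ> p))"
      using comp_in_indices[OF _ i]
      by (intro sum.cong refl) (simp only: act_apply if_True sum_distrib_left comp_assoc mult.assoc)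
    finally show ?thesis using i by (simp only: act_apply[of N m x] if_True)
  qed (simp add: act_apply)
qed

lemma tensor_power_sum:
  "tensor_power N n g (\<Sum>i\<in>I. c i *\<^sub>C x i) = (\<Sum>i\<in>I. c i *\<^sub>C tensor_power N n g (x i))"
  by (induction I rule: infinite_finite_induct)
    (simp_all only: sum.infinite sum.empty sum.insert tensor_power_zero tensor_power_add
      tensor_power_scale not_False_eq_True)

lemma act_tensor_power: "act N m x (tensor_power N m g t) = tensor_power N m g (act N m x t)"
  unfolding act_def tensor_power_sum
  by (intro sum.cong refl) (simp only: tensor_power_perm)

lemma specht_moduleI: "x \<in> group_ring (card lam) \<Longrightarrow> gmult (card lam) x (young_symmetrizer lam) \<in> specht_module lam"
  by (auto simp: specht_module_def)

lemma specht_moduleE: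
  assumes "x \<in> specht_module lam"
  obtains y where "y \<in> group_ring (card lam)" "x = gmult (card lam) y (young_symmetrizer lam)"
  using assms unfolding specht_module_def by blast

lemma group_ring_closed:
  "x \<in> group_ring m \<Longrightarrow> y \<in> group_ring m \<Longrightarrow> x + y \<in> group_ring m"
  "x \<in> group_ring m \<Longrightarrow> c *\<^sub>C x \<in> group_ring m"
  "0 \<in> group_ring m"
  using csubspace_supported_on[of "sym_group m"] unfolding group_ring_eq cvec.subspace_def by blast+

lemma csubspace_specht: "csubspace (specht_module lam)"
proof (unfold cvec.subspace_def, intro conjI ballI allI)
  have "gmult (card lam) (0 *\<^sub>C 0) (young_symmetrizer lam) = 0 *\<^sub>C gmult (card lam) 0 (young_symmetrizer lam)"
    by (rule gmult_scale_left)
  then have "gmult (card lam) 0 (young_symmetrizer lam) = 0" by (simp only: cvec.scale_zero_left)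
  then show "0 \<in> specht_module lam"
    using specht_moduleI[OF group_ring_closed(3)] by metis
next
  fix x y assume "x \<in> specht_module lam" "y \<in> specht_module lam"
  then show "x + y \<in> specht_module lam"
    by (elim specht_moduleE) (simp only: gmult_add_left[symmetric] specht_moduleI group_ring_closed)
next
  fix c x assume "x \<in> specht_module lam"
  then show "c *\<^sub>C x \<in> specht_module lam"
    by (elim specht_moduleE) (simp only: gmult_scale_left[symmetric] specht_moduleI group_ring_closed)
qed

lemma young_symmetrizer_in_specht: "young_symmetrizer lam \<in> specht_module lam"
  using specht_moduleI[OF group_basis_in[OF sym_group_id]] gmult_one_left[OF young_symmetrizer_in]
  by metis

lemma specht_left_ideal: "x \<in> specht_module lam \<Longrightarrow> gmult (card lam) y x \<in> specht_module lam"
  by (elim specht_moduleE) (simp only: gmult_assoc[symmetric] specht_moduleI gmult_in)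

text \<open>
  The homomorphism \<open>x \<mapsto> x t\<close> from the Specht module to the tensors, for a traceless tensor \<open>t\<close>.  All
  vectors of the Weyl module arise in this way.
\<close>
definition weyl_map :: "nat \<Rightarrow> diagram \<Rightarrow> tensor \<Rightarrow> weyl_vector" where
  "weyl_map N lam t = (\<lambda>x. if x \<in> specht_module lam then act N (card lam) x t else 0)"

lemma weyl_map_in:
  assumes t: "t \<in> traceless_tensors N (card lam)"
  shows "weyl_map N lam t \<in> weyl_module N lam"
proof -
  have "linear_on (specht_module lam) (weyl_map N lam t)"
    unfolding linear_on_def weyl_map_def
    by (simp add: cvec.subspace_add[OF csubspace_specht] cvec.subspace_scale[OF csubspace_specht]
        act_add_left act_scale_left)
  moreover have "weyl_map N lam t ` specht_module lam \<subseteq> traceless_tensors N (card lam)"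
    using act_traceless[OF t] by (auto simp: weyl_map_def)
  moreover have "weyl_map N lam t (sym_action (card lam) s x) = perm_operator N (card lam) s (weyl_map N lam t x)"
    if "s \<in> sym_group (card lam)" "x \<in> specht_module lam" for s x
    using that specht_left_ideal[OF that(2)]
    by (simp only: weyl_map_def sym_action_def if_True act_mult act_basis)
  moreover have "weyl_map N lam t x = 0" if "x \<notin> specht_module lam" for x
    using that by (simp only: weyl_map_def if_False)
  ultimately show ?thesis unfolding weyl_module_def Hom_def by blast
qed

lemma weyl_map_add: "weyl_map N lam (t + u) = weyl_map N lam t + weyl_map N lam u"
  by (rule ext) (simp only: plus_fun_apply weyl_map_def act_add_right split: if_split, simp)

lemma scaleC_fun_apply: "(c *\<^sub>C f) x = c *\<^sub>C f x" for f :: "'a \<Rightarrow> 'b::complex_vector"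
  by (simp add: scaleC_fun_def)

lemma weyl_map_scale: "weyl_map N lam (c *\<^sub>C t) = c *\<^sub>C weyl_map N lam t"
  by (rule ext) (simp add: weyl_map_def act_scale_right scaleC_fun_apply)

lemma weyl_map_tensor_power:
  "weyl_map N lam (tensor_power N (card lam) g t) = tensor_power N (card lam) g \<circ> weyl_map N lam t"
  by (rule ext) (simp add: weyl_map_def act_tensor_power tensor_power_zero)

lemma group_ring_expand:
  assumes "x \<in> group_ring m"
  shows "x = (\<Sum>s\<in>sym_group m. x s *\<^sub>C group_basis s)"
  unfolding group_basis_def
  by (rule supported_on_expand[OF finite_sym_group assms[unfolded group_ring_eq]])

lemma gmult_sum_left:
  "gmult m (\<Sum>i\<in>I. c i *\<^sub>C x i) z = (\<Sum>i\<in>I. c i *\<^sub>C gmult m (x i) z)"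
proof -
  have z: "gmult m 0 z = 0"
    using gmult_scale_left[of m 0 0 z] by (simp only: cvec.scale_zero_left)
  show ?thesis
    by (induction I rule: infinite_finite_induct)
      (simp_all only: sum.infinite sum.empty sum.insert z gmult_add_left gmult_scale_left not_False_eq_True)
qed

lemma weyl_module_act:
  assumes \<phi>: "\<phi> \<in> weyl_module N lam" and y: "y \<in> specht_module lam" and x: "x \<in> group_ring (card lam)"
  shows "\<phi> (gmult (card lam) x y) = act N (card lam) x (\<phi> y)"
proof -
  let ?m = "card lam"
  note \<phi>' = \<phi>[unfolded weyl_module_def]
  have "gmult ?m x y = (\<Sum>s\<in>sym_group ?m. x s *\<^sub>C gmult ?m (group_basis s) y)"
    by (subst group_ring_expand[OF x]) (rule gmult_sum_left)
  then have "\<phi> (gmult ?m x y) = (\<Sum>s\<in>sym_group ?m. x s *\<^sub>C \<phi> (gmult ?m (group_basis s) y))"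
    by (simp only: Hom_sum[OF \<phi>' csubspace_specht specht_left_ideal[OF y]])
  also have "\<dots> = (\<Sum>s\<in>sym_group ?m. x s *\<^sub>C perm_operator N ?m s (\<phi> y))"
    using Hom_equivariant[OF \<phi>' _ y] by (intro sum.cong refl) (simp only: sym_action_def)
  finally show ?thesis by (simp only: act_def)
qed

lemma weyl_map_surj:
  assumes \<phi>: "\<phi> \<in> weyl_module N lam"
  shows "\<exists>t\<in>traceless_tensors N (card lam). \<phi> = weyl_map N lam t"
proof -
  let ?m = "card lam" and ?e = "young_symmetrizer lam"
  note \<phi>' = \<phi>[unfolded weyl_module_def]
  obtain z where z: "z \<in> group_ring ?m" "?e = gmult ?m ?e (gmult ?m z ?e)"
    using group_ring_regular[OF young_symmetrizer_in] by blast
  define t where "t = act N ?m z (\<phi> ?e)"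
  have t: "t \<in> traceless_tensors N ?m"
    unfolding t_def by (intro act_traceless Hom_in[OF \<phi>'] young_symmetrizer_in_specht)
  have e: "\<phi> ?e = act N ?m ?e t"
  proof -
    have "\<phi> ?e = \<phi> (gmult ?m (gmult ?m ?e z) ?e)"
      by (subst z(2)) (simp only: gmult_assoc)
    also have "\<dots> = act N ?m (gmult ?m ?e z) (\<phi> ?e)"
      by (rule weyl_module_act[OF \<phi> young_symmetrizer_in_specht gmult_in])
    finally show ?thesis by (simp only: act_mult t_def)
  qed
  have "\<phi> x = weyl_map N lam t x" for x
  proof (cases "x \<in> specht_module lam")
    case True
    then obtain y where y: "y \<in> group_ring ?m" "x = gmult ?m y ?e" by (rule specht_moduleE)
    have "\<phi> x = act N ?m y (\<phi> ?e)"
      unfolding y(2) by (rule weyl_module_act[OF \<phi> young_symmetrizer_in_specht y(1)])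
    also have "\<dots> = act N ?m x t" by (simp only: e y(2) act_mult)
    finally show ?thesis using True by (simp only: weyl_map_def if_True)
  next
    case False
    then show ?thesis using Hom_outside[OF \<phi>' False] by (simp only: weyl_map_def if_False)
  qed
  then show ?thesis using t by blast
qed

text \<open>
  A second parametrization of the Weyl module, symmetric in the rows: if \<open>e\<close> is the Young symmetrizer,
  \<open>t\<close> is multiplied by \<open>e\<^sup>*\<close> first, whereas \<open>weyl_map\<close> is alternating in the columns since \<open>e\<close> is.
\<close>
definition weyl_row_map :: "nat \<Rightarrow> diagram \<Rightarrow> tensor \<Rightarrow> weyl_vector" where
  "weyl_row_map N lam t =
     weyl_map N lam (act N (card lam) (star (card lam) (young_symmetrizer lam)) t)"

lemma weyl_row_map_surj:
  assumes \<phi>: "\<phi> \<in> weyl_module N lam"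
  shows "\<exists>t\<in>traceless_tensors N (card lam). \<phi> = weyl_row_map N lam t"
proof -
  let ?m = "card lam" and ?e = "young_symmetrizer lam"
  obtain t where t: "t \<in> traceless_tensors N ?m" "\<phi> = weyl_map N lam t"
    using weyl_map_surj[OF \<phi>] by blast
  obtain w where w: "w \<in> group_ring ?m" "?e = gmult ?m ?e (gmult ?m (star ?m ?e) w)"
    using exists_right_factor[OF young_symmetrizer_in] by blast
  have "weyl_map N lam t x = weyl_row_map N lam (act N ?m w t) x" for x
  proof (cases "x \<in> specht_module lam")
    case True
    then obtain y where y: "y \<in> group_ring ?m" "x = gmult ?m y ?e" by (rule specht_moduleE)
    have "x = gmult ?m y (gmult ?m ?e (gmult ?m (star ?m ?e) w))"
      unfolding y(2) by (rule arg_cong[OF w(2)])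
    then have "act N ?m x t = act N ?m y (act N ?m ?e (act N ?m (star ?m ?e) (act N ?m w t)))"
      by (simp only: act_mult)
    also have "\<dots> = act N ?m x (act N ?m (star ?m ?e) (act N ?m w t))"
      by (simp only: y(2) act_mult)
    finally show ?thesis using True by (simp only: weyl_row_map_def weyl_map_def if_True)
  qed (simp only: weyl_row_map_def weyl_map_def if_False)
  then have "weyl_map N lam t = weyl_row_map N lam (act N ?m w t)" by (rule ext)
  then show ?thesis using t act_traceless[OF t(1)] by metis
qed

lemma transpose_sym_group:
  assumes "finite lam" "same_line f lam x y"
  shows "transpose x y \<in> sym_group (card lam)"
  by (rule line_group_sym[OF transpose_in_line_group[OF assms]])

lemma weyl_map_column:
  assumes fin: "finite lam" and xy: "same_line snd lam x y" "x \<noteq> y"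
  shows "weyl_map N lam (perm_operator N (card lam) (transpose x y) t) = (- 1) *\<^sub>C weyl_map N lam t"
proof
  fix z
  let ?m = "card lam" and ?e = "young_symmetrizer lam" and ?\<tau> = "transpose x y"
  note \<tau> = transpose_sym_group[OF fin xy(1)]
  show "weyl_map N lam (perm_operator N ?m ?\<tau> t) z = ((- 1) *\<^sub>C weyl_map N lam t) z"
  proof (cases "z \<in> specht_module lam")
    case True
    then obtain u where u: "u \<in> group_ring ?m" "z = gmult ?m u ?e" by (rule specht_moduleE)
    have "act N ?m z (perm_operator N ?m ?\<tau> t) = act N ?m u (act N ?m (gmult ?m ?e (group_basis ?\<tau>)) t)"
      by (simp only: u(2) act_mult act_basis[OF \<tau>])
    also have "gmult ?m ?e (group_basis ?\<tau>) = (- 1) *\<^sub>C ?e"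
      by (simp only: young_symmetrizer_column[OF fin xy] cvec.scale_minus_left cvec.scale_one)
    also have "act N ?m u (act N ?m ((- 1) *\<^sub>C ?e) t) = (- 1) *\<^sub>C act N ?m z t"
      by (simp only: u(2) act_mult act_scale_left act_scale_right)
    finally show ?thesis using True by (simp only: weyl_map_def scaleC_fun_apply if_True)
  next
    case False
    then show ?thesis by (simp only: weyl_map_def scaleC_fun_apply if_False cvec.scale_zero_right)
  qed
qed

lemma weyl_row_map_row:
  assumes fin: "finite lam" and xy: "same_line fst lam x y"
  shows "weyl_row_map N lam (perm_operator N (card lam) (transpose x y) t) = weyl_row_map N lam t"
proof -
  let ?m = "card lam" and ?e = "young_symmetrizer lam" and ?\<tau> = "transpose x y"
  note \<tau> = transpose_sym_group[OF fin xy]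
  have "gmult ?m (star ?m ?e) (group_basis ?\<tau>) = gmult ?m (star ?m ?e) (star ?m (group_basis ?\<tau>))"
    by (simp add: star_basis[OF \<tau>])
  also have "\<dots> = star ?m ?e"
    by (simp only: star_mult[symmetric] young_symmetrizer_row[OF fin xy])
  finally have "act N ?m (star ?m ?e) (perm_operator N ?m ?\<tau> t) = act N ?m (star ?m ?e) t"
    by (simp only: act_mult[symmetric] act_basis[OF \<tau>, symmetric])
  then show ?thesis by (simp only: weyl_row_map_def)
qed

section \<open>Equivariant maps attached to the vectors of \<open>V(\<lambda>,p)\<close>\<close>

text \<open>
  The orthogonal projection onto the traceless tensors; it commutes with both group actions.
\<close>
abbreviation traceless_part :: "nat \<Rightarrow> nat \<Rightarrow> tensor \<Rightarrow> tensor" where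
  "traceless_part N m \<equiv> proj (multi_indices N m) (traceless_tensors N m)"

lemma finite_subspace_traceless: "finite_subspace (multi_indices N m) (traceless_tensors N m)"
  using traceless_subset[of N m] csubspace_traceless
  by unfold_locales (simp_all only: finite_multi_indices tensors_eq)

lemmas traceless_part_simps =
  finite_subspace.proj_in[OF finite_subspace_traceless]
  finite_subspace.proj_add[OF finite_subspace_traceless]
  finite_subspace.proj_scale[OF finite_subspace_traceless]

lemma traceless_part_perm:
  assumes "s \<in> sym_group m" "t \<in> tensors N m"
  shows "traceless_part N m (perm_operator N m s t) = perm_operator N m s (traceless_part N m t)"
  by (rule finite_subspace.proj_commute[OF finite_subspace_traceless, where Y = "perm_operator N m (finv s)"])
    (use assms in \<open>simp_all only: tensors_eq[symmetric] perm_operator_in perm_operator_diff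
      traceless_perm sym_group_inv perm_operator_adjoint\<close>)

lemma traceless_part_tensor_power:
  assumes "g \<in> orthogonal_group N" "t \<in> tensors N m"
  shows "traceless_part N m (tensor_power N m g t) = tensor_power N m g (traceless_part N m t)"
  by (rule finite_subspace.proj_commute[OF finite_subspace_traceless, where Y = "tensor_power N m (adjoint_matrix N g)"])
    (use assms in \<open>simp_all only: tensors_eq[symmetric] tensor_power_in tensor_power_diff
      traceless_tensor_power adjoint_orthogonal tensor_power_adjoint\<close>)

lemma traceless_part_cup:
  assumes xy: "x \<in> {1..m}" "y \<in> {1..m}" "x \<noteq> y" and i: "i \<in> indices N ({1..m} - {x, y})"
  shows "traceless_part N m (cup_tensor N x y i) = 0"
proof (rule finite_subspace.proj_eq_0[OF finite_subspace_traceless])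
  fix z assume z: "z \<in> traceless_tensors N m"
  have "tensor_inner N m z (cup_tensor N x y i) = 0"
    unfolding inner_cup_tensor[OF i xy(1,2)] using z xy i unfolding traceless_iff by blast
  then show "tensor_inner N m (cup_tensor N x y i) z = 0"
    by (subst cinner_commute) simp
qed

text \<open>
  A vector of \<open>V(\<lambda>,p)\<close> becomes an equivariant map of tensor powers when a parametrization \<open>j\<close> of the
  Weyl module by traceless tensors is composed with it.
\<close>
lemma exists_pullback:
  assumes w: "w \<in> V_module N lam p"
    and j_in: "\<And>t. t \<in> traceless_tensors N (card lam) \<Longrightarrow> j t \<in> weyl_module N lam"
    and j_add: "\<And>t u. j (t + u) = j t + j u"
    and j_scale: "\<And>c t. j (c *\<^sub>C t) = c *\<^sub>C j t"
    and j_power: "\<And>g t. j (tensor_power N (card lam) g t) = tensor_power N (card lam) g \<circ> j t"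
    and \<phi>: "\<exists>t\<in>traceless_tensors N (card lam). \<phi> = j t"
    and perm: "\<And>x y. R x y \<Longrightarrow> transpose x y \<in> sym_group (card lam)"
    and j_sym: "\<And>x y t. R x y \<Longrightarrow> j (perm_operator N (card lam) (transpose x y) t) = c *\<^sub>C j t"
  shows "\<exists>a\<in>equivariant N (card lam) p. kills_cups N (card lam) a \<and> (\<exists>t\<in>tensors N (card lam). a t = w \<phi>) \<and>
    (\<forall>x y. R x y \<longrightarrow>
      (\<forall>t\<in>tensors N (card lam). a (perm_operator N (card lam) (transpose x y) t) = c *\<^sub>C a t))"
proof -
  let ?m = "card lam"
  note w' = w[unfolded V_module_def]
  define a where "a = (\<lambda>t. if t \<in> tensors N ?m then w (j (traceless_part N ?m t)) else 0)"
  have jp: "j (traceless_part N ?m t) \<in> weyl_module N lam" for t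
    by (intro j_in traceless_part_simps)
  have a: "a t = w (j (traceless_part N ?m t))" if "t \<in> tensors N ?m" for t
    using that by (simp only: a_def if_True)
  have "linear_on (tensors N ?m) a"
    unfolding linear_on_def
    by (intro conjI ballI allI)
      (simp_all only: a tensors_closed traceless_part_simps j_add j_scale jp Hom_add[OF w'] Hom_scale[OF w'])
  moreover have "a ` tensors N ?m \<subseteq> tensors N p"
    using Hom_in[OF w' jp] by (auto simp: a)
  moreover have "a (tensor_power N ?m g t) = tensor_power N p g (a t)"
    if "g \<in> orthogonal_group N" "t \<in> tensors N ?m" for g t
    using that Hom_equivariant[OF w' that(1) jp]
    by (simp only: a tensor_power_in traceless_part_tensor_power j_power)
  moreover have "a t = 0" if "t \<notin> tensors N ?m" for t
    using that by (simp only: a_def if_False)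
  ultimately have equi: "a \<in> equivariant N ?m p" unfolding Hom_def by blast
  have "j 0 = 0"
    using j_scale[of 0 0] by (simp only: cvec.scale_zero_left)
  then have "a (cup_tensor N x y i) = 0"
    if "x \<in> {1..?m}" "y \<in> {1..?m}" "x \<noteq> y" "i \<in> indices N ({1..?m} - {x, y})" for x y i
    by (simp only: a[OF cup_tensor_in[OF that(4,1,2)]] traceless_part_cup[OF that] Hom_zero[OF w'])
  then have cups: "kills_cups N ?m a" unfolding kills_cups_def by blast
  obtain t where t: "t \<in> traceless_tensors N ?m" "\<phi> = j t" using \<phi> by blast
  have tt: "t \<in> tensors N ?m" using t traceless_subset by blast
  have "a t = w \<phi>"
    unfolding a[OF tt] finite_subspace.proj_id[OF finite_subspace_traceless t(1)] t(2) ..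
  moreover have "a (perm_operator N ?m (transpose x y) t) = c *\<^sub>C a t"
    if xy: "R x y" and t: "t \<in> tensors N ?m" for x y t
    unfolding a[OF t] a[OF perm_operator_in[OF perm[OF xy]]] traceless_part_perm[OF perm[OF xy] t] j_sym[OF xy]
    by (rule Hom_scale[OF w' jp])
  ultimately show ?thesis using equi cups tt by blast
qed

lemma exists_column_pullback:
  assumes fin: "finite lam" and w: "w \<in> V_module N lam p" and \<phi>: "\<phi> \<in> weyl_module N lam"
  shows "\<exists>a\<in>equivariant N (card lam) p. kills_cups N (card lam) a \<and> (\<exists>t\<in>tensors N (card lam). a t = w \<phi>) \<and>
    (\<forall>x y. same_line snd lam x y \<and> x \<noteq> y \<longrightarrow>
      (\<forall>t\<in>tensors N (card lam). a (perm_operator N (card lam) (transpose x y) t) = (- 1) *\<^sub>C a t))"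
  by (rule exists_pullback[OF w weyl_map_in weyl_map_add weyl_map_scale weyl_map_tensor_power
      weyl_map_surj[OF \<phi>]])
    (blast intro: transpose_sym_group[OF fin] weyl_map_column[OF fin])+

lemma exists_row_pullback:
  assumes fin: "finite lam" and w: "w \<in> V_module N lam p" and \<phi>: "\<phi> \<in> weyl_module N lam"
  shows "\<exists>a\<in>equivariant N (card lam) p. kills_cups N (card lam) a \<and> (\<exists>t\<in>tensors N (card lam). a t = w \<phi>) \<and>
    (\<forall>x y. same_line fst lam x y \<longrightarrow>
      (\<forall>t\<in>tensors N (card lam). a (perm_operator N (card lam) (transpose x y) t) = 1 *\<^sub>C a t))"
proof (rule exists_pullback[OF w, where j = "weyl_row_map N lam"])
  fix t u c g
  show "weyl_row_map N lam t \<in> weyl_module N lam" if "t \<in> traceless_tensors N (card lam)"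
    unfolding weyl_row_map_def by (intro weyl_map_in act_traceless that)
  show "weyl_row_map N lam (t + u) = weyl_row_map N lam t + weyl_row_map N lam u"
    "weyl_row_map N lam (c *\<^sub>C t) = c *\<^sub>C weyl_row_map N lam t"
    "weyl_row_map N lam (tensor_power N (card lam) g t) = tensor_power N (card lam) g \<circ> weyl_row_map N lam t"
    unfolding weyl_row_map_def
    by (simp_all only: act_add_right act_scale_right act_tensor_power weyl_map_add weyl_map_scale weyl_map_tensor_power)
next
  fix x y t assume "same_line fst lam x y"
  then show "transpose x y \<in> sym_group (card lam)"
    "weyl_row_map N lam (perm_operator N (card lam) (transpose x y) t) = 1 *\<^sub>C weyl_row_map N lam t"
    using transpose_sym_group[OF fin] weyl_row_map_row[OF fin] by (simp_all only: scaleC_one)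
qed (rule weyl_row_map_surj[OF \<phi>])

text \<open>
  Every bijection takes two entries in a row to two entries in a column.  The parametrization symmetric in
  the rows is used for the first module, and the one alternating in the columns for the second.
\<close>
lemma not_separated_orthogonal:
  assumes fin: "finite mu" "finite nu"
    and sep: "\<And>r. bij_betw r {1..card mu} {1..card nu} \<Longrightarrow> \<not> separates r mu nu"
    and v: "v \<in> V_module N mu p" and w: "w \<in> V_module N nu p"
    and \<phi>: "\<phi> \<in> weyl_module N mu" and \<psi>: "\<psi> \<in> weyl_module N nu"
  shows "tensor_inner N p (v \<phi>) (w \<psi>) = 0"
proof -
  obtain a s where a: "a \<in> equivariant N (card mu) p" "kills_cups N (card mu) a" "s \<in> tensors N (card mu)" "a s = v \<phi>"
    and a_row: "\<And>x y t. same_line fst mu x y \<Longrightarrow> t \<in> tensors N (card mu) \<Longrightarrow>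
      a (perm_operator N (card mu) (transpose x y) t) = 1 *\<^sub>C a t"
    using exists_row_pullback[OF fin(1) v \<phi>] by blast
  obtain b t where b: "b \<in> equivariant N (card nu) p" "kills_cups N (card nu) b" "t \<in> tensors N (card nu)" "b t = w \<psi>"
    and b_col: "\<And>x y t. same_line snd nu x y \<Longrightarrow> x \<noteq> y \<Longrightarrow> t \<in> tensors N (card nu) \<Longrightarrow>
      b (perm_operator N (card nu) (transpose x y) t) = (- 1) *\<^sub>C b t"
    using exists_column_pullback[OF fin(2) w \<psi>] by blast
  have "tensor_inner N p (a s) (b t) = 0"
  proof (rule equivariant_images_orthogonal[OF a(1) b(1) a(2) b(2) _ a(3) b(3)])
    fix r assume r: "bij_betw r {1..card mu} {1..card nu}"
    obtain x y where xy: "x \<noteq> y" "same_line fst mu x y" "same_line snd nu (r x) (r y)"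
      using sep[OF r] unfolding separates_def by blast
    have mem: "x \<in> {1..card mu}" "y \<in> {1..card mu}"
      using xy(2) bij_betw_tableau[OF fin(1)] by (auto simp: same_line_def dest: bij_betwE)
    have rne: "r x \<noteq> r y"
      using inj_on_eq_iff[OF bij_betw_imp_inj_on[OF r] mem] xy(1) by simp
    show "\<exists>x\<in>{1..card mu}. \<exists>y\<in>{1..card mu}. \<exists>\<alpha> \<beta>. x \<noteq> y \<and> \<alpha> * cnj \<beta> = -1 \<and>
        (\<forall>t\<in>tensors N (card mu). a (perm_operator N (card mu) (transpose x y) t) = \<alpha> *\<^sub>C a t) \<and>
        (\<forall>t\<in>tensors N (card nu). b (perm_operator N (card nu) (transpose (r x) (r y)) t) = \<beta> *\<^sub>C b t)"
      by (intro bexI[OF _ mem(1)] bexI[OF _ mem(2)] exI[of _ "1::complex"] exI[of _ "-1::complex"] conjI ballI,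
          rule xy(1), simp, rule a_row[OF xy(2)], assumption, rule b_col[OF xy(3) rne], assumption)
  qed
  then show ?thesis by (simp only: a(4) b(4))
qed

lemma V_images_orthogonal:
  assumes mu: "young_diagram mu" and nu: "young_diagram nu" and ne: "mu \<noteq> nu"
    and v: "v \<in> V_module N mu p" and w: "w \<in> V_module N nu p"
    and \<phi>: "\<phi> \<in> weyl_module N mu" and \<psi>: "\<psi> \<in> weyl_module N nu"
  shows "tensor_inner N p (v \<phi>) (w \<psi>) = 0"
proof -
  have fin: "finite mu" "finite nu" using mu nu by (simp_all add: young_diagram_def)
  show ?thesis
  proof (cases "\<exists>r. bij_betw r {1..card mu} {1..card nu} \<and> separates r mu nu")
    case False
    then show ?thesis by (intro not_separated_orthogonal[OF fin _ v w \<phi> \<psi>]) blast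
  next
    case True
    then have "\<not> separates r nu mu" if "bij_betw r {1..card nu} {1..card mu}" for r
      using separates_both_imp_eq[OF mu nu] that ne by blast
    then have "tensor_inner N p (w \<psi>) (v \<phi>) = 0"
      by (intro not_separated_orthogonal[OF fin(2,1) _ w v \<psi> \<phi>]) blast
    then show ?thesis by (subst cinner_commute) simp
  qed
qed

text \<open>
  In degree 0 the image pairs to zero with itself, because there are no bijections of the empty set of
  places with a nonempty one.
\<close>
lemma V_image_empty_degree:
  assumes lam: "finite lam" "lam \<noteq> {}" and v: "v \<in> V_module N lam 0" and \<phi>: "\<phi> \<in> weyl_module N lam"
  shows "v \<phi> = 0"
proof -
  obtain b t where b: "b \<in> equivariant N (card lam) 0" "kills_cups N (card lam) b" "t \<in> tensors N (card lam)" "b t = v \<phi>"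
    using exists_column_pullback[OF lam(1) v \<phi>] by blast
  define a where "a = (\<lambda>t. if t \<in> tensors N 0 then t else 0)"
  have a: "a \<in> equivariant N 0 0"
    unfolding Hom_def linear_on_def a_def by (auto simp: tensors_closed)
  have "kills_cups N 0 a" by (simp add: kills_cups_def)
  moreover have "\<not> bij_betw r {1..0} {1..card lam}" for r :: "nat \<Rightarrow> nat"
    using lam bij_betw_same_card[of r "{1..0}" "{1..card lam}"] by auto
  ultimately have "tensor_inner N 0 (a (v \<phi>)) (b t) = 0"
    using Hom_in[OF v[unfolded V_module_def] \<phi>]
    by (intro equivariant_images_orthogonal[OF a b(1) _ b(2) _ _ b(3)]) simp_all
  moreover have "v \<phi> \<in> tensors N 0"
    using Hom_in[OF v[unfolded V_module_def] \<phi>] .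
  ultimately show ?thesis
    using cinner_eq_0[OF finite_multi_indices, of "v \<phi>" N 0] by (simp only: a_def if_True b(4) tensors_eq)
qed

section \<open>Isotypic components of the tensor powers\<close>

text \<open>
  The component of the type \<open>U(\<lambda>,N)\<close> in the \<open>p\<close>-th tensor power: the sum of the images of \<open>U(\<lambda>,N)\<close>.
\<close>
definition isotypic :: "nat \<Rightarrow> diagram \<Rightarrow> nat \<Rightarrow> tensor set" where
  "isotypic N lam p = cspan (\<Union>v\<in>V_module N lam p. v ` weyl_module N lam)"

lemma csubspace_isotypic: "csubspace (isotypic N lam p)"
  unfolding isotypic_def by (rule cvec.subspace_span)

lemma isotypic_base: "v \<in> V_module N lam p \<Longrightarrow> \<phi> \<in> weyl_module N lam \<Longrightarrow> v \<phi> \<in> isotypic N lam p"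
  unfolding isotypic_def by (intro cvec.span_base) blast

lemma isotypic_induct [consumes 1]:
  assumes "t \<in> isotypic N lam p" and "csubspace S"
    and "\<And>v. v \<in> V_module N lam p \<Longrightarrow> v ` weyl_module N lam \<subseteq> S"
  shows "t \<in> S"
proof -
  have "isotypic N lam p \<subseteq> S"
    unfolding isotypic_def using assms(3) by (intro cvec.span_minimal assms(2)) blast
  then show ?thesis using assms(1) by blast
qed

lemma isotypic_subset: "isotypic N lam p \<subseteq> tensors N p"
proof
  fix t assume "t \<in> isotypic N lam p"
  then show "t \<in> tensors N p"
  proof (rule isotypic_induct[OF _ csubspace_tensors])
    fix v assume v: "v \<in> V_module N lam p"
    show "v ` weyl_module N lam \<subseteq> tensors N p"
      by (rule image_subsetI) (rule Hom_in[OF v[unfolded V_module_def]])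
  qed
qed

lemmas isotypic_tensors = subsetD[OF isotypic_subset]

lemma weyl_tensor_power:
  assumes g: "g \<in> orthogonal_group N" and \<phi>: "\<phi> \<in> weyl_module N lam"
  shows "tensor_power N (card lam) g \<circ> \<phi> \<in> weyl_module N lam"
proof -
  obtain t where t: "t \<in> traceless_tensors N (card lam)" "\<phi> = weyl_map N lam t"
    using weyl_map_surj[OF \<phi>] by blast
  show ?thesis
    unfolding t(2) weyl_map_tensor_power[symmetric] by (intro weyl_map_in traceless_tensor_power g t(1))
qed

lemma subspace_preimage:
  assumes "csubspace S" "\<And>x y. f (x + y) = f x + f y" "\<And>c x. f (c *\<^sub>C x) = c *\<^sub>C f x"
  shows "csubspace {x. f x \<in> S}"
proof -
  have "f 0 = 0" using assms(3)[of 0 0] by (simp only: cvec.scale_zero_left)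
  show ?thesis
  proof (rule cvec.subspaceI)
    show "0 \<in> {x. f x \<in> S}"
      using cvec.subspace_0[OF assms(1)] \<open>f 0 = 0\<close> by (simp only: mem_Collect_eq)
    show "x + y \<in> {x. f x \<in> S}" if "x \<in> {x. f x \<in> S}" "y \<in> {x. f x \<in> S}" for x y
      using cvec.subspace_add[OF assms(1)] that by (simp only: mem_Collect_eq assms(2))
    show "c *\<^sub>C x \<in> {x. f x \<in> S}" if "x \<in> {x. f x \<in> S}" for c x
      using cvec.subspace_scale[OF assms(1)] that by (simp only: mem_Collect_eq assms(3))
  qed
qed

lemma isotypic_tensor_power:
  assumes g: "g \<in> orthogonal_group N" and t: "t \<in> isotypic N lam p"
  shows "tensor_power N p g t \<in> isotypic N lam p"
proof -
  have "t \<in> {t. tensor_power N p g t \<in> isotypic N lam p}"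
    using t
  proof (rule isotypic_induct)
    show "csubspace {t. tensor_power N p g t \<in> isotypic N lam p}"
      by (intro subspace_preimage csubspace_isotypic tensor_power_add tensor_power_scale)
    fix v assume v: "v \<in> V_module N lam p"
    show "v ` weyl_module N lam \<subseteq> {t. tensor_power N p g t \<in> isotypic N lam p}"
    proof (rule image_subsetI)
      fix \<phi> assume \<phi>: "\<phi> \<in> weyl_module N lam"
      have eq: "v (tensor_power N (card lam) g \<circ> \<phi>) = tensor_power N p g (v \<phi>)"
        by (rule Hom_equivariant[OF v[unfolded V_module_def] g \<phi>])
      show "v \<phi> \<in> {t. tensor_power N p g t \<in> isotypic N lam p}"
        unfolding mem_Collect_eq eq[symmetric] by (rule isotypic_base[OF v weyl_tensor_power[OF g \<phi>]])
    qed
  qed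
  then show ?thesis by blast
qed

lemma isotypic_orthogonal:
  assumes "young_diagram mu" "young_diagram nu" "mu \<noteq> nu"
    and s: "s \<in> isotypic N mu p" and t: "t \<in> isotypic N nu p"
  shows "tensor_inner N p s t = 0"
proof -
  have left: "csubspace {s. tensor_inner N p s t = 0}" for t
    by (rule cvec.subspaceI)
      (simp_all only: mem_Collect_eq cinner_zero cinner_add_left cinner_scale_left mult_zero_right add_0)
  have right: "csubspace {t. tensor_inner N p s t = 0}" for s
    by (rule cvec.subspaceI)
      (simp_all only: mem_Collect_eq cinner_zero cinner_add_right cinner_scale_right mult_zero_right add_0)
  have "s \<in> {s. tensor_inner N p s t = 0}"
    using s
  proof (rule isotypic_induct[OF _ left])
    fix v assume v: "v \<in> V_module N mu p"
    show "v ` weyl_module N mu \<subseteq> {s. tensor_inner N p s t = 0}"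
    proof (rule image_subsetI)
      fix \<phi> assume \<phi>: "\<phi> \<in> weyl_module N mu"
      have "t \<in> {t. tensor_inner N p (v \<phi>) t = 0}"
        using t
      proof (rule isotypic_induct[OF _ right])
        fix w assume w: "w \<in> V_module N nu p"
        show "w ` weyl_module N nu \<subseteq> {t. tensor_inner N p (v \<phi>) t = 0}"
          using V_images_orthogonal[OF assms(1-3) v w \<phi>] by (intro image_subsetI CollectI)
    qed
    then show "v \<phi> \<in> {s. tensor_inner N p s t = 0}" by blast
    qed
  qed
  then show ?thesis by blast
qed

lemma isotypic_disjoint:
  assumes "young_diagram mu" "young_diagram nu" "mu \<noteq> nu"
    and "t \<in> isotypic N mu p" "t \<in> isotypic N nu p"
  shows "t = 0"
proof (rule cinner_eq_0[OF finite_multi_indices])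
  show "tensor_inner N p t t = 0" by (rule isotypic_orthogonal[OF assms])
  show "t \<in> supported_on (multi_indices N p)"
    using assms(4) isotypic_subset tensors_eq by blast
qed

lemma isotypic_degree_0:
  assumes "finite lam" "lam \<noteq> {}" "t \<in> isotypic N lam 0"
  shows "t = 0"
proof -
  have "t \<in> {0}"
    using assms(3)
  proof (rule isotypic_induct)
    show "csubspace {0 :: tensor}" by (rule cvec.subspace_single_0)
  next
    fix v assume v: "v \<in> V_module N lam 0"
    show "v ` weyl_module N lam \<subseteq> {0}"
      by (rule image_subsetI) (simp only: V_image_empty_degree[OF assms(1,2) v] singleton_iff)
  qed
  then show ?thesis by blast
qed

text \<open>
  The orthogonal projection onto the isotypic component, as an element of the centralizer algebra;
  these are 0 outside the tensors of degree \<open>p\<close>.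
\<close>
definition isotypic_projection :: "nat \<Rightarrow> diagram \<Rightarrow> nat \<Rightarrow> tensor \<Rightarrow> tensor" where
  "isotypic_projection N lam p t =
     (if t \<in> tensors N p then proj (multi_indices N p) (isotypic N lam p) t else 0)"

lemma finite_subspace_isotypic: "finite_subspace (multi_indices N p) (isotypic N lam p)"
  using isotypic_subset[of N lam p] csubspace_isotypic
  by unfold_locales (simp_all only: finite_multi_indices tensors_eq)

lemma isotypic_projection_centralizer: "isotypic_projection N lam p \<in> centralizer_algebra N p"
proof -
  interpret finite_subspace "multi_indices N p" "isotypic N lam p" by (rule finite_subspace_isotypic)
  let ?X = "isotypic_projection N lam p"
  have X: "?X t = proj (multi_indices N p) (isotypic N lam p) t" if "t \<in> tensors N p" for t
    using that by (simp only: isotypic_projection_def if_True)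
  have "linear_on (tensors N p) ?X"
    unfolding linear_on_def
    by (intro conjI ballI allI) (simp_all only: X tensors_closed proj_add proj_scale)
  moreover have "?X ` tensors N p \<subseteq> tensors N p"
    using isotypic_tensors[OF proj_in] by (auto simp: X)
  moreover have "?X (tensor_power N p g t) = tensor_power N p g (?X t)"
    if "g \<in> orthogonal_group N" "t \<in> tensors N p" for g t
    unfolding X[OF that(2)] X[OF tensor_power_in]
    by (rule proj_commute[where Y = "tensor_power N p (adjoint_matrix N g)"])
      (use that in \<open>simp_all only: tensors_eq[symmetric] tensor_power_in tensor_power_diff
        isotypic_tensor_power adjoint_orthogonal tensor_power_adjoint\<close>)
  moreover have "?X t = 0" if "t \<notin> tensors N p" for t
    using that by (simp only: isotypic_projection_def if_False)
  ultimately show ?thesis unfolding centralizer_algebra_def Hom_def by blast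
qed

lemma isotypic_projection_in: "isotypic_projection N lam p t \<in> isotypic N lam p"
  using finite_subspace.proj_in[OF finite_subspace_isotypic] cvec.subspace_0[OF csubspace_isotypic]
  by (simp add: isotypic_projection_def)

lemma isotypic_projection_id: "t \<in> isotypic N lam p \<Longrightarrow> isotypic_projection N lam p t = t"
  using finite_subspace.proj_id[OF finite_subspace_isotypic] isotypic_tensors
  by (simp only: isotypic_projection_def if_True)

lemma isotypic_projection_fixes:
  assumes v: "v \<in> V_module N lam p"
  shows "isotypic_projection N lam p \<circ> v = v"
proof
  fix y
  have "v y \<in> isotypic N lam p"
  proof (cases "y \<in> weyl_module N lam")
    case False
    then show ?thesis
      using Hom_outside[OF v[unfolded V_module_def]] cvec.subspace_0[OF csubspace_isotypic] by simp
  qed (rule isotypic_base[OF v])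
  then show "(isotypic_projection N lam p \<circ> v) y = v y" by (simp add: isotypic_projection_id)
qed

section \<open>Slices of tensors\<close>

text \<open>
  The tensor of degree \<open>k\<close> that results from \<open>t\<close> when the indices at the places after \<open>k\<close> are fixed
  to be those of \<open>i\<close>.
\<close>
definition slice :: "nat \<Rightarrow> nat \<Rightarrow> tensor \<Rightarrow> (nat \<Rightarrow> nat) \<Rightarrow> tensor" where
  "slice N k t i = (\<lambda>j. if j \<in> multi_indices N k then t (\<lambda>m. if m \<in> {1..k} then j m else i m) else 0)"

lemma slice_in: "slice N k t i \<in> tensors N k"
  by (simp add: slice_def tensors_def)

lemma slice_add: "slice N k (t + u) i = slice N k t i + slice N k u i"
  by (auto simp: slice_def fun_eq_iff)

lemma slice_scale: "slice N k (c *\<^sub>C t) i = c *\<^sub>C slice N k t i"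
  by (auto simp: slice_def fun_eq_iff scaleC_apply)

lemma ampliation_slice:
  "ampliation N k n X t i = (if i \<in> multi_indices N n then X (slice N k t i) (restrict i {1..k}) else 0)"
  by (simp add: ampliation_def slice_def)

lemma slice_ampliation_fixed:
  assumes kn: "k \<le> n" and i: "i \<in> multi_indices N n" and X: "X \<in> centralizer_algebra N k"
    and t: "ampliation N k n X t = t"
  shows "X (slice N k t i) = slice N k t i"
proof
  fix j
  show "X (slice N k t i) j = slice N k t i j"
  proof (cases "j \<in> multi_indices N k")
    case j: True
    let ?i = "\<lambda>m. if m \<in> {1..k} then j m else i m"
    have i': "?i \<in> multi_indices N n"
      using i j kn by (auto simp: multi_indices_def PiE_iff extensional_def)
    have "slice N k t ?i = slice N k t i"
      unfolding slice_def by (intro ext if_cong refl arg_cong[of _ _ t]) auto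
    moreover have "restrict ?i {1..k} = j"
      using j by (auto simp: multi_indices_def PiE_iff extensional_def fun_eq_iff)
    ultimately have "ampliation N k n X t ?i = X (slice N k t i) j"
      using i' by (simp only: ampliation_slice if_True)
    then show ?thesis using j unfolding t slice_def by simp
  next
    case False
    have "X (slice N k t i) \<in> tensors N k"
      using Hom_in[OF X[unfolded centralizer_algebra_def] slice_in] .
    then show ?thesis using False by (simp add: tensors_def slice_def)
  qed
qed

lemma ampliation_linear:
  assumes X: "X \<in> centralizer_algebra N k"
  shows "ampliation N k n X (t + u) = ampliation N k n X t + ampliation N k n X u"
    and "ampliation N k n X (c *\<^sub>C t) = c *\<^sub>C ampliation N k n X t"
proof -
  note X' = X[unfolded centralizer_algebra_def]
  show "ampliation N k n X (t + u) = ampliation N k n X t + ampliation N k n X u"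
    by (rule ext) (simp add: ampliation_slice slice_add Hom_add[OF X' slice_in slice_in])
  show "ampliation N k n X (c *\<^sub>C t) = c *\<^sub>C ampliation N k n X t"
    by (rule ext) (simp add: ampliation_slice slice_scale Hom_scale[OF X' slice_in] scaleC_apply)
qed

text \<open>
  The projection onto the isotypic component of \<open>mu\<close> is the identity on \<open>V(\<mu>,k)\<close>, hence on every
  isomorphic module.
\<close>
lemma V_component_fixed:
  assumes v: "v \<in> V_component N lam n mu k"
  shows "ampliation N k n (isotypic_projection N mu k) \<circ> v = v"
proof -
  let ?X = "isotypic_projection N mu k"
  note X = isotypic_projection_centralizer[of N mu k]
  note lin = ampliation_linear[OF X]
  have zero: "ampliation N k n ?X 0 = 0"
    using lin(2)[of n 0 0] by (simp only: cvec.scale_zero_left)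
  have fixed: "ampliation N k n ?X (x z) = x z" if "x \<in> {v. ampliation N k n ?X \<circ> v = v}"
    for x :: brauer_vector and z
    using that fun_cong[of "ampliation N k n ?X \<circ> x" x z] unfolding mem_Collect_eq comp_apply by blast
  have sub: "csubspace {v :: brauer_vector. ampliation N k n ?X \<circ> v = v}"
  proof (unfold cvec.subspace_def mem_Collect_eq, intro conjI ballI allI)
    show "ampliation N k n ?X \<circ> 0 = (0 :: brauer_vector)"
      by (rule ext) (simp only: comp_apply zero_fun_apply zero)
  next
    fix x y :: brauer_vector
    assume x: "x \<in> {v. ampliation N k n ?X \<circ> v = v}" and y: "y \<in> {v. ampliation N k n ?X \<circ> v = v}"
    show "ampliation N k n ?X \<circ> (x + y) = x + y"
      by (rule ext) (simp only: comp_apply plus_fun_apply lin fixed[OF x] fixed[OF y])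
  next
    fix c and x :: brauer_vector
    assume x: "x \<in> {v. ampliation N k n ?X \<circ> v = v}"
    show "ampliation N k n ?X \<circ> (c *\<^sub>C x) = c *\<^sub>C x"
      by (rule ext) (simp only: comp_apply scaleC_fun_apply[of c x] lin fixed[OF x])
  qed
  have "V_component N lam n mu k \<subseteq> {v. ampliation N k n ?X \<circ> v = v}"
    unfolding V_component_def
  proof (rule cvec.span_minimal[OF _ sub], rule Union_least)
    fix W assume "W \<in> {W \<in> submodules (centralizer_algebra N k) (\<lambda>X v. ampliation N k n X \<circ> v) (V_module N lam n).
      isomorphic_modules (centralizer_algebra N k) (\<lambda>X v. X \<circ> v) (V_module N mu k) (\<lambda>X v. ampliation N k n X \<circ> v) W}"
    then obtain f where f: "f \<in> Hom (centralizer_algebra N k) (\<lambda>X v. X \<circ> v) (V_module N mu k) (\<lambda>X v. ampliation N k n X \<circ> v) W"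
      and bij: "bij_betw f (V_module N mu k) W"
      unfolding isomorphic_modules_def by blast
    show "W \<subseteq> {v. ampliation N k n ?X \<circ> v = v}"
    proof
      fix v assume "v \<in> W"
      then obtain u where u: "u \<in> V_module N mu k" "v = f u"
        using bij by (auto simp: bij_betw_def)
      have "ampliation N k n ?X \<circ> f u = f (?X \<circ> u)"
        using Hom_equivariant[OF f X u(1)] by simp
      also have "\<dots> = f u" by (simp only: isotypic_projection_fixes[OF u(1)])
      finally show "v \<in> {v. ampliation N k n ?X \<circ> v = v}" by (simp add: u(2))
    qed
  qed
  then show ?thesis using v by blast
qed

lemma slice_in_isotypic:
  assumes v: "v \<in> V_component N lam n mu k" and kn: "k \<le> n" and i: "i \<in> multi_indices N n"
  shows "slice N k (v y) i \<in> isotypic N mu k"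
proof -
  have "ampliation N k n (isotypic_projection N mu k) (v y) = v y"
    by (rule fun_cong[OF V_component_fixed[OF v], unfolded comp_apply])
  from slice_ampliation_fixed[OF kn i isotypic_projection_centralizer this]
  show ?thesis using isotypic_projection_in by metis
qed

lemma slice_full:
  assumes t: "t \<in> tensors N n" and i: "i \<in> multi_indices N n"
  shows "slice N n t i = t"
proof
  fix j
  have "(\<lambda>m. if m \<in> {1..n} then j m else i m) = j" if "j \<in> multi_indices N n"
    using i that by (auto simp: multi_indices_def PiE_iff extensional_def fun_eq_iff)
  then show "slice N n t i j = t j"
    using t by (auto simp: slice_def tensors_def)
qed

section \<open>Contraction of the last two factors\<close>

text \<open>
  Contraction of the last two places, as a map from the tensors of degree \<open>p + 2\<close> to those of degree \<open>p\<close>.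
\<close>
definition contract_last :: "nat \<Rightarrow> nat \<Rightarrow> tensor \<Rightarrow> tensor" where
  "contract_last N p t = (\<lambda>j. if j \<in> multi_indices N p then contract N (p + 1) (p + 2) t j else 0)"

lemma contract_last_add: "contract_last N p (t + u) = contract_last N p t + contract_last N p u"
  by (auto simp: contract_last_def contract_add fun_eq_iff)

lemma contract_last_scale: "contract_last N p (c *\<^sub>C t) = c *\<^sub>C contract_last N p t"
  by (auto simp: contract_last_def contract_scale fun_eq_iff scaleC_apply)

lemma contract_last_in: "contract_last N p t \<in> tensors N p"
  by (simp add: contract_last_def tensors_def)

lemma contract_last_tensor_power:
  assumes g: "g \<in> orthogonal_group N"
  shows "contract_last N p (tensor_power N (p + 2) g t) = tensor_power N p g (contract_last N p t)"
proof
  fix i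
  have K: "{1..p + 2} - {p + 1, p + 2} = {1..p}" by auto
  show "contract_last N p (tensor_power N (p + 2) g t) i = tensor_power N p g (contract_last N p t) i"
  proof (cases "i \<in> multi_indices N p")
    case True
    have "contract N (p + 1) (p + 2) (tensor_power N (p + 2) g t) i
        = (\<Sum>j\<in>indices N {1..p}. (\<Prod>m\<in>{1..p}. g $$ (i m, j m)) * contract N (p + 1) (p + 2) t j)"
      using contract_tensor_power[OF g, of "p + 1" "p + 2" "p + 2" i t] True
      unfolding K multi_indices_def by simp
    then show ?thesis
      using True by (simp add: contract_last_def tensor_power_def multi_indices_def)
  qed (simp add: contract_last_def tensor_power_def)
qed

lemma contract_last_V_module:
  assumes v: "v \<in> V_module N lam (p + 2)"
  shows "contract_last N p \<circ> v \<in> V_module N lam p"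
proof -
  note v' = v[unfolded V_module_def]
  have zero: "contract_last N p 0 = 0"
    using contract_last_scale[of N p 0 0] by (simp only: cvec.scale_zero_left)
  have "linear_on (weyl_module N lam) (contract_last N p \<circ> v)"
    unfolding linear_on_def
    by (simp add: Hom_add[OF v'] Hom_scale[OF v'] contract_last_add contract_last_scale)
  moreover have "(contract_last N p \<circ> v) ` weyl_module N lam \<subseteq> tensors N p"
    using contract_last_in by auto
  moreover have "(contract_last N p \<circ> v) (tensor_power N (card lam) g \<circ> \<phi>)
      = tensor_power N p g ((contract_last N p \<circ> v) \<phi>)"
    if "g \<in> orthogonal_group N" "\<phi> \<in> weyl_module N lam" for g \<phi>
    using Hom_equivariant[OF v' that] contract_last_tensor_power[OF that(1)] by simp
  moreover have "(contract_last N p \<circ> v) \<phi> = 0" if "\<phi> \<notin> weyl_module N lam" for \<phi>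
    using Hom_outside[OF v' that] zero by simp
  ultimately show ?thesis unfolding V_module_def Hom_def by blast
qed

lemma contract_last_isotypic:
  assumes t: "t \<in> isotypic N lam (p + 2)"
  shows "contract_last N p t \<in> isotypic N lam p"
proof -
  have "t \<in> {t. contract_last N p t \<in> isotypic N lam p}"
    using t
  proof (rule isotypic_induct)
    show "csubspace {t. contract_last N p t \<in> isotypic N lam p}"
      by (intro subspace_preimage csubspace_isotypic contract_last_add contract_last_scale)
    fix v assume v: "v \<in> V_module N lam (p + 2)"
    show "v ` weyl_module N lam \<subseteq> {t. contract_last N p t \<in> isotypic N lam p}"
    proof (rule image_subsetI)
      fix \<phi> assume \<phi>: "\<phi> \<in> weyl_module N lam"
      show "v \<phi> \<in> {t. contract_last N p t \<in> isotypic N lam p}"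
        unfolding mem_Collect_eq
        using isotypic_base[OF contract_last_V_module[OF v] \<phi>] by (simp only: comp_apply)
    qed
  qed
  then show ?thesis by blast
qed

lemma contract_last_slice:
  "contract_last N p (slice N (p + 2) t i) = (\<Sum>c<N. slice N p t (i(p + 1 := c, p + 2 := c)))"
proof
  fix j
  show "contract_last N p (slice N (p + 2) t i) j = (\<Sum>c<N. slice N p t (i(p + 1 := c, p + 2 := c))) j"
  proof (cases "j \<in> multi_indices N p")
    case j: True
    have "slice N (p + 2) t i (j(p + 1 := c, p + 2 := c)) = slice N p t (i(p + 1 := c, p + 2 := c)) j"
      if c: "c < N" for c
    proof -
      have "j(p + 1 := c, p + 2 := c) \<in> multi_indices N (p + 2)"
        using j c by (auto simp: multi_indices_def PiE_iff extensional_def)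
      moreover have "(\<lambda>m. if m \<in> {1..p + 2} then (j(p + 1 := c, p + 2 := c)) m else i m)
          = (\<lambda>m. if m \<in> {1..p} then j m else (i(p + 1 := c, p + 2 := c)) m)"
        by (auto simp: fun_eq_iff)
      ultimately show ?thesis
        using j unfolding slice_def by (simp only: if_True)
    qed
    then show ?thesis
      using j unfolding contract_last_def contract_def fun_sum_apply by (simp only: if_True) (rule sum.cong, auto)
  qed (simp add: contract_last_def fun_sum_apply slice_def)
qed

section \<open>Contraction of the canonical vectors\<close>

theorem proposition3p1:
  fixes n N k :: nat and lam :: diagram and \<Lambda> :: "nat \<Rightarrow> diagram" and v :: brauer_vector
  assumes "n \<ge> 1" and "N \<ge> 1"
    and "lam \<in> diagrams n N"
    and "\<Lambda> \<in> diagram_paths N lam n"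
    and "k \<in> {1..n - 1}"
    and "\<Lambda> (k - 1) \<noteq> \<Lambda> (k + 1)"
    and "canonical_vector N lam n \<Lambda> v"
  shows "brauer_action N n (sbar n k) v = 0"
proof -
  define p where "p = k - 1"
  have k: "k = p + 1" "k + 1 = p + 2" and kn: "p + 2 \<le> n"
    using assms(5) by (auto simp: p_def)
  let ?mu = "\<Lambda> p" and ?nu = "\<Lambda> (p + 2)"
  have young: "young_diagram (\<Lambda> j)" if "j \<le> n" for j
    using assms(4) that by (auto simp: diagram_paths_def diagrams_def PiE_iff)
  have start: "\<Lambda> 0 = {}" and final: "\<Lambda> n = lam"
    using assms(4) by (auto simp: diagram_paths_def)
  have ne: "?mu \<noteq> ?nu" using assms(6) by (simp add: k)
  have mu: "young_diagram ?mu" and nu: "young_diagram ?nu" using young kn by auto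
  have v: "v \<in> V_module N lam n" and comp: "\<And>j. j \<in> {1..n - 1} \<Longrightarrow> v \<in> V_component N lam n (\<Lambda> j) j"
    using assms(7) by (auto simp: canonical_vector_def)
  \<comment> \<open>For \<open>p + 2 = n\<close> there is no condition on the component; the slice is the whole tensor.\<close>
  have upper: "slice N (p + 2) (v y) i \<in> isotypic N ?nu (p + 2)" if i: "i \<in> multi_indices N n" for y i
  proof (cases "p + 2 = n")
    case True
    have "v y \<in> isotypic N lam n"
      using isotypic_projection_in[of N lam n "v y"]
      unfolding fun_cong[OF isotypic_projection_fixes[OF v], of y, unfolded comp_apply] .
    then show ?thesis
      using slice_full[OF isotypic_tensors i] True final by (simp only:)
  next
    case False
    then show ?thesis using kn by (intro slice_in_isotypic[OF comp _ i]) auto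
  qed
  have contracted: "contract N k (k + 1) (v y) i = 0" if i: "i \<in> multi_indices N n" for y i
  proof -
    let ?s = "contract_last N p (slice N (p + 2) (v y) i)"
    have s_nu: "?s \<in> isotypic N ?nu p" by (intro contract_last_isotypic upper i)
    have "?s = 0"
    proof (cases "p = 0")
      case True
      then show ?thesis
        using isotypic_degree_0[of ?nu ?s N] s_nu nu ne start by (simp add: young_diagram_def)
    next
      case False
      have "?s \<in> isotypic N ?mu p"
        unfolding contract_last_slice
      proof (rule cvec.subspace_sum[OF csubspace_isotypic])
        fix c assume c: "c \<in> {..<N}"
        have "i(p + 1 := c, p + 2 := c) \<in> multi_indices N n"
          using i c kn by (auto simp: multi_indices_def PiE_iff extensional_def)
        then show "slice N p (v y) (i(p + 1 := c, p + 2 := c)) \<in> isotypic N ?mu p"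
          using False kn by (intro slice_in_isotypic[OF comp]) auto
      qed
      then show ?thesis using isotypic_disjoint[OF mu nu ne] s_nu by blast
    qed
    then have "0 = (\<Sum>c<N. slice N p (v y) (i(p + 1 := c, p + 2 := c))) (restrict i {1..p})"
      unfolding contract_last_slice by (simp only: zero_fun_apply)
    also have "\<dots> = contract N (p + 1) (p + 2) (v y) i"
      unfolding fun_sum_apply contract_def
    proof (rule sum.cong[OF refl])
      fix c
      have "restrict i {1..p} \<in> multi_indices N p"
        using i kn by (auto simp: multi_indices_def PiE_iff)
      moreover have "(\<lambda>m. if m \<in> {1..p} then restrict i {1..p} m else (i(p + 1 := c, p + 2 := c)) m)
          = i(p + 1 := c, p + 2 := c)"
        by (auto simp: fun_eq_iff)
      ultimately show "slice N p (v y) (i(p + 1 := c, p + 2 := c)) (restrict i {1..p})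
          = v y (i(p + 1 := c, p + 2 := c))"
        unfolding slice_def by (simp only: if_True)
    qed
    finally show ?thesis unfolding k(2) unfolding k(1) by (rule sym)
  qed
  have "k \<in> {1..n}" "k + 1 \<in> {1..n}" "k \<noteq> k + 1" using assms(5) by auto
  note op = contraction_operator[OF this]
  have "brauer_action N n (sbar n k) v y i = 0" for y i
    unfolding brauer_action_def sbar_def comp_apply op using contracted[of i y] by auto
  then show ?thesis
    by (intro ext) (simp only: zero_fun_apply)
qed

end
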